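(* Let $t\in(0,1)$, $r=\sqrt{1-t^2}$, and let $\{\theta_k\}_{k\in\mathbb Z}$ and $\{\alpha_k\}_{k\in\mathbb Z}$ be random phases such that all the variables $\theta_k,\alpha_k$ ($k\in\mathbb Z$) are independent and uniformly distributed on the torus $\mathbb T=\mathbb R/2\pi\mathbb Z$. Let $U_\omega=M(\{\theta_k(\omega)\},\{\alpha_k(\omega)\},\{0\})$ be the corresponding random unitary operator on $\ell^2(\mathbb Z)$ (with constant coefficients $t_k=t$, $r_k=r$). Then, almost surely, $$\sigma_{a.c.}(U_\omega)=\emptyset .$$
   Context: Let $(\varphi_k)_{k\in\mathbb Z}$ be the canonical orthonormal basis of $\ell^2(\mathbb Z)$. For sequences of real phases $\{\theta_k\},\{\alpha_k\},\{\gamma_k\}$, $k\in\mathbb Z$, and constants $r,t$ with $r^2+t^2=1$, put $$S_k=e^{-i\theta_k}\begin{pmatrix} r e^{-i\alpha_k} & i t e^{i\gamma_k}\\ i t e^{-i\gamma_k} & r e^{i\alpha_k}\end{pmatrix}.$$ $U_e$ is the unitary operator acting on each $\mathrm{span}\{\varphi_{2k},\varphi_{2k+1}\}$, $k\in\mathbb Z$, by the matrix $S_{2k}$ in the ordered basis $(\varphi_{2k},\varphi_{2k+1})$; $U_o$ is the unitary operator acting on each $\mathrm{span}\{\varphi_{2k+1},\varphi_{2k+2}\}$ by $S_{2k+1}$ in the ordered basis $(\varphi_{2k+1},\varphi_{2k+2})$. Set $M(\{\theta_k\},\{\alpha_k\},\{\gamma_k\}):=U_oU_e$. $\sigma_{a.c.}$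 denotes the absolutely continuous spectrum. *)

theory Defs
  imports "HOL-Probability.Probability"
begin

section \<open>The Hilbert space of square-summable sequences over the integers\<close>

text \<open>Vectors are coordinate functions with respect to the canonical basis, and operators act on
  such functions; only their restriction to \<open>ell2\<close> is ever used.\<close>

definition ell2 :: "(int \<Rightarrow> complex) set" where
  "ell2 = {f. (\<lambda>k. (cmod (f k))\<^sup>2) summable_on UNIV}"

definition ell2_inner :: "(int \<Rightarrow> complex) \<Rightarrow> (int \<Rightarrow> complex) \<Rightarrow> complex" where
  "ell2_inner f g = (\<Sum>\<^sub>\<infinity>k. cnj (f k) * g k)"

definition ell2_norm :: "(int \<Rightarrow> complex) \<Rightarrow> real" where
  "ell2_norm f = sqrt (\<Sum>\<^sub>\<infinity>k. (cmod (f k))\<^sup>2)"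


section \<open>Spectrum and absolutely continuous spectrum\<close>

text \<open>Spectrum of the restriction of \<open>T\<close> to the invariant subspace \<open>H\<close>: the complement of the
  set of all \<open>z\<close> for which \<open>T - z\<close> is a bijection of \<open>H\<close> with bounded inverse.\<close>

definition spectrum_on ::
  "(int \<Rightarrow> complex) set \<Rightarrow> ((int \<Rightarrow> complex) \<Rightarrow> (int \<Rightarrow> complex)) \<Rightarrow> complex set" where
  "spectrum_on H T =
     {z. \<not> (bij_betw (\<lambda>f k. T f k - z * f k) H H \<and>
            (\<exists>C. \<forall>f\<in>H. ell2_norm f \<le> C * ell2_norm (\<lambda>k. T f k - z * f k)))}"

text \<open>The spectral measure of a unitary \<open>U\<close> at the vector \<open>f\<close> is the unique finite Borel measure
  on the unit circle with moments \<open>\<langle>f, U\<^sup>n f\<rangle>\<close>. Nonnegative \<open>n\<close> suffice, because the moments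
  of order \<open>-n\<close> are the complex conjugates of those of order \<open>n\<close> on both sides.\<close>

definition is_spectral_measure ::
  "((int \<Rightarrow> complex) \<Rightarrow> (int \<Rightarrow> complex)) \<Rightarrow> (int \<Rightarrow> complex) \<Rightarrow> complex measure \<Rightarrow> bool" where
  "is_spectral_measure U f \<mu> \<longleftrightarrow>
     finite_measure \<mu> \<and> sets \<mu> = sets borel \<and> emeasure \<mu> (- sphere 0 1) = 0 \<and>
     (\<forall>n::nat. (LINT z|\<mu>. z ^ n) = ell2_inner f ((U ^^ n) f))"

definition circle_lebesgue :: "complex measure" where
  "circle_lebesgue = distr (restrict_space lborel {0..<2 * pi}) borel cis"

text \<open>For unitary \<open>U\<close> every vector has exactly one spectral measure, so the existential quantifier
  here just names it.\<close>

definition ac_subspace ::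
  "((int \<Rightarrow> complex) \<Rightarrow> (int \<Rightarrow> complex)) \<Rightarrow> (int \<Rightarrow> complex) set" where
  "ac_subspace U =
     {f \<in> ell2. \<exists>\<mu>. is_spectral_measure U f \<mu> \<and> absolutely_continuous circle_lebesgue \<mu>}"

definition ac_spectrum :: "((int \<Rightarrow> complex) \<Rightarrow> (int \<Rightarrow> complex)) \<Rightarrow> complex set" where
  "ac_spectrum U = spectrum_on (ac_subspace U) U"


section \<open>The unitary band matrices\<close>

definition scatter :: "real \<Rightarrow> real \<Rightarrow> real \<Rightarrow> real \<Rightarrow> real \<Rightarrow> complex^2^2" where
  "scatter r t \<theta> \<alpha> \<gamma> =
     vector [vector [cis (-\<theta>) * (of_real r * cis (-\<alpha>)), cis (-\<theta>) * (\<i> * of_real t * cis \<gamma>)],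
             vector [cis (-\<theta>) * (\<i> * of_real t * cis (-\<gamma>)), cis (-\<theta>) * (of_real r * cis \<alpha>)]]"

text \<open>For \<open>P = even\<close> or \<open>P = odd\<close>: the operator acting on the coordinates \<open>(m, m + 1)\<close> by
  the matrix \<open>S m\<close>, for every \<open>m\<close> with \<open>P m\<close>.\<close>

definition block_op ::
  "(int \<Rightarrow> bool) \<Rightarrow> (int \<Rightarrow> complex^2^2) \<Rightarrow> (int \<Rightarrow> complex) \<Rightarrow> (int \<Rightarrow> complex)" where
  "block_op P S f n =
     (if P n then (S n *v vector [f n, f (n + 1)]) $ 1
             else (S (n - 1) *v vector [f (n - 1), f n]) $ 2)"

definition band_op ::
  "real \<Rightarrow> real \<Rightarrow> (int \<Rightarrow> real) \<Rightarrow> (int \<Rightarrow> real) \<Rightarrow> (int \<Rightarrow> real) \<Rightarrow>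
     (int \<Rightarrow> complex) \<Rightarrow> (int \<Rightarrow> complex)" where
  "band_op r t \<theta> \<alpha> \<gamma> =
     (let S = (\<lambda>k. scatter r t (\<theta> k) (\<alpha> k) (\<gamma> k)) in block_op odd S \<circ> block_op even S)"

end

theory Submission
  imports Defs "HOL-Real_Asymp.Real_Asymp" "HOL-Complex_Analysis.Great_Picard"
begin

text \<open>
  For fixed \<open>z\<close> on the circle, the equation \<open>U \<psi> = z \<psi>\<close> is solved by transfer matrices. One step
  multiplies \<open>|v|\<^sup>2\<close> by \<open>A - B p cos(\<theta> + \<beta>)\<close> with \<open>A\<^sup>2 - B\<^sup>2 = 1\<close>, \<open>0 \<le> p \<le> 1\<close> and \<open>\<theta>\<close> uniform. For
  \<open>p = 1\<close> the reciprocal of this factor is a Poisson kernel, of mean 1, so its square root has mean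
  less than 1; hence the expectation of \<open>1/|v|\<close> decays geometrically, for every initial vector
  independent of the phases used. The direction that stays polynomially bounded to the left is a
  measurable function of the phases on the left, so a.s. the solution through it grows to the right.
  By Tonelli, almost surely there is, for almost every \<open>z\<close>, no polynomially bounded solution \<open>\<psi> \<noteq> 0\<close>.

  On the other hand let \<open>f\<close> have an absolutely continuous spectral measure. The Fejer means
  \<open>D* D f / N\<close> with \<open>D = \<Sum>n<N. z\<^sup>-\<^sup>n U\<^sup>n\<close> are approximate solutions. They are bounded in \<open>L\<^sup>1(dz)\<close> with
  polynomial weights, uniformly integrable in \<open>z\<close>, and the mean of their \<open>k\<close>-th coordinate is
  \<open>f k\<close>. A limit point in the product topology is a polynomially bounded solution, hence zero;
  therefore the means tend to 0 and \<open>f = 0\<close>.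
\<close>

section \<open>Averaging over a uniform phase\<close>

text \<open>The explicit average does the work of Furstenberg's theorem: its rate
  \<open>q < 1\<close> depends on \<open>r\<close> only and is uniform in the energy and in the
  direction of the vector. The square root is essential: for \<open>p = 1\<close> the reciprocal
  \<open>1 / |v|^2\<close> is preserved in mean, so only a power strictly below it can decay. The
  exceptional set of energies depends on the environment and is only known to be a Lebesgue null
  set; nothing is claimed for all \<open>z\<close> at once. So the Fejer means of \<open>f\<close>
  must be kept from concentrating on small sets of energies, and this is exactly what absolute
  continuity provides. Three powers fit together. Weights \<open>1 / (k^2 + 1)\<close> make
  coordinate sums converge, so solutions with at most quadratic growth have to be excluded; for
  this, growth beyond a cubic is enough, and the geometric decay in mean gives it, since
  \<open>(n + 1)^3 q^n\<close> is summable.\<close>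

lemma inverse_sqrt_convex_combination:
  fixes a b p :: real
  assumes "0 < a" "0 < b" "0 \<le> p" "p \<le> 1"
  shows "1 / sqrt ((1 - p) * a + p * b) \<le> (1 - p) / sqrt a + p / sqrt b"
proof -
  define x y where "x = sqrt a" and "y = sqrt b"
  have xy: "x > 0" "y > 0" "a = x\<^sup>2" "b = y\<^sup>2"
    using assms by (auto simp: x_def y_def)
  have pos: "(1 - p) * x + p * y > 0"
    using assms xy by (metis add_nonneg_pos add_pos_nonneg diff_ge_0_iff_ge diff_gt_0_iff_gt
        less_eq_real_def mult_nonneg_nonneg mult_pos_pos zero_less_one)
  \<comment> \<open>The two estimates are Jensen's inequality for the square root and for the
    reciprocal. Both defects are \<open>p (1 - p) (x - y)^2\<close> up to a positive factor.\<close>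
  have "((1 - p) * a + p * b) - ((1 - p) * x + p * y)\<^sup>2 = p * (1 - p) * (x - y)\<^sup>2"
    unfolding xy by (simp add: power2_eq_square algebra_simps)
  also have "\<dots> \<ge> 0" using assms by simp
  finally have "(1 - p) * x + p * y \<le> sqrt ((1 - p) * a + p * b)"
    by (intro real_le_rsqrt) simp
  then have "1 / sqrt ((1 - p) * a + p * b) \<le> 1 / ((1 - p) * x + p * y)"
    using pos by (intro divide_left_mono mult_pos_pos) linarith+
  also have "\<dots> \<le> (1 - p) / x + p / y"
  proof -
    have "((1 - p) / x + p / y) * ((1 - p) * x + p * y) - 1 = p * (1 - p) * (x - y)\<^sup>2 / (x * y)"
      using xy by (simp add: field_simps power2_eq_square)
    also have "\<dots> \<ge> 0" using assms xy by simp
    finally show ?thesis using pos by (simp add: pos_divide_le_eq)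
  qed
  finally show ?thesis by (simp add: x_def y_def)
qed

text \<open>With \<open>P = 1 / y\<close> this is the gain in \<open>sqrt P \<le> (1 + P) / 2\<close>, in a form that can be
  integrated explicitly when \<open>y\<close> is affine in the cosine.\<close>

lemma inverse_sqrt_le_quadratic:
  fixes y K :: real
  assumes "0 < y" "1 / K \<le> y" "y \<le> K"
  shows "1 / sqrt y \<le> (1 + 1 / y) / 2 - (y - 1)\<^sup>2 / (2 * (1 + sqrt K)\<^sup>2 * K\<^sup>2)"
proof -
  define s where "s = 1 / sqrt y"
  have K: "K > 0" using assms by linarith
  have s: "s > 0" "s\<^sup>2 = 1 / y" using assms by (auto simp: s_def power_divide)
  have "1 / y \<le> K" using assms K by (simp add: field_simps)
  then have sK: "s \<le> sqrt K" using s by (intro real_le_rsqrt) auto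
  \<comment> \<open>The defect to be bounded is \<open>(1 - s)^2 / 2\<close>. It is compared with
    \<open>(y - 1)^2\<close> through the factorisation
    \<open>1 - 1 / y = (1 - s) (1 + s)\<close>.\<close>
  have "(1 - s)\<^sup>2 * (1 + s)\<^sup>2 = (1 - 1 / y)\<^sup>2"
    using s(2) by (simp add: power2_eq_square algebra_simps)
  also have "\<dots> = (y - 1)\<^sup>2 / y\<^sup>2" using assms by (simp add: field_simps power2_eq_square)
  finally have eq: "(1 - s)\<^sup>2 * (1 + s)\<^sup>2 = (y - 1)\<^sup>2 / y\<^sup>2" .
  have "(y - 1)\<^sup>2 / ((1 + sqrt K)\<^sup>2 * K\<^sup>2) \<le> (y - 1)\<^sup>2 / ((1 + s)\<^sup>2 * y\<^sup>2)"
    using assms s sK K by (intro divide_left_mono mult_mono power_mono) auto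
  also have "\<dots> = (1 - s)\<^sup>2"
    using eq s assms by (simp add: field_simps)
  also have "(1 - s)\<^sup>2 = 1 + 1 / y - 2 * s" using s(2) by (simp add: power2_eq_square algebra_simps)
  finally show ?thesis by (simp add: s_def[symmetric] field_simps)
qed

text \<open>Since \<open>A - B p cos\<close> is the convex combination of \<open>A\<close> and
  \<open>A - B cos\<close> with weights \<open>1 - p\<close> and \<open>p\<close>, convexity reduces
  the claim to \<open>p = 0\<close>, where the integrand is the constant
  \<open>1 / sqrt A < 1\<close>, and to \<open>p = 1\<close>, where the quadratic gain over the
  Poisson kernel is integrated.\<close>

lemma inverse_sqrt_average_contraction:
  fixes r :: real
  assumes r: "0 < r" "r < 1"
  defines "A \<equiv> (1 + r\<^sup>2) / (1 - r\<^sup>2)" and "B \<equiv> 2 * r / (1 - r\<^sup>2)"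
  shows "\<exists>q. 0 < q \<and> q < 1 \<and> (\<forall>p \<beta>. 0 \<le> p \<longrightarrow> p \<le> 1 \<longrightarrow>
      (\<integral>\<^sup>+\<theta>\<in>{0..2 * pi}. ennreal (1 / sqrt (A - B * p * cos (\<theta> + \<beta>))) \<partial>lborel) \<le> ennreal (2 * pi * q))"
proof -
  have r2: "0 < 1 - r\<^sup>2" "1 - r\<^sup>2 < 1 + r\<^sup>2"
    using r by (auto simp: power_less_one_iff abs_square_less_1)
  have A1: "A > 1" and B0: "B > 0" using r r2 by (auto simp: A_def B_def field_simps)
  define K where "K = A + B"
  have AB: "(A - B) * (A + B) = 1"
  proof -
    have "(A - B) * (A + B) = ((1 + r\<^sup>2)\<^sup>2 - (2 * r)\<^sup>2) / (1 - r\<^sup>2)\<^sup>2"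
      unfolding A_def B_def by (simp add: diff_divide_distrib[symmetric] add_divide_distrib[symmetric])
        (simp add: power2_eq_square algebra_simps)
    also have "(1 + r\<^sup>2)\<^sup>2 - (2 * r)\<^sup>2 = (1 - r\<^sup>2)\<^sup>2" by (simp add: power2_eq_square algebra_simps)
    finally show ?thesis using r2 by simp
  qed
  have K: "K > 1" using A1 B0 by (simp add: K_def)
  have ABK: "A - B = 1 / K" using AB K by (simp add: K_def field_simps)
  then have ABp: "A - B > 0" using K by simp
  have range: "A - B \<le> A - B * c" "A - B * c \<le> K" if "\<bar>c\<bar> \<le> 1" for c
    using that B0 by (auto simp: K_def abs_le_iff intro: mult_left_le)
       (metis minus_le_iff mult.commute mult_minus_right mult_left_le_one_le mult_left_mono less_eq_real_def mult.right_neutral)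
  define \<kappa> where "\<kappa> = 1 / (2 * (1 + sqrt K)\<^sup>2 * K\<^sup>2)"
  have \<kappa>: "\<kappa> > 0" using K by (auto simp: \<kappa>_def intro!: divide_pos_pos mult_pos_pos zero_less_power add_pos_nonneg)
  \<comment> \<open>The entries bound the means for \<open>p = 0\<close> and \<open>p = 1\<close>.
    For \<open>y = A - B cos\<close>, the mean of \<open>1 / y\<close> is 1 and the mean of
    \<open>(y - 1)^2\<close> is \<open>(A - 1)^2 + B^2 / 2\<close>.\<close>
  define q where "q = max (1 / sqrt A) (1 - \<kappa> * ((A - 1)\<^sup>2 + B\<^sup>2 / 2))"
  have q: "0 < q" "q < 1"
  proof -
    show "0 < q" using A1 by (auto simp: q_def less_max_iff_disj)
    have "\<kappa> * ((A - 1)\<^sup>2 + B\<^sup>2 / 2) > 0" using \<kappa> B0 by (intro mult_pos_pos add_nonneg_pos) auto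
    then show "q < 1" using A1 by (auto simp: q_def)
  qed
  have "(\<integral>\<^sup>+\<theta>\<in>{0..2 * pi}. ennreal (1 / sqrt (A - B * p * cos (\<theta> + \<beta>))) \<partial>lborel) \<le> ennreal (2 * pi * q)"
    if p: "0 \<le> p" "p \<le> 1" for p \<beta>
  proof -
    define b where "b = (1 - p) / sqrt A"
    define u where "u = (\<lambda>\<theta>. b + p * ((1 + 1 / (A - B * cos (\<theta> + \<beta>))) / 2
        - \<kappa> * (A - B * cos (\<theta> + \<beta>) - 1)\<^sup>2))"
    \<comment> \<open>An antiderivative of \<open>u\<close>. The arctangent is the imaginary part of
      \<open>- log (1 - r exp (i (\<theta> + \<beta>)))\<close>; its derivative is half of the
      Poisson kernel minus 1, and by periodicity it contributes nothing over a full period.\<close>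
    define F where "F = (\<lambda>\<theta>. b * \<theta> + p * (\<theta> +
        arctan (r * sin (\<theta> + \<beta>) / (1 - r * cos (\<theta> + \<beta>)))
        - \<kappa> * ((A - 1)\<^sup>2 * \<theta> - 2 * (A - 1) * B * sin (\<theta> + \<beta>)
            + B\<^sup>2 * (\<theta> / 2 + sin (\<theta> + \<beta>) * cos (\<theta> + \<beta>) / 2))))"
    have le_u: "1 / sqrt (A - B * p * cos (\<theta> + \<beta>)) \<le> u \<theta>" for \<theta>
    proof -
      define y where "y = A - B * cos (\<theta> + \<beta>)"
      have y: "1 / K \<le> y" "y \<le> K" "0 < y"
        using range[of "cos (\<theta> + \<beta>)"] ABK ABp unfolding y_def
        by (simp, simp, smt (verit) abs_cos_le_one)
      have "1 / sqrt (A - B * p * cos (\<theta> + \<beta>)) = 1 / sqrt ((1 - p) * A + p * y)"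
        by (simp add: y_def algebra_simps)
      also have "\<dots> \<le> (1 - p) / sqrt A + p / sqrt y"
        using inverse_sqrt_convex_combination[of A y p] A1 y p by auto
      also have "\<dots> = (1 - p) / sqrt A + p * (1 / sqrt y)" by simp
      also have "\<dots> \<le> u \<theta>"
        using inverse_sqrt_le_quadratic[of y K] y p
        unfolding u_def b_def y_def[symmetric] \<kappa>_def by (intro add_left_mono mult_left_mono) auto
      finally show ?thesis .
    qed
    have arg_pos: "A - B * (p * cos (\<theta> + \<beta>)) > 0" for \<theta>
    proof -
      have "\<bar>p * cos (\<theta> + \<beta>)\<bar> \<le> 1" using p by (simp add: abs_mult mult_le_one)
      from range(1)[OF this] ABp show ?thesis by linarith
    qed
    then have u0: "0 \<le> u \<theta>" for \<theta>
      using le_u[of \<theta>] by (smt (verit, best) mult.assoc real_sqrt_ge_zero zero_le_divide_1_iff)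
    have F': "(F has_real_derivative u \<theta>) (at \<theta>)" for \<theta>
    proof -
      define s c where "s = sin (\<theta> + \<beta>)" and "c = cos (\<theta> + \<beta>)"
      have sc: "s\<^sup>2 = 1 - c\<^sup>2" by (simp add: s_def c_def sin_squared_eq)
      have c1: "\<bar>c\<bar> \<le> 1" by (simp add: c_def)
      have d: "1 - r * c > 0"
      proof -
        have "r * c \<le> r * 1" using r c1 by (intro mult_left_mono) auto
        then show ?thesis using r by linarith
      qed
      have sq: "(1 - r * c)\<^sup>2 + (r * s)\<^sup>2 = 1 + r\<^sup>2 - 2 * r * c"
        using sc by algebra
      have sqpos: "1 + r\<^sup>2 - 2 * r * c > 0"
        using d sq by (smt (verit, ccfv_SIG) zero_less_power zero_le_power2)
      have at: "((\<lambda>\<theta>. arctan (r * sin (\<theta> + \<beta>) / (1 - r * cos (\<theta> + \<beta>)))) has_real_derivative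
          (r * c - r\<^sup>2) / (1 + r\<^sup>2 - 2 * r * c)) (at \<theta>)"
      proof -
        have "((\<lambda>\<theta>. arctan (r * sin (\<theta> + \<beta>) / (1 - r * cos (\<theta> + \<beta>)))) has_real_derivative
          ((r * c * (1 - r * c) - r * s * (r * s)) / (1 - r * c)\<^sup>2) / (1 + (r * s / (1 - r * c))\<^sup>2)) (at \<theta>)"
          using d unfolding s_def c_def
          by (auto intro!: derivative_eq_intros simp: power2_eq_square field_simps)
        also have "((r * c * (1 - r * c) - r * s * (r * s)) / (1 - r * c)\<^sup>2) / (1 + (r * s / (1 - r * c))\<^sup>2)
            = (r * c * (1 - r * c) - r * s * (r * s)) / ((1 - r * c)\<^sup>2 + (r * s)\<^sup>2)"
        proof -
          have *: "1 + (r * s / (1 - r * c))\<^sup>2 = ((1 - r * c)\<^sup>2 + (r * s)\<^sup>2) / (1 - r * c)\<^sup>2"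
            using d by (simp add: power_divide add_divide_distrib)
          show ?thesis unfolding * using d by simp
        qed
        also have "r * c * (1 - r * c) - r * s * (r * s) = r * c - r\<^sup>2"
          using sc by algebra
        finally show ?thesis using sq by simp
      qed
      have P: "1 / (A - B * c) = 1 + 2 * ((r * c - r\<^sup>2) / (1 + r\<^sup>2 - 2 * r * c))"
      proof -
        have "A - B * c = (1 + r\<^sup>2 - 2 * r * c) / (1 - r\<^sup>2)"
          by (simp add: A_def B_def diff_divide_distrib)
        then have "1 / (A - B * c) = (1 - r\<^sup>2) / (1 + r\<^sup>2 - 2 * r * c)" by simp
        then show ?thesis using sqpos by (simp add: field_simps)
      qed
      have "(F has_real_derivative b + p * (1 + (r * c - r\<^sup>2) / (1 + r\<^sup>2 - 2 * r * c)
         - \<kappa> * ((A - 1)\<^sup>2 - 2 * (A - 1) * B * c + B\<^sup>2 * (1 / 2 + (c * c - s * s) / 2)))) (at \<theta>)"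
        unfolding F_def
        by (rule derivative_eq_intros at refl | simp)+ (simp add: s_def c_def)
      moreover have "1 / 2 + (c * c - s * s) / 2 = c\<^sup>2"
        using sc by (simp add: power2_eq_square diff_divide_distrib)
      then have "(A - 1)\<^sup>2 - 2 * (A - 1) * B * c + B\<^sup>2 * (1 / 2 + (c * c - s * s) / 2) = (A - B * c - 1)\<^sup>2"
        by (simp add: power2_eq_square algebra_simps)
      moreover have "1 + (r * c - r\<^sup>2) / (1 + r\<^sup>2 - 2 * r * c) = (1 + 1 / (A - B * c)) / 2"
        unfolding P by simp
      ultimately show ?thesis by (simp only: u_def c_def)
    qed
    have F_eq: "F (2 * pi) - F 0 = 2 * pi * ((1 - p) / sqrt A + p * (1 - \<kappa> * ((A - 1)\<^sup>2 + B\<^sup>2 / 2)))"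
    proof -
      have "sin (2 * pi + \<beta>) = sin \<beta>" "cos (2 * pi + \<beta>) = cos \<beta>" by (simp_all add: sin_add cos_add)
      then show ?thesis by (simp add: F_def b_def algebra_simps)
    qed
    have "(1 - p) * (1 / sqrt A) + p * (1 - \<kappa> * ((A - 1)\<^sup>2 + B\<^sup>2 / 2)) \<le> (1 - p) * q + p * q"
      using p by (intro add_mono mult_left_mono) (auto simp: q_def)
    then have F_le: "F (2 * pi) - F 0 \<le> 2 * pi * q"
      unfolding F_eq by (intro mult_left_mono) (auto simp: algebra_simps)
    have cont: "continuous_on UNIV u"
    proof -
      have "A - B * cos (\<theta> + \<beta>) \<noteq> 0" for \<theta>
        using range(1)[of "cos (\<theta> + \<beta>)"] ABp by simp
      then show ?thesis unfolding u_def by (auto intro!: continuous_intros)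
    qed
    have "(\<integral>\<^sup>+\<theta>\<in>{0..2 * pi}. ennreal (1 / sqrt (A - B * p * cos (\<theta> + \<beta>))) \<partial>lborel)
        \<le> (\<integral>\<^sup>+\<theta>. ennreal (u \<theta>) * indicator {0..2 * pi} \<theta> \<partial>lborel)"
      using le_u by (intro nn_integral_mono mult_right_mono ennreal_leI) auto
    also have "\<dots> = F (2 * pi) - F 0"
      using F' u0 cont by (intro nn_integral_FTC_Icc borel_measurable_continuous_onI)
        (auto intro: has_field_derivative_at_within)
    also have "\<dots> \<le> ennreal (2 * pi * q)" using F_le by (intro ennreal_leI)
    finally show ?thesis .
  qed
  with q show ?thesis by blast
qed

section \<open>Transfer matrices\<close>

text \<open>A block with inputs \<open>(x, x')\<close> and outputs \<open>(y, y')\<close> is solved for the primed pair in terms of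
  the unprimed one. The outputs of one layer are the inputs of the next, and the outputs of the second
  layer are \<open>z\<close> times the inputs of the first; with the result \<open>(y', z x')\<close> both kinds of blocks
  obey the same recursion, up to unimodular factors.\<close>

definition transfer_step ::
  "real \<Rightarrow> real \<Rightarrow> complex \<Rightarrow> real \<Rightarrow> real \<Rightarrow> complex \<times> complex \<Rightarrow> complex \<times> complex" where
  "transfer_step r t z \<theta> \<alpha> v =
     (cis (\<alpha> - \<theta>) * (of_real r * cis \<theta> * snd v - cis (-\<alpha>) * fst v) / (\<i> * of_real t),
      z * (cis \<theta> * snd v - of_real r * cis (-\<alpha>) * fst v) / (\<i> * of_real t))"

primrec transfer ::
  "real \<Rightarrow> real \<Rightarrow> complex \<Rightarrow> (nat \<Rightarrow> real) \<Rightarrow> (nat \<Rightarrow> real) \<Rightarrow> complex \<times> complex \<Rightarrow> nat \<Rightarrow> complex \<times> complex"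
  where
  "transfer r t z \<theta> \<alpha> v 0 = v"
| "transfer r t z \<theta> \<alpha> v (Suc n) = transfer_step r t z (\<theta> n) (\<alpha> n) (transfer r t z \<theta> \<alpha> v n)"

lemma transfer_scale:
  "transfer r t z \<theta> \<alpha> (u * fst v, u * snd v) n =
     (u * fst (transfer r t z \<theta> \<alpha> v n), u * snd (transfer r t z \<theta> \<alpha> v n))"
  by (induction n) (simp_all add: transfer_step_def algebra_simps diff_divide_distrib)

lemma transfer_add:
  "transfer r t z \<theta> \<alpha> (v + w) n = transfer r t z \<theta> \<alpha> v n + transfer r t z \<theta> \<alpha> w n"
  by (induction n)
     (simp_all add: transfer_step_def prod_eq_iff algebra_simps diff_divide_distrib add_divide_distrib)

lemma norm_scale_pair: "norm (u * a, u * b) = cmod u * norm (a, b)" for u a b :: complex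
  by (simp add: norm_Pair norm_mult power_mult_distrib flip: distrib_left)
     (simp add: real_sqrt_mult)

text \<open>Unimodular prefactors drop out of the norm. With \<theta> absorbed into one entry and
  \<alpha> into the other, \<theta> survives only as a rotation of the cross term, which makes the
  dependence on \<theta> a cosine.\<close>

lemma norm_transfer_step:
  assumes "t \<noteq> 0" "cmod z = 1"
  shows "(norm (transfer_step r t z \<theta> \<alpha> v))\<^sup>2 =
    ((1 + r\<^sup>2) * (norm v)\<^sup>2 - 4 * r * Re (cis \<theta> * (snd v * cnj (cis (-\<alpha>) * fst v)))) / t\<^sup>2"
proof -
  define a b where "a = cis \<theta> * snd v" and "b = cis (-\<alpha>) * fst v"
  have nv: "(norm v)\<^sup>2 = (cmod a)\<^sup>2 + (cmod b)\<^sup>2"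
    by (cases v) (simp add: a_def b_def norm_Pair norm_mult)
  have "(norm (transfer_step r t z \<theta> \<alpha> v))\<^sup>2
      = (cmod (cis (\<alpha> - \<theta>) * (of_real r * a - b) / (\<i> * of_real t)))\<^sup>2
        + (cmod (z * (a - of_real r * b) / (\<i> * of_real t)))\<^sup>2"
    by (simp add: transfer_step_def a_def b_def norm_Pair mult.assoc)
  also have "\<dots> = ((cmod (of_real r * a - b))\<^sup>2 + (cmod (a - of_real r * b))\<^sup>2) / t\<^sup>2"
    using assms by (simp add: norm_mult norm_divide power_divide add_divide_distrib)
  also have "(cmod (of_real r * a - b))\<^sup>2 + (cmod (a - of_real r * b))\<^sup>2
      = (1 + r\<^sup>2) * ((cmod a)\<^sup>2 + (cmod b)\<^sup>2) - 4 * r * Re (a * cnj b)"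
    by (simp add: cmod_power2) (simp add: power2_eq_square algebra_simps)
  also have "a * cnj b = cis \<theta> * (snd v * cnj (cis (-\<alpha>) * fst v))"
    by (simp add: a_def b_def)
  finally show ?thesis by (simp add: nv)
qed

text \<open>After division by \<open>|v|^2\<close>, the cross term has amplitude
  \<open>p = 2 |\<kappa>| / |v|^2\<close>, at most 1 by the arithmetic-geometric mean inequality,
  and phase \<open>Arg \<kappa>\<close>. The averaging bound is uniform in both, so one
  \<open>q\<close> serves all \<open>z\<close>, \<alpha> and \<open>v\<close>.\<close>

lemma transfer_step_average:
  assumes "0 < t" "t < 1" "r = sqrt (1 - t\<^sup>2)"
  shows "\<exists>q. 0 < q \<and> q < 1 \<and> (\<forall>z \<alpha> v. cmod z = 1 \<longrightarrow> v \<noteq> 0 \<longrightarrow>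
      (\<integral>\<^sup>+\<theta>. ennreal (1 / norm (transfer_step r t z \<theta> \<alpha> v)) \<partial>uniform_measure lborel {0..<2 * pi})
        \<le> ennreal q * ennreal (1 / norm v))"
proof -
  have t2: "t\<^sup>2 < 1" using assms by (simp add: power_less_one_iff)
  then have r: "0 < r" "r < 1" "1 - r\<^sup>2 = t\<^sup>2"
    using assms by (auto simp: real_sqrt_lt_1_iff)
  obtain q where q: "0 < q" "q < 1" and avg: "\<And>p \<beta>. 0 \<le> p \<Longrightarrow> p \<le> 1 \<Longrightarrow>
      (\<integral>\<^sup>+\<theta>\<in>{0..2 * pi}. ennreal (1 / sqrt ((1 + r\<^sup>2) / t\<^sup>2 - 2 * r / t\<^sup>2 * p * cos (\<theta> + \<beta>))) \<partial>lborel)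
       \<le> ennreal (2 * pi * q)"
    using inverse_sqrt_average_contraction[OF r(1,2)] unfolding r(3) by blast
  have "(\<integral>\<^sup>+\<theta>. ennreal (1 / norm (transfer_step r t z \<theta> \<alpha> v)) \<partial>uniform_measure lborel {0..<2 * pi})
        \<le> ennreal q * ennreal (1 / norm v)"
    if z: "cmod z = 1" and v: "v \<noteq> 0" for z \<alpha> v
  proof -
    define \<kappa> where "\<kappa> = snd v * cnj (cis (-\<alpha>) * fst v)"
    define p where "p = 2 * cmod \<kappa> / (norm v)\<^sup>2"
    have nv: "(norm v)\<^sup>2 > 0" using v by simp
    have "cmod \<kappa> = cmod (snd v) * cmod (fst v)" by (simp add: \<kappa>_def norm_mult)
    moreover have "(norm v)\<^sup>2 = (cmod (fst v))\<^sup>2 + (cmod (snd v))\<^sup>2"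
      by (cases v) (simp add: norm_Pair)
    moreover have "0 \<le> (cmod (fst v) - cmod (snd v))\<^sup>2" by simp
    ultimately have "2 * cmod \<kappa> \<le> (norm v)\<^sup>2" by (simp add: power2_eq_square algebra_simps)
    then have p: "0 \<le> p" "p \<le> 1" using nv by (auto simp: p_def)
    have eq: "1 / norm (transfer_step r t z \<theta> \<alpha> v) =
       1 / norm v * (1 / sqrt ((1 + r\<^sup>2) / t\<^sup>2 - 2 * r / t\<^sup>2 * p * cos (\<theta> + Arg \<kappa>)))" for \<theta>
    proof -
      have "Re (cis \<theta> * \<kappa>) = cmod \<kappa> * cos (\<theta> + Arg \<kappa>)"
        by (subst rcis_cmod_Arg[of \<kappa>, symmetric]) (simp add: rcis_def cos_add algebra_simps del: rcis_cmod_Arg)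
      moreover have "(norm (transfer_step r t z \<theta> \<alpha> v))\<^sup>2 =
         ((1 + r\<^sup>2) * (norm v)\<^sup>2 - 4 * r * Re (cis \<theta> * \<kappa>)) / t\<^sup>2"
        unfolding \<kappa>_def using assms z by (intro norm_transfer_step) auto
      moreover have "2 * cmod \<kappa> = (norm v)\<^sup>2 * p" using nv by (simp add: p_def)
      then have "4 * r * (cmod \<kappa> * cos (\<theta> + Arg \<kappa>)) = (norm v)\<^sup>2 * (2 * r * p * cos (\<theta> + Arg \<kappa>))"
        by algebra
      ultimately have "(norm (transfer_step r t z \<theta> \<alpha> v))\<^sup>2 =
         (norm v)\<^sup>2 * ((1 + r\<^sup>2) / t\<^sup>2 - 2 * r / t\<^sup>2 * p * cos (\<theta> + Arg \<kappa>))"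
        by (simp add: right_diff_distrib diff_divide_distrib)
      then have "norm (transfer_step r t z \<theta> \<alpha> v) =
         sqrt ((norm v)\<^sup>2 * ((1 + r\<^sup>2) / t\<^sup>2 - 2 * r / t\<^sup>2 * p * cos (\<theta> + Arg \<kappa>)))"
        by (metis norm_ge_zero real_sqrt_abs abs_of_nonneg)
      then show ?thesis by (simp add: real_sqrt_mult)
    qed
    have "(\<integral>\<^sup>+\<theta>. ennreal (1 / norm (transfer_step r t z \<theta> \<alpha> v)) \<partial>uniform_measure lborel {0..<2 * pi})
        = (\<integral>\<^sup>+\<theta>. ennreal (1 / norm v * (1 / sqrt ((1 + r\<^sup>2) / t\<^sup>2 - 2 * r / t\<^sup>2 * p * cos (\<theta> + Arg \<kappa>))))
             * indicator {0..<2 * pi} \<theta> \<partial>lborel) / ennreal (2 * pi)"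
      unfolding eq by (subst nn_integral_uniform_measure) auto
    also have "\<dots> \<le> (\<integral>\<^sup>+\<theta>. ennreal (1 / norm v) *
         (ennreal (1 / sqrt ((1 + r\<^sup>2) / t\<^sup>2 - 2 * r / t\<^sup>2 * p * cos (\<theta> + Arg \<kappa>))) * indicator {0..2 * pi} \<theta>)
          \<partial>lborel) / ennreal (2 * pi)"
      by (intro divide_right_mono_ennreal nn_integral_mono)
         (auto simp: ennreal_mult'[symmetric] split: split_indicator)
    also have "\<dots> \<le> ennreal (1 / norm v) * ennreal (2 * pi * q) / ennreal (2 * pi)"
      using avg[of p "Arg \<kappa>"] p
      by (subst nn_integral_cmult) (auto intro!: divide_right_mono_ennreal mult_left_mono)
    also have "\<dots> = ennreal q * ennreal (1 / norm v)"
      using q by (simp add: ennreal_mult'[symmetric] divide_ennreal field_simps)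
    finally show ?thesis .
  qed
  with q show ?thesis by blast
qed

text \<open>Needed because \<open>1 / norm 0\<close> is 0: a vanishing vector would make the
  reciprocal norm small without any growth. Invertibility comes from \<open>r^2 < 1\<close>.\<close>

lemma transfer_step_nonzero:
  assumes "t \<noteq> 0" "cmod z = 1" "r\<^sup>2 < 1" "v \<noteq> 0"
  shows "transfer_step r t z \<theta> \<alpha> v \<noteq> 0"
proof
  assume "transfer_step r t z \<theta> \<alpha> v = 0"
  then have a: "of_real r * (cis \<theta> * snd v) = cis (-\<alpha>) * fst v"
    and b: "cis \<theta> * snd v = of_real r * (cis (-\<alpha>) * fst v)"
    using assms by (auto simp: transfer_step_def zero_prod_def mult.assoc)
  have "cis (-\<alpha>) * fst v = of_real (r\<^sup>2) * (cis (-\<alpha>) * fst v)"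
    using a b by (simp add: power2_eq_square algebra_simps)
  then have "(1 - of_real (r\<^sup>2)) * (cis (-\<alpha>) * fst v) = 0" by (simp add: algebra_simps)
  moreover have "1 - complex_of_real (r\<^sup>2) \<noteq> 0"
    using assms(3) by (metis eq_iff_diff_eq_0 less_irrefl of_real_1 of_real_eq_iff)
  ultimately have "fst v = 0" by simp
  with b have "snd v = 0" by simp
  with \<open>fst v = 0\<close> assms show False by (auto simp: prod_eq_iff)
qed

lemma transfer_nonzero:
  assumes "t \<noteq> 0" "cmod z = 1" "r\<^sup>2 < 1" "v \<noteq> 0"
  shows "transfer r t z \<theta> \<alpha> v n \<noteq> 0"
  using assms by (induction n) (auto dest: transfer_step_nonzero)

text \<open>One variable is independent of the tuple of all the others, so Tonelli for the joint law
  of this pair integrates it out with the rest of the environment frozen. Here \<open>f\<close> may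
  depend on the whole environment, as the limit direction on the left does.\<close>

lemma (in prob_space) nn_integral_resample:
  fixes Y :: "'i \<Rightarrow> 'a \<Rightarrow> real"
  assumes ind: "indep_vars (\<lambda>_. borel) Y UNIV"
    and f[measurable]: "f \<in> borel_measurable (Pi\<^sub>M UNIV (\<lambda>_. borel))"
  shows "(\<integral>\<^sup>+\<omega>. f (\<lambda>i. Y i \<omega>) \<partial>M) = (\<integral>\<^sup>+\<omega>. (\<integral>\<^sup>+u. f ((\<lambda>i. Y i \<omega>)(j := u)) \<partial>distr M borel (Y j)) \<partial>M)"
proof -
  have Y[measurable]: "Y i \<in> borel_measurable M" for i
    using ind by (auto simp: indep_vars_def)
  let ?A = "Pi\<^sub>M {j} (\<lambda>_. borel :: real measure)" and ?B = "Pi\<^sub>M (UNIV - {j}) (\<lambda>_. borel :: real measure)"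
  let ?X = "\<lambda>\<omega>. restrict (\<lambda>i. Y i \<omega>) {j}" and ?Z = "\<lambda>\<omega>. restrict (\<lambda>i. Y i \<omega>) (UNIV - {j})"
  have "indep_var ?A ?X ?B ?Z"
    by (rule indep_var_restrict[OF ind]) auto
  then have X[measurable]: "?X \<in> M \<rightarrow>\<^sub>M ?A" and Z[measurable]: "?Z \<in> M \<rightarrow>\<^sub>M ?B"
    and D: "distr M ?A ?X \<Otimes>\<^sub>M distr M ?B ?Z = distr M (?A \<Otimes>\<^sub>M ?B) (\<lambda>\<omega>. (?X \<omega>, ?Z \<omega>))"
    by (auto simp: indep_var_distribution_eq)
  \<comment> \<open>Reassembles an environment from its coordinate \<open>j\<close> and the
    remaining ones.\<close>
  let ?g = "\<lambda>(x, z). f (\<lambda>i. if i = j then x j else z i)"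
  have [measurable]: "(\<lambda>(x, z) i. if i = j then x j else z i) \<in> (?A \<Otimes>\<^sub>M ?B) \<rightarrow>\<^sub>M Pi\<^sub>M UNIV (\<lambda>_. borel)"
  proof (intro measurable_PiM_single')
    fix i
    show "(\<lambda>p. (case p of (x, z) \<Rightarrow> \<lambda>i. if i = j then x j else z i) i) \<in> borel_measurable (?A \<Otimes>\<^sub>M ?B)"
      by (cases "i = j") (auto simp: split_beta' intro!: measurable_compose[OF measurable_fst]
            measurable_compose[OF measurable_snd] measurable_component_singleton)
  qed auto
  have g[measurable]: "?g \<in> borel_measurable (?A \<Otimes>\<^sub>M ?B)"
    using measurable_compose[OF \<open>(\<lambda>(x, z) i. if i = j then x j else z i) \<in> _\<close> f] by (simp add: split_beta')
  interpret PX: prob_space "distr M ?A ?X" by (rule prob_space_distr) simp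
  interpret PZ: prob_space "distr M ?B ?Z" by (rule prob_space_distr) simp
  interpret P: pair_sigma_finite "distr M ?A ?X" "distr M ?B ?Z" ..
  have glue: "(\<lambda>i. if i = j then Y i \<omega> else Y i \<omega>') = (\<lambda>i. Y i \<omega>')(j := Y j \<omega>)" for \<omega> \<omega>'
    by auto
  have "(\<integral>\<^sup>+\<omega>. f (\<lambda>i. Y i \<omega>) \<partial>M) = (\<integral>\<^sup>+\<omega>. ?g (?X \<omega>, ?Z \<omega>) \<partial>M)"
    by (intro nn_integral_cong) (auto intro!: arg_cong[where f=f])
  also have "\<dots> = (\<integral>\<^sup>+p. ?g p \<partial>distr M (?A \<Otimes>\<^sub>M ?B) (\<lambda>\<omega>. (?X \<omega>, ?Z \<omega>)))"
    by (subst nn_integral_distr) auto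
  also have "\<dots> = (\<integral>\<^sup>+p. ?g p \<partial>(distr M ?A ?X \<Otimes>\<^sub>M distr M ?B ?Z))"
    by (simp add: D)
  also have "\<dots> = (\<integral>\<^sup>+z. (\<integral>\<^sup>+x. ?g (x, z) \<partial>distr M ?A ?X) \<partial>distr M ?B ?Z)"
    by (subst P.nn_integral_snd) auto
  also have "\<dots> = (\<integral>\<^sup>+\<omega>. (\<integral>\<^sup>+x. ?g (x, ?Z \<omega>) \<partial>distr M ?A ?X) \<partial>M)"
    by (subst nn_integral_distr) auto
  also have "\<dots> = (\<integral>\<^sup>+\<omega>. (\<integral>\<^sup>+\<omega>'. ?g (?X \<omega>', ?Z \<omega>) \<partial>M) \<partial>M)"
  proof (rule nn_integral_cong)
    fix \<omega> assume "\<omega> \<in> space M"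
    then have [measurable]: "?Z \<omega> \<in> space ?B" using measurable_space[OF Z] by blast
    show "(\<integral>\<^sup>+x. ?g (x, ?Z \<omega>) \<partial>distr M ?A ?X) = (\<integral>\<^sup>+\<omega>'. ?g (?X \<omega>', ?Z \<omega>) \<partial>M)"
      by (subst nn_integral_distr) (auto intro: measurable_compose[OF measurable_Pair2' g])
  qed
  also have "\<dots> = (\<integral>\<^sup>+\<omega>. (\<integral>\<^sup>+\<omega>'. f ((\<lambda>i. Y i \<omega>)(j := Y j \<omega>')) \<partial>M) \<partial>M)"
    by (intro nn_integral_cong) (auto intro!: arg_cong[where f=f])
  also have "\<dots> = (\<integral>\<^sup>+\<omega>. (\<integral>\<^sup>+u. f ((\<lambda>i. Y i \<omega>)(j := u)) \<partial>distr M borel (Y j)) \<partial>M)"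
  proof (rule nn_integral_cong)
    fix \<omega>
    have "(\<lambda>u. (\<lambda>i. Y i \<omega>)(j := u)) \<in> borel \<rightarrow>\<^sub>M Pi\<^sub>M UNIV (\<lambda>_. borel)"
      by (intro measurable_PiM_single') auto
    from measurable_compose[OF this f]
    show "(\<integral>\<^sup>+\<omega>'. f ((\<lambda>i. Y i \<omega>)(j := Y j \<omega>')) \<partial>M) = (\<integral>\<^sup>+u. f ((\<lambda>i. Y i \<omega>)(j := u)) \<partial>distr M borel (Y j))"
      by (subst nn_integral_distr) auto
  qed
  finally show ?thesis .
qed

lemma transfer_step_measurable[measurable]:
  assumes [measurable]: "z \<in> borel_measurable N" "\<theta> \<in> borel_measurable N" "\<alpha> \<in> borel_measurable N"
    "v \<in> borel_measurable N"
  shows "(\<lambda>x. transfer_step r t (z x) (\<theta> x) (\<alpha> x) (v x)) \<in> borel_measurable N"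
proof -
  have cis: "(\<lambda>x. cis (f x)) \<in> borel_measurable N" if "f \<in> borel_measurable N" for f
    using that by (intro borel_measurable_continuous_on[OF _ that]) (auto intro: continuous_intros)
  have [measurable]: "(\<lambda>x. fst (v x)) \<in> borel_measurable N" "(\<lambda>x. snd (v x)) \<in> borel_measurable N"
    by (auto intro!: borel_measurable_continuous_on[OF _ assms(4)] continuous_intros)
  have [measurable]: "(\<lambda>x. cis (\<theta> x)) \<in> borel_measurable N" "(\<lambda>x. cis (- \<alpha> x)) \<in> borel_measurable N"
     "(\<lambda>x. cis (\<alpha> x - \<theta> x)) \<in> borel_measurable N"
    by (auto intro!: cis)
  show ?thesis unfolding transfer_step_def by (intro borel_measurable_Pair) measurable
qed

lemma transfer_measurable[measurable]:
  assumes [measurable]: "z \<in> borel_measurable N" "\<And>n. (\<lambda>x. \<theta> x n) \<in> borel_measurable N"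
    "\<And>n. (\<lambda>x. \<alpha> x n) \<in> borel_measurable N" "v \<in> borel_measurable N"
  shows "(\<lambda>x. transfer r t (z x) (\<theta> x) (\<alpha> x) (v x) n) \<in> borel_measurable N"
  by (induction n) auto

lemma transfer_cong:
  assumes "\<And>k. k < n \<Longrightarrow> \<theta> k = \<theta>' k" "\<And>k. k < n \<Longrightarrow> \<alpha> k = \<alpha>' k"
  shows "transfer r t z \<theta> \<alpha> v n = transfer r t z \<theta>' \<alpha>' v n"
  using assms by (induction n) auto

text \<open>Induction on the number of steps: resampling the phase of the last step leaves the
  vector before it unchanged, so the one-step average gains a factor \<open>q\<close>. The initial
  vector may be random, provided that it ignores the phases \<open>\<iota> n\<close>; this admits a
  direction determined by the other half-line. Norm at least 1 starts the induction.\<close>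

lemma (in prob_space) transfer_inverse_norm_decay:
  fixes Y :: "int + int \<Rightarrow> 'a \<Rightarrow> real" and \<iota> :: "nat \<Rightarrow> int" and \<alpha> :: "nat \<Rightarrow> (int + int \<Rightarrow> real) \<Rightarrow> real"
  assumes ind: "indep_vars (\<lambda>_. borel) Y UNIV"
    and unif: "\<And>k. distr M borel (Y (Inl k)) = uniform_measure lborel {0..<2 * pi}"
    and \<iota>: "inj \<iota>" and q: "0 < q"
    and avg: "\<And>\<alpha> v. v \<noteq> 0 \<Longrightarrow>
      (\<integral>\<^sup>+\<theta>. ennreal (1 / norm (transfer_step r t z \<theta> \<alpha> v)) \<partial>uniform_measure lborel {0..<2 * pi})
        \<le> ennreal q * ennreal (1 / norm v)"
    and t: "t \<noteq> 0" "r\<^sup>2 < 1" and z: "cmod z = 1"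
    and \<alpha>[measurable]: "\<And>n. \<alpha> n \<in> borel_measurable (Pi\<^sub>M UNIV (\<lambda>_. borel))"
    and \<alpha>_upd: "\<And>n x k u. \<alpha> n (x(Inl k := u)) = \<alpha> n x"
    and v[measurable]: "v \<in> borel_measurable (Pi\<^sub>M UNIV (\<lambda>_. borel))"
    and v_upd: "\<And>x n u. v (x(Inl (\<iota> n) := u)) = v x"
    and v_ge: "\<And>x. norm (v x) \<ge> 1"
  shows "(\<integral>\<^sup>+\<omega>. ennreal (1 / norm (transfer r t z (\<lambda>n. Y (Inl (\<iota> n)) \<omega>) (\<lambda>n. \<alpha> n (\<lambda>i. Y i \<omega>)) (v (\<lambda>i. Y i \<omega>)) n)) \<partial>M)
           \<le> ennreal (q ^ n)"
proof (induction n)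
  case 0
  have "(\<integral>\<^sup>+\<omega>. ennreal (1 / norm (v (\<lambda>i. Y i \<omega>))) \<partial>M) \<le> (\<integral>\<^sup>+\<omega>. 1 \<partial>M)"
    using v_ge by (intro nn_integral_mono) (auto simp: divide_le_eq intro: order_less_le_trans[OF zero_less_one])
  then show ?case by (simp add: emeasure_space_1)
next
  case (Suc n)
  define W where "W m x = transfer r t z (\<lambda>n. x (Inl (\<iota> n))) (\<lambda>n. \<alpha> n x) (v x) m" for m x
  have v0: "v x \<noteq> 0" for x using v_ge[of x] by auto
  have [measurable]: "W m \<in> borel_measurable (Pi\<^sub>M UNIV (\<lambda>_. borel))" for m
    unfolding W_def by measurable
  have upd: "W (Suc n) (x(Inl (\<iota> n) := u)) = transfer_step r t z u (\<alpha> n x) (W n x)" for x u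
  proof -
    \<comment> \<open>Injectivity of \<iota>: the phase with index \<open>\<iota> n\<close> does not
      occur among the first \<open>n\<close> steps.\<close>
    have "W n (x(Inl (\<iota> n) := u)) = W n x"
      unfolding W_def v_upd \<alpha>_upd using \<iota> by (intro transfer_cong) (auto dest: injD)
    then show ?thesis by (simp add: W_def \<alpha>_upd)
  qed
  have "(\<integral>\<^sup>+\<omega>. ennreal (1 / norm (W (Suc n) (\<lambda>i. Y i \<omega>))) \<partial>M)
     = (\<integral>\<^sup>+\<omega>. (\<integral>\<^sup>+u. ennreal (1 / norm (W (Suc n) ((\<lambda>i. Y i \<omega>)(Inl (\<iota> n) := u)))) \<partial>uniform_measure lborel {0..<2 * pi}) \<partial>M)"
    by (subst nn_integral_resample[OF ind, of _ "Inl (\<iota> n)"]) (auto simp: unif)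
  also have "\<dots> \<le> (\<integral>\<^sup>+\<omega>. ennreal q * ennreal (1 / norm (W n (\<lambda>i. Y i \<omega>))) \<partial>M)"
    unfolding upd using t z v0 by (intro nn_integral_mono avg) (auto simp: W_def dest: transfer_nonzero)
  also have "\<dots> = ennreal q * (\<integral>\<^sup>+\<omega>. ennreal (1 / norm (W n (\<lambda>i. Y i \<omega>))) \<partial>M)"
  proof (intro nn_integral_cmult)
    have [measurable]: "Y i \<in> borel_measurable M" for i
      using ind by (auto simp: indep_vars_def)
    have "(\<lambda>\<omega> i. Y i \<omega>) \<in> M \<rightarrow>\<^sub>M Pi\<^sub>M UNIV (\<lambda>_. borel)"
      by (intro measurable_PiM_single') auto
    from measurable_compose[OF this, of "W n"]
    have [measurable]: "(\<lambda>\<omega>. W n (\<lambda>i. Y i \<omega>)) \<in> borel_measurable M" by simp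
    show "(\<lambda>\<omega>. ennreal (1 / norm (W n (\<lambda>i. Y i \<omega>)))) \<in> borel_measurable M" by measurable
  qed
  also have "\<dots> \<le> ennreal q * ennreal (q ^ n)"
    using Suc.IH unfolding W_def by (intro mult_left_mono) auto
  also have "\<dots> = ennreal (q ^ Suc n)" using q by (simp add: ennreal_mult'[symmetric])
  finally show ?case by (simp add: W_def)
qed

section \<open>Minimising the norm along a complex line\<close>

definition pair_inner :: "complex \<times> complex \<Rightarrow> complex \<times> complex \<Rightarrow> complex" where
  "pair_inner a b = cnj (fst a) * fst b + cnj (snd a) * snd b"

lemma pair_inner_self: "pair_inner a a = of_real ((norm a)\<^sup>2)"
  by (cases a) (simp add: pair_inner_def norm_Pair mult.commute[of "cnj _"] flip: complex_norm_square)

lemma cmod_pair_inner_le: "cmod (pair_inner a b) \<le> norm a * norm b"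
proof -
  have "cmod (pair_inner a b) \<le> cmod (fst a) * cmod (fst b) + cmod (snd a) * cmod (snd b)"
    unfolding pair_inner_def by (rule norm_triangle_le) (simp add: norm_mult)
  also have "\<dots> = inner (cmod (fst a), cmod (snd a)) (cmod (fst b), cmod (snd b))" by simp
  also have "\<dots> \<le> norm (cmod (fst a), cmod (snd a)) * norm (cmod (fst b), cmod (snd b))"
    by (rule norm_cauchy_schwarz)
  also have "\<dots> = norm a * norm b" by (simp add: norm_prod_def)
  finally show ?thesis .
qed

text \<open>\<open>c\<close> is compared with the minimiser of \<open>\<lambda>c. norm (c p + q)\<close>.\<close>

lemma cmod_diff_minimizer_le:
  assumes "p \<noteq> 0"
  shows "cmod (c - (- pair_inner p q / of_real ((norm p)\<^sup>2))) \<le> norm ((c * fst p, c * snd p) + q) / norm p"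
proof -
  have "pair_inner p ((c * fst p, c * snd p) + q) = c * pair_inner p p + pair_inner p q"
    by (simp add: pair_inner_def algebra_simps)
  then have "c - (- pair_inner p q / of_real ((norm p)\<^sup>2)) =
      pair_inner p ((c * fst p, c * snd p) + q) / of_real ((norm p)\<^sup>2)"
    using assms by (simp add: pair_inner_self add_divide_distrib)
  then have "cmod (c - (- pair_inner p q / of_real ((norm p)\<^sup>2))) \<le>
      (norm p * norm ((c * fst p, c * snd p) + q)) / (norm p)\<^sup>2"
    using cmod_pair_inner_le[of p "(c * fst p, c * snd p) + q"]
    by (simp add: norm_divide norm_power divide_right_mono)
  then show ?thesis using assms by (simp add: power2_eq_square)
qed

section \<open>Generalized eigenfunctions\<close>

lemma block_op_scatter:
  fixes r t :: real and \<theta> \<alpha> \<gamma> :: "int \<Rightarrow> real"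
  defines "S \<equiv> \<lambda>k. scatter r t (\<theta> k) (\<alpha> k) (\<gamma> k)"
  shows "P n \<Longrightarrow> block_op P S f n =
      cis (-\<theta> n) * (of_real r * cis (-\<alpha> n) * f n + \<i> * of_real t * cis (\<gamma> n) * f (n + 1))"
    and "\<not> P (n + 1) \<Longrightarrow> block_op P S f (n + 1) =
      cis (-\<theta> n) * (\<i> * of_real t * cis (-\<gamma> n) * f n + of_real r * cis (\<alpha> n) * f (n + 1))"
  by (simp_all add: block_op_def S_def scatter_def matrix_vector_mult_def sum_2 algebra_simps)

lemma transfer_step_block:
  assumes rt: "r\<^sup>2 + t\<^sup>2 = 1" and t: "t \<noteq> 0"
    and y: "y = cis (-\<theta>) * (of_real r * cis (-\<alpha>) * x + \<i> * of_real t * x')"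
    and y': "y' = cis (-\<theta>) * (\<i> * of_real t * x + of_real r * cis \<alpha> * x')"
  shows "transfer_step r t z \<theta> \<alpha> (x, y) = (y', z * x')"
proof -
  define R T :: complex where "R = of_real r" and "T = of_real t"
  have RT: "R * R + T * T = 1"
    using rt by (simp add: R_def T_def power2_eq_square flip: of_real_mult of_real_add)
  then have RR: "R * R = 1 - T * T" by (simp add: eq_diff_eq)
  have T: "T \<noteq> 0" using t by (simp add: T_def)
  have cy: "cis \<theta> * y = R * cis (-\<alpha>) * x + \<i> * T * x'"
    by (simp add: y R_def T_def cis_mult flip: mult.assoc)
  have "R * cis \<theta> * y - cis (-\<alpha>) * x = \<i> * T * (\<i> * T * cis (-\<alpha>) * x + R * x')"
  proof -
    have "R * cis \<theta> * y = R * (R * cis (-\<alpha>) * x + \<i> * T * x')"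
      unfolding cy[symmetric] by simp
    also have "\<dots> = R * R * (cis (-\<alpha>) * x) + \<i> * T * R * x'" by (simp add: algebra_simps)
    finally show ?thesis unfolding RR by (simp add: algebra_simps)
  qed
  moreover have "cis \<theta> * y - R * cis (-\<alpha>) * x = \<i> * T * x'" by (simp add: cy)
  moreover have "cis (\<alpha> - \<theta>) * (\<i> * T * cis (-\<alpha>) * x + R * x') = y'"
  proof -
    have "cis (\<alpha> - \<theta>) = cis (-\<theta>) * cis \<alpha>" by (simp add: cis_mult)
    moreover have "cis \<alpha> * cis (-\<alpha>) = 1" by (simp add: cis_mult)
    ultimately show ?thesis
      unfolding y' R_def[symmetric] T_def[symmetric] by (simp add: algebra_simps)
  qed
  ultimately show ?thesis
    using T unfolding transfer_step_def R_def[symmetric] T_def[symmetric]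
    by (simp add: mult.left_commute[of _ "\<i>"] mult.left_commute[of _ T])
qed

lemma transfer_step_scale:
  "transfer_step r t z \<theta> \<alpha> (u * a, u * b) =
     (u * fst (transfer_step r t z \<theta> \<alpha> (a, b)), u * snd (transfer_step r t z \<theta> \<alpha> (a, b)))"
  using transfer_scale[of r t z "\<lambda>_. \<theta>" "\<lambda>_. \<alpha>" u "(a, b)" 1] by simp

text \<open>Steps are linear, so unimodular factors picked up on the way collect into one scalar
  \<open>c\<close>, invisible to the norm.\<close>

lemma norm_transfer_eq:
  assumes step: "\<And>n. transfer_step r t z (\<theta> n) (\<alpha> n) (e n) = (u n * fst (e (Suc n)), u n * snd (e (Suc n)))"
    and u: "\<And>n. cmod (u n) = 1"
  shows "norm (transfer r t z \<theta> \<alpha> (e 0) n) = norm (e n)"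
proof -
  have "\<exists>c. cmod c = 1 \<and> transfer r t z \<theta> \<alpha> (e 0) n = (c * fst (e n), c * snd (e n))"
  proof (induction n)
    case 0
    show ?case by (rule exI[of _ 1]) simp
  next
    case (Suc n)
    then obtain c where c: "cmod c = 1" "transfer r t z \<theta> \<alpha> (e 0) n = (c * fst (e n), c * snd (e n))"
      by auto
    then have "transfer r t z \<theta> \<alpha> (e 0) (Suc n) = (c * u n * fst (e (Suc n)), c * u n * snd (e (Suc n)))"
      by (simp add: transfer_step_scale step)
    then show ?case using c u by (intro exI[of _ "c * u n"]) (auto simp: norm_mult)
  qed
  then obtain c where "cmod c = 1" "transfer r t z \<theta> \<alpha> (e 0) n = (c * fst (e n), c * snd (e n))"
    by auto
  then show ?thesis by (simp add: norm_scale_pair)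
qed

text \<open>With \<eta> the result of the even layer, the eigenvalue equation says that the odd
  layer maps \<eta> to \<open>z \<psi>\<close>. The state at a site is the pair of input and output
  of the next block met. Going left reverses the coordinates of each block; with \<gamma> equal to 0
  this amounts to replacing \<alpha> by its negative.\<close>

lemma norm_transfer_generalized_eigenfunction:
  fixes r t :: real and \<theta> \<alpha> :: "int \<Rightarrow> real"
  assumes rt: "r\<^sup>2 + t\<^sup>2 = 1" and t: "t \<noteq> 0" and z: "cmod z = 1"
    and ev: "\<And>k. band_op r t \<theta> \<alpha> (\<lambda>_. 0) \<psi> k = z * \<psi> k"
  defines "\<eta> \<equiv> block_op even (\<lambda>k. scatter r t (\<theta> k) (\<alpha> k) 0) \<psi>"
  shows "norm (transfer r t z (\<lambda>n. \<theta> (int n)) (\<lambda>n. \<alpha> (int n)) (\<psi> 0, \<eta> 0) n) = norm (\<psi> (int n), \<eta> (int n))"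
    and "norm (transfer r t z (\<lambda>n. \<theta> (- int n - 1)) (\<lambda>n. - \<alpha> (- int n - 1)) (\<eta> 0, z * \<psi> 0) n)
           = norm (\<psi> (- int n), \<eta> (- int n))"
proof -
  have zpsi: "z * \<psi> k = block_op odd (\<lambda>k. scatter r t (\<theta> k) (\<alpha> k) 0) \<eta> k" for k
    using ev[of k] by (simp add: band_op_def \<eta>_def Let_def o_def)
  have E: "\<eta> m = cis (-\<theta> m) * (of_real r * cis (-\<alpha> m) * \<psi> m + \<i> * of_real t * \<psi> (m + 1))"
       "\<eta> (m + 1) = cis (-\<theta> m) * (\<i> * of_real t * \<psi> m + of_real r * cis (\<alpha> m) * \<psi> (m + 1))"
    if "even m" for m
    using that unfolding \<eta>_def by (simp_all add: block_op_scatter)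
  have O: "z * \<psi> m = cis (-\<theta> m) * (of_real r * cis (-\<alpha> m) * \<eta> m + \<i> * of_real t * \<eta> (m + 1))"
       "z * \<psi> (m + 1) = cis (-\<theta> m) * (\<i> * of_real t * \<eta> m + of_real r * cis (\<alpha> m) * \<eta> (m + 1))"
    if "odd m" for m
    using that unfolding zpsi by (simp_all add: block_op_scatter)
  \<comment> \<open>At an even site the next block is an even one, from \<psi> to \<eta>; at an odd
    site it is an odd one, from \<eta> to \<open>z \<psi>\<close>. Leaving an odd block yields an
    additional factor \<open>z\<close>.\<close>
  define R where "R n = (if even n then (\<psi> (int n), \<eta> (int n)) else (\<eta> (int n), z * \<psi> (int n)))" for n
  have "transfer_step r t z (\<theta> (int n)) (\<alpha> (int n)) (R n) =
      ((if even n then 1 else z) * fst (R (Suc n)), (if even n then 1 else z) * snd (R (Suc n)))" for n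
  proof (cases "even n")
    case True
    then have "even (int n)" by simp
    from transfer_step_block[OF rt t E[OF this], of z] True show ?thesis by (simp add: R_def add.commute)
  next
    case False
    then have "odd (int n)" by simp
    from transfer_step_block[OF rt t O[OF this], of z] False show ?thesis by (simp add: R_def add.commute)
  qed
  from norm_transfer_eq[of r t z "\<lambda>n. \<theta> (int n)" "\<lambda>n. \<alpha> (int n)" R, OF this, of n] z
  show "norm (transfer r t z (\<lambda>n. \<theta> (int n)) (\<lambda>n. \<alpha> (int n)) (\<psi> 0, \<eta> 0) n) = norm (\<psi> (int n), \<eta> (int n))"
    by (simp add: R_def norm_Pair norm_mult add.commute)
  \<comment> \<open>Mirror image of \<open>R\<close>: the block between \<open>- n - 1\<close> and
    \<open>- n\<close> is labelled by its left end, hence the phase index, and it is an odd block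
    when \<open>n\<close> is even.\<close>
  define L where "L n = (if even n then (\<eta> (- int n), z * \<psi> (- int n)) else (\<psi> (- int n), \<eta> (- int n)))" for n
  have "transfer_step r t z (\<theta> (- int n - 1)) (- \<alpha> (- int n - 1)) (L n) =
      ((if even n then z else 1) * fst (L (Suc n)), (if even n then z else 1) * snd (L (Suc n)))" for n
  proof -
    define m where "m = - int n - 1"
    have m: "- int n = m + 1" "- int (Suc n) = m" by (auto simp: m_def)
    show ?thesis
    proof (cases "even n")
      case True
      then have "odd m" by (simp add: m_def)
      note O = O[OF this]
      have "transfer_step r t z (\<theta> m) (- \<alpha> m) (\<eta> (m + 1), z * \<psi> (m + 1)) = (z * \<psi> m, z * \<eta> m)"
        using rt t O by (intro transfer_step_block) (auto simp: add.commute)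
      then show ?thesis using True by (simp add: L_def m flip: m_def)
    next
      case False
      then have "even m" by (simp add: m_def)
      note E = E[OF this]
      have "transfer_step r t z (\<theta> m) (- \<alpha> m) (\<psi> (m + 1), \<eta> (m + 1)) = (\<eta> m, z * \<psi> m)"
        using rt t E by (intro transfer_step_block) (auto simp: add.commute)
      then show ?thesis using False by (simp add: L_def m flip: m_def)
    qed
  qed
  from norm_transfer_eq[of r t z "\<lambda>n. \<theta> (- int n - 1)" "\<lambda>n. - \<alpha> (- int n - 1)" L, OF this, of n] z
  show "norm (transfer r t z (\<lambda>n. \<theta> (- int n - 1)) (\<lambda>n. - \<alpha> (- int n - 1)) (\<eta> 0, z * \<psi> 0) n)
           = norm (\<psi> (- int n), \<eta> (- int n))"
    by (simp add: L_def norm_Pair norm_mult add.commute split: if_splits)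
qed

text \<open>The value of the even layer at \<open>k\<close> involves \<psi> at \<open>k\<close> and
  at one neighbour, so at distance at most \<open>n + 1\<close> from the origin. The constant 4
  counts \<open>C\<close> for \<psi> and \<open>C + 2 C\<close> for the layer, where 2 comes from
  \<open>1 + (n + 1)^2 \<le> 2 (n + 1)^2\<close>.\<close>

lemma norm_generalized_eigenfunction_pair_le:
  fixes r t :: real and \<theta> \<alpha> :: "int \<Rightarrow> real"
  assumes rt: "r\<^sup>2 + t\<^sup>2 = 1"
    and bound: "\<And>k. cmod (\<psi> k) \<le> C * (1 + (real_of_int k)\<^sup>2)"
    and n: "\<bar>k\<bar> = int n"
  shows "norm (\<psi> k, block_op even (\<lambda>k. scatter r t (\<theta> k) (\<alpha> k) 0) \<psi> k) \<le> 4 * C * (real n + 1)\<^sup>2"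
proof -
  have C: "0 \<le> C" using order_trans[OF norm_ge_zero bound[of 0]] by simp
  have "\<bar>r\<bar> \<le> 1" "\<bar>t\<bar> \<le> 1" using rt
    by (metis abs_le_square_iff abs_one le_add_same_cancel1 one_power2 zero_le_power2 add.commute)+
  then have mult: "cmod (of_real r * x) \<le> cmod x" "cmod (of_real t * x) \<le> cmod x" for x
    by (auto simp: norm_mult mult_left_le_one_le)
  have near: "cmod (\<psi> j) \<le> 2 * C * (real n + 1)\<^sup>2" if "\<bar>j\<bar> \<le> int n + 1" for j
  proof -
    have "\<bar>real_of_int j\<bar> \<le> real n + 1" using that by linarith
    then have "(real_of_int j)\<^sup>2 \<le> (real n + 1)\<^sup>2"
      by (intro power2_le_iff_abs_le[THEN iffD2]) auto
    moreover have "1 \<le> (real n + 1)\<^sup>2" by simp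
    ultimately have "C * (1 + (real_of_int j)\<^sup>2) \<le> C * (2 * (real n + 1)\<^sup>2)"
      using C by (intro mult_left_mono) linarith+
    then show ?thesis using bound[of j] by simp
  qed
  have self: "cmod (\<psi> k) \<le> C * (real n + 1)\<^sup>2"
  proof -
    have "(real_of_int k)\<^sup>2 = (real n)\<^sup>2"
      using n by (metis of_int_abs of_int_of_nat_eq power2_abs)
    then have "C * (1 + (real_of_int k)\<^sup>2) \<le> C * (real n + 1)\<^sup>2"
      using C by (intro mult_left_mono) (auto simp: power2_eq_square algebra_simps)
    then show ?thesis using bound[of k] by simp
  qed
  define \<eta> where "\<eta> = block_op even (\<lambda>k. scatter r t (\<theta> k) (\<alpha> k) 0) \<psi>"
  have "\<exists>j. \<bar>j\<bar> \<le> int n + 1 \<and> cmod (\<eta> k) \<le> cmod (\<psi> k) + cmod (\<psi> j)"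
  proof (cases "even k")
    case True
    then have "\<eta> k = cis (-\<theta> k) * (of_real r * (cis (-\<alpha> k) * \<psi> k) + of_real t * (\<i> * \<psi> (k + 1)))"
      by (simp add: \<eta>_def block_op_scatter algebra_simps)
    also have "cmod \<dots> \<le> cmod (\<psi> k) + cmod (\<psi> (k + 1))"
      using mult(1)[of "cis (-\<alpha> k) * \<psi> k"] mult(2)[of "\<i> * \<psi> (k + 1)"]
      by (subst norm_mult) (auto intro!: norm_triangle_le simp: norm_mult)
    finally show ?thesis using n by (intro exI[of _ "k + 1"]) auto
  next
    case False
    then have "\<eta> k = cis (-\<theta> (k - 1)) * (of_real r * (cis (\<alpha> (k - 1)) * \<psi> k) + of_real t * (\<i> * \<psi> (k - 1)))"
      using block_op_scatter(2)[of even "k - 1" r t \<theta> \<alpha> "\<lambda>_. 0" \<psi>] by (simp add: \<eta>_def algebra_simps)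
    also have "cmod \<dots> \<le> cmod (\<psi> k) + cmod (\<psi> (k - 1))"
      using mult(1)[of "cis (\<alpha> (k - 1)) * \<psi> k"] mult(2)[of "\<i> * \<psi> (k - 1)"]
      by (subst norm_mult) (auto intro!: norm_triangle_le simp: norm_mult)
    finally show ?thesis using n by (intro exI[of _ "k - 1"]) auto
  qed
  then have "cmod (\<eta> k) \<le> C * (real n + 1)\<^sup>2 + 2 * C * (real n + 1)\<^sup>2"
    using near self by (meson add_mono order_trans)
  then have "cmod (\<psi> k) + cmod (\<eta> k) \<le> 4 * C * (real n + 1)\<^sup>2" using self by linarith
  moreover have "norm (\<psi> k, \<eta> k) \<le> cmod (\<psi> k) + cmod (\<eta> k)"
    using norm_Pair_le by blast
  ultimately show ?thesis by (simp add: \<eta>_def)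
qed

section \<open>From finite sums to growth of solutions\<close>

lemma eventually_gt_of_suminf_finite:
  fixes f g :: "nat \<Rightarrow> real"
  assumes fin: "(\<Sum>n. ennreal (f n / g n)) < \<top>" and f: "\<And>n. 0 \<le> f n" and g: "\<And>n. 0 < g n"
  shows "\<forall>\<^sub>F n in sequentially. f n < g n"
proof -
  have "summable (\<lambda>n. f n / g n)"
    using fin by (intro summable_suminf_not_top) (auto intro!: divide_nonneg_pos f g)
  then have "(\<lambda>n. f n / g n) \<longlonglongrightarrow> 0" by (rule summable_LIMSEQ_zero)
  then have "\<forall>\<^sub>F n in sequentially. f n / g n < 1" by (rule order_tendstoD) simp
  then show ?thesis by eventually_elim (use g in \<open>simp add: divide_less_eq\<close>)
qed

lemma not_cubic_of_quadratic:
  fixes C :: real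
  assumes "\<forall>\<^sub>F n in sequentially. (real n + 1) ^ 3 < g n" and "\<And>n. g n \<le> C * (real n + 1)\<^sup>2"
  shows False
proof -
  have "\<forall>\<^sub>F n in sequentially. real n + 1 < C"
    using assms(1)
  proof eventually_elim
    case (elim n)
    then have "(real n + 1)\<^sup>2 * (real n + 1) < (real n + 1)\<^sup>2 * C"
      using assms(2)[of n] by (simp add: power3_eq_cube power2_eq_square algebra_simps)
    then show ?case by (rule mult_left_less_imp_less) simp
  qed
  moreover have "\<forall>\<^sub>F n in sequentially. real n \<ge> C"
    by (rule eventually_sequentiallyI[of "nat \<lceil>C\<rceil>"]) linarith
  ultimately have "\<forall>\<^sub>F n in sequentially. False" by eventually_elim simp
  then show False by simp
qed

text \<open>The environment \<open>x\<close> consists of the phases \<open>\<theta>\<close> (\<open>Inl\<close>) and \<open>\<alpha>\<close> (\<open>Inr\<close>).\<close>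

definition left_transfer :: "real \<Rightarrow> real \<Rightarrow> (int + int \<Rightarrow> real) \<Rightarrow> real \<Rightarrow> complex \<times> complex \<Rightarrow> nat \<Rightarrow> complex \<times> complex"
  where "left_transfer r t x \<xi> =
    transfer r t (cis \<xi>) (\<lambda>n. x (Inl (- int n - 1))) (\<lambda>n. - x (Inr (- int n - 1)))"

definition right_transfer :: "real \<Rightarrow> real \<Rightarrow> (int + int \<Rightarrow> real) \<Rightarrow> real \<Rightarrow> complex \<times> complex \<Rightarrow> nat \<Rightarrow> complex \<times> complex"
  where "right_transfer r t x \<xi> =
    transfer r t (cis \<xi>) (\<lambda>n. x (Inl (int n))) (\<lambda>n. x (Inr (int n)))"

text \<open>Limit of the minimisers over \<open>c\<close> of the norm of the transferred \<open>(c, 1)\<close>; no other \<open>(c, 1)\<close> can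
  stay polynomially bounded to the left. An arbitrary value if the limit does not exist.\<close>

definition left_direction :: "real \<Rightarrow> real \<Rightarrow> (int + int \<Rightarrow> real) \<Rightarrow> real \<Rightarrow> complex" where
  "left_direction r t x \<xi> = lim (\<lambda>n.
     - pair_inner (left_transfer r t x \<xi> (1, 0) n) (left_transfer r t x \<xi> (0, 1) n) /
       of_real ((norm (left_transfer r t x \<xi> (1, 0) n))\<^sup>2))"

text \<open>One jointly measurable quantity whose finiteness forces growth in both directions. The
  left series tests only \<open>(1, 0)\<close>, the one direction not of the form
  \<open>(c, 1)\<close>. The right series starts from the solution whose left data are
  \<open>(c, 1)\<close> with \<open>c\<close> the limit direction; since its left data hold
  \<open>z\<close> times the value at 0, that value is the conjugate of \<open>z\<close>.\<close>

definition inverse_growth :: "real \<Rightarrow> real \<Rightarrow> (int + int \<Rightarrow> real) \<Rightarrow> real \<Rightarrow> ennreal" where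
  "inverse_growth r t x \<xi> =
     (\<Sum>n. ennreal ((real n + 1) ^ 3 / norm (left_transfer r t x \<xi> (1, 0) n))) +
     (\<Sum>n. ennreal ((real n + 1) ^ 3 / norm (right_transfer r t x \<xi> (cnj (cis \<xi>), left_direction r t x \<xi>) n)))"

text \<open>Boundedness on the left determines the solution up to a factor, namely as the one
  through \<open>left_direction\<close>; boundedness on the right then contradicts the growth of
  exactly this solution.\<close>

lemma no_polynomially_bounded_eigenfunction:
  fixes r t :: real
  assumes rt: "r\<^sup>2 + t\<^sup>2 = 1" and t: "0 < t"
    and fin: "inverse_growth r t x \<xi> < \<top>"
    and ev: "\<And>k. band_op r t (\<lambda>k. x (Inl k)) (\<lambda>k. x (Inr k)) (\<lambda>_. 0) \<psi> k = cis \<xi> * \<psi> k"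
    and bound: "\<And>k. cmod (\<psi> k) \<le> C * (1 + (real_of_int k)\<^sup>2)"
  shows "\<psi> k = 0"
proof (rule ccontr)
  assume nz: "\<psi> k \<noteq> 0"
  have r2: "r\<^sup>2 < 1" using rt t by (metis less_add_same_cancel1 zero_less_power)
  have t0: "t \<noteq> 0" using t by simp
  define \<eta> where "\<eta> = block_op even (\<lambda>k. scatter r t (x (Inl k)) (x (Inr k)) 0) \<psi>"
  define a b where "a = \<eta> 0" and "b = cis \<xi> * \<psi> 0"
  have psi0: "\<psi> 0 = cnj (cis \<xi>) * b" by (simp add: b_def cis_cnj cis_mult flip: mult.assoc)
  define p where "p = left_transfer r t x \<xi> (1, 0)"
  define q where "q = left_transfer r t x \<xi> (0, 1)"
  have p0: "p n \<noteq> 0" for n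
    unfolding p_def left_transfer_def using t0 r2 by (intro transfer_nonzero) (auto simp: zero_prod_def)
  have right: "norm (right_transfer r t x \<xi> (\<psi> 0, a) n) = norm (\<psi> (int n), \<eta> (int n))"
    and left: "norm (left_transfer r t x \<xi> (a, b) n) = norm (\<psi> (- int n), \<eta> (- int n))" for n
    using norm_transfer_generalized_eigenfunction[OF rt t0 _ ev, of n]
    by (simp_all add: right_transfer_def left_transfer_def a_def b_def \<eta>_def)
  have le: "norm (\<psi> j, \<eta> j) \<le> 4 * C * (real n + 1)\<^sup>2" if "\<bar>j\<bar> = int n" for j n
    unfolding \<eta>_def using norm_generalized_eigenfunction_pair_le[OF rt bound that] .
  have right_le: "norm (right_transfer r t x \<xi> (\<psi> 0, a) n) \<le> 4 * C * (real n + 1)\<^sup>2"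
    and left_le: "norm (left_transfer r t x \<xi> (a, b) n) \<le> 4 * C * (real n + 1)\<^sup>2" for n
    unfolding right left by (rule le; simp)+
  have left_lin: "left_transfer r t x \<xi> (u, v) n = (u * fst (p n), u * snd (p n)) + (v * fst (q n), v * snd (q n))" for u v n
  proof -
    have uv: "(u, v) = (u * fst (1, 0 :: complex), u * snd (1 :: complex, 0)) +
        (v * fst (0, 1 :: complex), v * snd (0 :: complex, 1))" by simp
    show ?thesis
      unfolding left_transfer_def p_def q_def by (subst uv) (simp only: transfer_add transfer_scale)
  qed
  have p_gt: "\<forall>\<^sub>F n in sequentially. (real n + 1) ^ 3 < norm (p n)"
    using fin p0 by (intro eventually_gt_of_suminf_finite) (auto simp: inverse_growth_def p_def)
  \<comment> \<open>Otherwise the left data are a multiple of \<open>(1, 0)\<close>. A nonzero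
    multiple grows beyond every quadratic bound, and zero data force the solution to vanish on both
    sides.\<close>
  have b: "b \<noteq> 0"
  proof
    assume b0: "b = 0"
    show False
    proof (cases "a = 0")
      case True
      have "norm (right_transfer r t x \<xi> (0, 0) n) = 0" "norm (left_transfer r t x \<xi> (0, 0) n) = 0" for n
        unfolding right_transfer_def left_transfer_def
        using transfer_scale[of r t _ _ _ 0 "(0, 0)" n] by (simp_all add: zero_prod_def)
      then have "\<psi> (int n) = 0" "\<psi> (- int n) = 0" for n
        using right[of n] left[of n] True b0 psi0 by (auto simp: norm_Pair sum_power2_eq_zero_iff)
      then have "\<psi> k = 0" by (cases k rule: int_cases2) auto
      with nz show False by simp
    next
      case False
      have "norm (left_transfer r t x \<xi> (a, b) n) = cmod a * norm (p n)" for n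
        unfolding left_lin b0 by (simp add: norm_scale_pair flip: zero_prod_def)
      then have "norm (p n) \<le> 4 * C / cmod a * (real n + 1)\<^sup>2" for n
        using left_le[of n] False by (simp add: field_simps)
      with p_gt show False by (rule not_cubic_of_quadratic)
    qed
  qed
  define c where "c = a / b"
  define C' where "C' = 4 * C / cmod b"
  have C: "0 \<le> C'"
    using order_trans[OF norm_ge_zero bound[of 0]] by (simp add: C'_def)
  have c_le: "norm ((c * fst (p n), c * snd (p n)) + q n) \<le> C' * (real n + 1)\<^sup>2" for n
  proof -
    have "left_transfer r t x \<xi> (a, b) n =
       (b * fst ((c * fst (p n), c * snd (p n)) + q n), b * snd ((c * fst (p n), c * snd (p n)) + q n))"
      unfolding left_lin using b by (simp add: c_def algebra_simps)
    then have "norm (left_transfer r t x \<xi> (a, b) n) = cmod b * norm ((c * fst (p n), c * snd (p n)) + q n)"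
      by (simp only: norm_scale_pair prod.collapse)
    with left_le[of n] b show ?thesis by (simp add: C'_def field_simps)
  qed
  \<comment> \<open>The distance from \<open>c\<close> to the minimiser is at most the norm of the
    transferred \<open>(c, 1)\<close>, which is quadratic, over that of the transferred
    \<open>(1, 0)\<close>, which exceeds a cubic.\<close>
  have "(\<lambda>n. - pair_inner (p n) (q n) / of_real ((norm (p n))\<^sup>2)) \<longlonglongrightarrow> c"
  proof (rule LIM_zero_cancel, rule Lim_null_comparison)
    show "\<forall>\<^sub>F n in sequentially. norm (- pair_inner (p n) (q n) / of_real ((norm (p n))\<^sup>2) - c) \<le> C' / (real n + 1)"
      using p_gt
    proof eventually_elim
      case (elim n)
      have pos: "norm (p n) > 0" using p0 by simp
      have "norm (- pair_inner (p n) (q n) / of_real ((norm (p n))\<^sup>2) - c)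
          \<le> norm ((c * fst (p n), c * snd (p n)) + q n) / norm (p n)"
        using cmod_diff_minimizer_le[OF p0, of c n "q n"] by (simp add: norm_minus_commute)
      also have "\<dots> \<le> C' * (real n + 1)\<^sup>2 / (real n + 1) ^ 3"
        using c_le[of n] elim C pos by (intro frac_le) auto
      also have "\<dots> = C' / (real n + 1)" by (simp add: power2_eq_square power3_eq_cube)
      finally show ?case .
    qed
    show "(\<lambda>n. C' / (real n + 1)) \<longlonglongrightarrow> 0"
      by real_asymp
  qed
  then have dir: "left_direction r t x \<xi> = c"
    unfolding left_direction_def p_def q_def by (rule limI)
  have "norm (right_transfer r t x \<xi> (\<psi> 0, a) n) = cmod b * norm (right_transfer r t x \<xi> (cnj (cis \<xi>), c) n)" for n
  proof -
    have *: "(\<psi> 0, a) = (b * fst (cnj (cis \<xi>), c), b * snd (cnj (cis \<xi>), c))"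
      using b psi0 by (simp add: c_def)
    show ?thesis
      unfolding right_transfer_def * transfer_scale norm_scale_pair by simp
  qed
  then have "norm (right_transfer r t x \<xi> (cnj (cis \<xi>), c) n) \<le> C' * (real n + 1)\<^sup>2" for n
    using right_le[of n] b by (simp add: C'_def field_simps)
  moreover have "right_transfer r t x \<xi> (cnj (cis \<xi>), c) n \<noteq> 0" for n
    unfolding right_transfer_def using t0 r2 by (intro transfer_nonzero) (auto simp: zero_prod_def)
  then have "\<forall>\<^sub>F n in sequentially. (real n + 1) ^ 3 < norm (right_transfer r t x \<xi> (cnj (cis \<xi>), c) n)"
    using fin by (intro eventually_gt_of_suminf_finite) (auto simp: inverse_growth_def dir)
  ultimately show False by (rule not_cubic_of_quadratic[rotated])
qed

section \<open>Joint measurability in environment and angle\<close>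

lemma left_direction_measurable[measurable]:
  "(\<lambda>p. left_direction r t (fst p) (snd p)) \<in> borel_measurable (Pi\<^sub>M UNIV (\<lambda>_. borel) \<Otimes>\<^sub>M borel)"
  (is "_ \<in> borel_measurable ?N")
proof -
  have z: "(\<lambda>p. cis (snd p)) \<in> borel_measurable ?N"
    by (intro borel_measurable_continuous_on[OF _ measurable_snd]) (auto intro: continuous_intros)
  have [measurable]: "(\<lambda>p. left_transfer r t (fst p) (snd p) v n) \<in> borel_measurable ?N" for v n
    unfolding left_transfer_def by (intro transfer_measurable z) measurable
  have [measurable]: "(\<lambda>p. pair_inner (f p) (g p)) \<in> borel_measurable ?N"
    if "f \<in> borel_measurable ?N" "g \<in> borel_measurable ?N" for f g
  proof -
    have "continuous_on UNIV (\<lambda>s. pair_inner (fst s) (snd s))"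
      unfolding pair_inner_def by (intro continuous_intros)
    from borel_measurable_continuous_on[OF this borel_measurable_Pair[OF that]] show ?thesis by simp
  qed
  show ?thesis unfolding left_direction_def by measurable
qed

lemma inverse_growth_measurable[measurable]:
  "(\<lambda>p. inverse_growth r t (fst p) (snd p)) \<in> borel_measurable (Pi\<^sub>M UNIV (\<lambda>_. borel) \<Otimes>\<^sub>M borel)"
  (is "_ \<in> borel_measurable ?N")
proof -
  have z: "(\<lambda>p. cis (snd p)) \<in> borel_measurable ?N" "(\<lambda>p. cnj (cis (snd p))) \<in> borel_measurable ?N"
    by (intro borel_measurable_continuous_on[where f=cis, OF _ measurable_snd]
        borel_measurable_continuous_on[where f="\<lambda>u. cnj (cis u)", OF _ measurable_snd] continuous_intros)+
  have [measurable]: "(\<lambda>p. left_transfer r t (fst p) (snd p) v n) \<in> borel_measurable ?N" for v n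
    unfolding left_transfer_def by (intro transfer_measurable z) measurable
  have [measurable]: "(\<lambda>p. right_transfer r t (fst p) (snd p) (cnj (cis (snd p)), left_direction r t (fst p) (snd p)) n)
     \<in> borel_measurable ?N" for n
    unfolding right_transfer_def
    by (intro transfer_measurable z borel_measurable_Pair left_direction_measurable) measurable
  show ?thesis unfolding inverse_growth_def by measurable
qed

lemma suminf_poly_geometric_finite:
  assumes "0 < q" "q < 1"
  shows "(\<Sum>n. ennreal ((real n + 1) ^ 3 * q ^ n)) < \<top>"
proof -
  \<comment> \<open>Half of the exponential rate absorbs the cubic factor; the other half leaves a
    geometric series.\<close>
  define c where "c = - ln q / 2"
  have c: "c > 0" using assms by (simp add: c_def)
  have "summable (\<lambda>n. (real n + 1) ^ 3 * exp (- (2 * c) * real n))"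
  proof (rule summable_comparison_test_bigo)
    have "summable (\<lambda>n. exp (- c) ^ n)" using c by (intro summable_geometric) auto
    then show "summable (\<lambda>n. norm (exp (- c * real n)))"
      by (simp add: exp_of_nat2_mult[symmetric])
    show "(\<lambda>n. (real n + 1) ^ 3 * exp (- (2 * c) * real n)) \<in> O(\<lambda>n. exp (- c * real n))"
      using c by real_asymp
  qed
  moreover have "exp (- (2 * c) * real n) = q ^ n" for n
    using assms by (simp add: c_def exp_of_nat2_mult)
  ultimately have "summable (\<lambda>n. (real n + 1) ^ 3 * q ^ n)" by (simp only:)
  then show ?thesis using assms by (subst suminf_ennreal2) (auto simp: less_top)
qed

text \<open>For each fixed angle the expectation of \<open>inverse_growth\<close> is at most
  \<open>K + K\<close>, a bound free of the angle, so the double integral is finite. Working with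
  this function avoids any measurability question about the set of angles that admit a bounded
  solution.\<close>

lemma (in prob_space) AE_no_polynomially_bounded_eigenfunction:
  fixes \<theta> \<alpha> :: "int \<Rightarrow> 'a \<Rightarrow> real"
  assumes t: "0 < t" "t < 1" and r: "r = sqrt (1 - t\<^sup>2)"
    and ind: "indep_vars (\<lambda>_. borel) (case_sum \<theta> \<alpha>) (UNIV :: (int + int) set)"
    and unif: "\<And>k. distr M borel (\<theta> k) = uniform_measure lborel {0..<2 * pi}"
  shows "AE \<omega> in M. AE \<xi> in restrict_space lborel {0..<2 * pi}. \<forall>\<psi> C.
    (\<forall>k. band_op r t (\<lambda>k. \<theta> k \<omega>) (\<lambda>k. \<alpha> k \<omega>) (\<lambda>_. 0) \<psi> k = cis \<xi> * \<psi> k) \<longrightarrow>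
    (\<forall>k. cmod (\<psi> k) \<le> C * (1 + (real_of_int k)\<^sup>2)) \<longrightarrow> (\<forall>k. \<psi> k = 0)"
proof -
  define Y where "Y = case_sum \<theta> \<alpha>"
  define X where "X \<omega> = (\<lambda>i. Y i \<omega>)" for \<omega>
  define L where "L = restrict_space lborel {0..<2 * pi}"
  have t2: "t\<^sup>2 < 1" using t by (simp add: power_less_one_iff)
  then have rt: "r\<^sup>2 + t\<^sup>2 = 1" by (simp add: r)
  then have r2: "r\<^sup>2 < 1" using t by (metis less_add_same_cancel1 zero_less_power)
  obtain q where q: "0 < q" "q < 1" and avg: "\<And>z \<alpha> v. cmod z = 1 \<Longrightarrow> v \<noteq> 0 \<Longrightarrow>
      (\<integral>\<^sup>+\<theta>. ennreal (1 / norm (transfer_step r t z \<theta> \<alpha> v)) \<partial>uniform_measure lborel {0..<2 * pi})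
        \<le> ennreal q * ennreal (1 / norm v)"
    using transfer_step_average[OF t r] by blast
  have indY: "indep_vars (\<lambda>_. borel) Y UNIV" using ind by (simp add: Y_def)
  have unifY: "distr M borel (Y (Inl k)) = uniform_measure lborel {0..<2 * pi}" for k
    using unif by (simp add: Y_def)
  have [measurable]: "Y i \<in> borel_measurable M" for i
    using indY by (auto simp: indep_vars_def)
  have [measurable]: "(\<lambda>\<omega>. X \<omega> i) \<in> borel_measurable M" for i
    by (simp add: X_def)
  have X[measurable]: "X \<in> M \<rightarrow>\<^sub>M Pi\<^sub>M UNIV (\<lambda>_. borel)"
    unfolding X_def by (intro measurable_PiM_single') auto
  have L[measurable_cong]: "sets L = sets (restrict_space borel {0..<2 * pi})"
    unfolding L_def by (rule sets_restrict_space_cong) simp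
  have id_L[measurable]: "(\<lambda>x. x) \<in> borel_measurable L"
    unfolding L_def by (intro measurable_restrict_space1) simp
  interpret L: finite_measure L
    by (rule finite_measureI) (simp add: L_def space_restrict_space emeasure_restrict_space)
  interpret P: pair_sigma_finite M L ..
  define G where "G = (\<lambda>(\<omega>, \<xi>). inverse_growth r t (X \<omega>) \<xi>)"
  have G[measurable]: "G \<in> borel_measurable (M \<Otimes>\<^sub>M L)"
  proof -
    have "(\<lambda>p. (X (fst p), snd p)) \<in> M \<Otimes>\<^sub>M L \<rightarrow>\<^sub>M Pi\<^sub>M UNIV (\<lambda>_. borel) \<Otimes>\<^sub>M borel"
      by (intro measurable_Pair measurable_compose[OF measurable_fst X] measurable_compose[OF measurable_snd id_L])
    from measurable_compose[OF this inverse_growth_measurable[of r t]]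
    show ?thesis by (simp add: G_def split_beta')
  qed
  define K where "K = (\<Sum>n. ennreal ((real n + 1) ^ 3 * q ^ n))"
  have K: "K < \<top>" unfolding K_def using q by (rule suminf_poly_geometric_finite)
  have G_le: "(\<integral>\<^sup>+\<omega>. G (\<omega>, \<xi>) \<partial>M) \<le> K + K" for \<xi>
  proof -
    have z: "cmod (cis \<xi>) = 1" by simp
    have pair: "(\<lambda>x. (x, \<xi>)) \<in> Pi\<^sub>M UNIV (\<lambda>_. borel) \<rightarrow>\<^sub>M Pi\<^sub>M UNIV (\<lambda>_. borel) \<Otimes>\<^sub>M borel"
      by measurable
    have dir[measurable]: "(\<lambda>x. left_direction r t x \<xi>) \<in> borel_measurable (Pi\<^sub>M UNIV (\<lambda>_. borel))"
      using measurable_compose[OF pair left_direction_measurable[of r t]] by simp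
    \<comment> \<open>The limit direction is built from phases with negative index only. This is
      where independence of the two half-lines enters.\<close>
    have dir_upd: "left_direction r t (x(Inl (int n) := u)) \<xi> = left_direction r t x \<xi>" for x n u
      by (simp add: left_direction_def left_transfer_def)
    have left: "(\<integral>\<^sup>+\<omega>. ennreal (1 / norm (left_transfer r t (X \<omega>) \<xi> (1, 0) n)) \<partial>M) \<le> ennreal (q ^ n)" for n
      using transfer_inverse_norm_decay[OF indY unifY _ q(1) avg[OF z] _ r2 z,
          of "\<lambda>n. - int n - 1" "\<lambda>n x. - x (Inr (- int n - 1))" "\<lambda>_. (1, 0)" n] t
      by (simp add: left_transfer_def X_def inj_def norm_Pair)
    have right: "(\<integral>\<^sup>+\<omega>. ennreal (1 / norm (right_transfer r t (X \<omega>) \<xi>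
        (cnj (cis \<xi>), left_direction r t (X \<omega>) \<xi>) n)) \<partial>M) \<le> ennreal (q ^ n)" for n
      using transfer_inverse_norm_decay[OF indY unifY _ q(1) avg[OF z] _ r2 z,
          of "\<lambda>n. int n" "\<lambda>n x. x (Inr (int n))" "\<lambda>x. (cnj (cis \<xi>), left_direction r t x \<xi>)" n] t
      by (simp add: right_transfer_def X_def inj_def norm_Pair dir_upd borel_measurable_Pair)
    have [measurable]: "(\<lambda>\<omega>. left_transfer r t (X \<omega>) \<xi> v n) \<in> borel_measurable M" for v n
      unfolding left_transfer_def by (intro transfer_measurable) measurable
    have [measurable]: "(\<lambda>\<omega>. left_direction r t (X \<omega>) \<xi>) \<in> borel_measurable M"
      using measurable_compose[OF X dir] .
    have [measurable]: "(\<lambda>\<omega>. right_transfer r t (X \<omega>) \<xi> (cnj (cis \<xi>), left_direction r t (X \<omega>) \<xi>) n)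
        \<in> borel_measurable M" for n
      unfolding right_transfer_def by (intro transfer_measurable borel_measurable_Pair) measurable
    have sum_le: "(\<integral>\<^sup>+\<omega>. (\<Sum>n. ennreal ((real n + 1) ^ 3 / norm (W \<omega> n))) \<partial>M) \<le> K"
      if [measurable]: "\<And>n. (\<lambda>\<omega>. W \<omega> n) \<in> borel_measurable M"
        and le: "\<And>n. (\<integral>\<^sup>+\<omega>. ennreal (1 / norm (W \<omega> n)) \<partial>M) \<le> ennreal (q ^ n)" for W :: "'a \<Rightarrow> nat \<Rightarrow> complex \<times> complex"
    proof -
      have "(\<integral>\<^sup>+\<omega>. (\<Sum>n. ennreal ((real n + 1) ^ 3 / norm (W \<omega> n))) \<partial>M)
          = (\<Sum>n. \<integral>\<^sup>+\<omega>. ennreal ((real n + 1) ^ 3) * ennreal (1 / norm (W \<omega> n)) \<partial>M)"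
        by (subst nn_integral_suminf) (auto simp: ennreal_mult'[symmetric])
      also have "\<dots> = (\<Sum>n. ennreal ((real n + 1) ^ 3) * \<integral>\<^sup>+\<omega>. ennreal (1 / norm (W \<omega> n)) \<partial>M)"
        by (subst nn_integral_cmult) auto
      also have "\<dots> \<le> (\<Sum>n. ennreal ((real n + 1) ^ 3) * ennreal (q ^ n))"
        by (intro suminf_le mult_left_mono le) auto
      finally show ?thesis using q by (simp add: K_def ennreal_mult')
    qed
    show ?thesis
      unfolding G_def inverse_growth_def prod.case
      by (subst nn_integral_add) (auto intro!: add_mono sum_le left right)
  qed
  have "(\<integral>\<^sup>+\<omega>. \<integral>\<^sup>+\<xi>. G (\<omega>, \<xi>) \<partial>L \<partial>M) = (\<integral>\<^sup>+\<xi>. \<integral>\<^sup>+\<omega>. G (\<omega>, \<xi>) \<partial>M \<partial>L)"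
    by (rule P.Fubini'[symmetric]) (simp add: G)
  also have "\<dots> \<le> (\<integral>\<^sup>+\<xi>. K + K \<partial>L)"
    by (intro nn_integral_mono G_le)
  also have "\<dots> < \<top>"
    using K by (simp add: ennreal_mult_less_top L.emeasure_eq_measure)
  finally have "(\<integral>\<^sup>+\<omega>. \<integral>\<^sup>+\<xi>. G (\<omega>, \<xi>) \<partial>L \<partial>M) \<noteq> \<infinity>" by simp
  then have AE_fin: "AE \<omega> in M. (\<integral>\<^sup>+\<xi>. G (\<omega>, \<xi>) \<partial>L) \<noteq> \<infinity>"
    by (intro nn_integral_PInf_AE) auto
  show ?thesis
    unfolding L_def[symmetric]
  proof (rule AE_mp[OF AE_fin], rule AE_I2, rule impI)
    fix \<omega> assume \<omega>: "\<omega> \<in> space M" and fin: "(\<integral>\<^sup>+\<xi>. G (\<omega>, \<xi>) \<partial>L) \<noteq> \<infinity>"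
    have "AE \<xi> in L. G (\<omega>, \<xi>) \<noteq> \<infinity>"
      using \<omega> fin by (intro nn_integral_PInf_AE measurable_compose[OF measurable_Pair1' G]) auto
    then show "AE \<xi> in L. \<forall>\<psi> C.
      (\<forall>k. band_op r t (\<lambda>k. \<theta> k \<omega>) (\<lambda>k. \<alpha> k \<omega>) (\<lambda>_. 0) \<psi> k = cis \<xi> * \<psi> k) \<longrightarrow>
      (\<forall>k. cmod (\<psi> k) \<le> C * (1 + (real_of_int k)\<^sup>2)) \<longrightarrow> (\<forall>k. \<psi> k = 0)"
    proof eventually_elim
      case (elim \<xi>)
      then have fin': "inverse_growth r t (X \<omega>) \<xi> < \<top>" by (simp add: G_def less_top)
      show ?case
        using no_polynomially_bounded_eigenfunction[OF rt t(1) fin']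
        by (auto simp: X_def Y_def)
    qed
  qed
qed

section \<open>Square-summable sequences\<close>

definition ell2_sq :: "(int \<Rightarrow> complex) \<Rightarrow> real" where
  "ell2_sq f = (\<Sum>\<^sub>\<infinity>k. (cmod (f k))\<^sup>2)"

lemma ell2_sq_nonneg: "0 \<le> ell2_sq f"
  unfolding ell2_sq_def by (rule infsum_nonneg) simp

lemma ell2_comparison:
  assumes "g summable_on UNIV" "\<And>k. (cmod (f k))\<^sup>2 \<le> g k"
  shows "f \<in> ell2"
  unfolding ell2_def mem_Collect_eq
  by (rule summable_on_comparison_test[OF assms(1)]) (use assms(2) in auto)

lemma ell2_scale: "f \<in> ell2 \<Longrightarrow> (\<lambda>k. c * f k) \<in> ell2"
  by (simp add: ell2_def norm_mult power_mult_distrib summable_on_cmult_right)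

lemma ell2_sq_scale: "f \<in> ell2 \<Longrightarrow> ell2_sq (\<lambda>k. c * f k) = (cmod c)\<^sup>2 * ell2_sq f"
  by (simp add: ell2_sq_def norm_mult power_mult_distrib infsum_cmult_right')

lemma cmod_add_square_le: "(cmod (a + b))\<^sup>2 \<le> 2 * ((cmod a)\<^sup>2 + (cmod b)\<^sup>2)"
proof -
  have "(cmod (a + b))\<^sup>2 \<le> (cmod a + cmod b)\<^sup>2" by (intro power_mono norm_triangle_ineq) auto
  also have "\<dots> \<le> 2 * ((cmod a)\<^sup>2 + (cmod b)\<^sup>2)"
    using zero_le_power2[of "cmod a - cmod b"] by (simp add: power2_eq_square algebra_simps)
  finally show ?thesis .
qed

lemma ell2_add:
  assumes "f \<in> ell2" "g \<in> ell2"
  shows "(\<lambda>k. f k + g k) \<in> ell2"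
proof (rule ell2_comparison)
  show "(\<lambda>k. 2 * ((cmod (f k))\<^sup>2 + (cmod (g k))\<^sup>2)) summable_on UNIV"
    using assms by (intro summable_on_cmult_right summable_on_add) (auto simp: ell2_def)
qed (rule cmod_add_square_le)

lemma ell2_zero: "(\<lambda>_. 0) \<in> ell2"
  by (simp add: ell2_def)

lemma ell2_sum:
  assumes "\<And>n. n \<in> I \<Longrightarrow> f n \<in> ell2"
  shows "(\<lambda>k. \<Sum>n\<in>I. f n k) \<in> ell2"
  using assms by (induction I rule: infinite_finite_induct) (auto intro: ell2_zero ell2_add)

text \<open>Replaces the Cauchy-Schwarz inequality by a sum that can be integrated term by term over
  the angle. The free weight \<open>s\<close> allows one factor to be made negligible at the expense
  of the other.\<close>

lemma cmod_mult_le_weighted: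
  fixes s :: real
  assumes "0 < s"
  shows "cmod (cnj a * b) \<le> s * (cmod a)\<^sup>2 + (cmod b)\<^sup>2 / s"
proof -
  have "0 \<le> (s * cmod a - cmod b)\<^sup>2" by simp
  then have "2 * s * (cmod a * cmod b) \<le> s * s * (cmod a)\<^sup>2 + (cmod b)\<^sup>2"
    by (simp add: power2_eq_square algebra_simps)
  then have "2 * (cmod a * cmod b) \<le> s * (cmod a)\<^sup>2 + (cmod b)\<^sup>2 / s"
    using assms by (simp add: field_simps)
  moreover have "0 \<le> cmod a * cmod b" by simp
  ultimately show ?thesis unfolding norm_mult complex_mod_cnj by linarith
qed

lemma ell2_inner_summable:
  assumes "f \<in> ell2" "g \<in> ell2"
  shows "(\<lambda>k. cmod (cnj (f k) * g k)) summable_on UNIV"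
proof (rule Infinite_Sum.abs_summable_on_comparison_test')
  show "(\<lambda>k. 1 * (cmod (f k))\<^sup>2 + (cmod (g k))\<^sup>2 / 1) summable_on UNIV"
    using assms unfolding ell2_def mult_1 div_by_1 mem_Collect_eq by (rule summable_on_add)
  show "norm (cnj (f k) * g k) \<le> 1 * (cmod (f k))\<^sup>2 + (cmod (g k))\<^sup>2 / 1" for k
    by (rule cmod_mult_le_weighted) simp
qed

lemma cmod_ell2_inner_le:
  assumes "f \<in> ell2" "g \<in> ell2" "0 < s"
  shows "cmod (ell2_inner f g) \<le> s * ell2_sq f + ell2_sq g / s"
proof -
  have sum: "(\<lambda>k. s * (cmod (f k))\<^sup>2) summable_on UNIV" "(\<lambda>k. inverse s * (cmod (g k))\<^sup>2) summable_on UNIV"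
    using assms by (intro summable_on_cmult_right; simp add: ell2_def)+
  have "cmod (ell2_inner f g) \<le> (\<Sum>\<^sub>\<infinity>k. cmod (cnj (f k) * g k))"
    unfolding ell2_inner_def by (rule norm_infsum_bound[OF ell2_inner_summable[OF assms(1,2)]])
  also have "\<dots> \<le> (\<Sum>\<^sub>\<infinity>k. s * (cmod (f k))\<^sup>2 + inverse s * (cmod (g k))\<^sup>2)"
  proof (rule infsum_mono[OF ell2_inner_summable[OF assms(1,2)] summable_on_add[OF sum]])
    show "cmod (cnj (f k) * g k) \<le> s * (cmod (f k))\<^sup>2 + inverse s * (cmod (g k))\<^sup>2" for k
      using cmod_mult_le_weighted[OF assms(3), of "f k" "g k"] by (simp add: field_simps)
  qed
  also have "\<dots> = s * ell2_sq f + inverse s * ell2_sq g"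
    unfolding ell2_sq_def infsum_add[OF sum] infsum_cmult_right' ..
  finally show ?thesis by (simp add: field_simps)
qed

lemma ell2_inner_self:
  assumes "f \<in> ell2"
  shows "ell2_inner f f = of_real (ell2_sq f)"
proof -
  have "((\<lambda>k. complex_of_real ((cmod (f k))\<^sup>2)) has_sum of_real (ell2_sq f)) UNIV"
    unfolding ell2_sq_def using assms by (intro has_sum_of_real has_sum_infsum) (simp add: ell2_def)
  then show ?thesis
    unfolding ell2_inner_def by (simp add: infsumI mult.commute[of "cnj _"] flip: complex_norm_square)
qed

lemma ell2_inner_cnj: "cnj (ell2_inner f g) = ell2_inner g f"
  unfolding ell2_inner_def infsum_cnj[symmetric] by (rule infsum_cong) simp

lemma ell2_inner_add_right:
  assumes "f \<in> ell2" "g \<in> ell2" "h \<in> ell2"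
  shows "ell2_inner f (\<lambda>k. g k + h k) = ell2_inner f g + ell2_inner f h"
  unfolding ell2_inner_def distrib_left
  by (intro infsum_add ell2_inner_summable[THEN abs_summable_summable] assms)

lemma ell2_inner_scale_right: "ell2_inner f (\<lambda>k. c * g k) = c * ell2_inner f g"
proof -
  have "(\<lambda>k. cnj (f k) * (c * g k)) = (\<lambda>k. c * (cnj (f k) * g k))"
    by (simp add: fun_eq_iff)
  then show ?thesis by (simp add: ell2_inner_def infsum_cmult_right')
qed

lemma ell2_inner_zero_right: "ell2_inner f (\<lambda>_. 0) = 0"
  by (simp add: ell2_inner_def)

lemma ell2_inner_sum_right:
  assumes "f \<in> ell2" "\<And>n. n \<in> I \<Longrightarrow> g n \<in> ell2"
  shows "ell2_inner f (\<lambda>k. \<Sum>n\<in>I. c n * g n k) = (\<Sum>n\<in>I. c n * ell2_inner f (g n))"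
  using assms(2)
proof (induction I rule: infinite_finite_induct)
  case (insert n I)
  then have "ell2_inner f (\<lambda>k. c n * g n k + (\<Sum>n\<in>I. c n * g n k))
      = ell2_inner f (\<lambda>k. c n * g n k) + ell2_inner f (\<lambda>k. \<Sum>n\<in>I. c n * g n k)"
    using assms(1) by (intro ell2_inner_add_right ell2_scale ell2_sum) auto
  with insert show ?case by (simp add: ell2_inner_scale_right)
qed (simp_all add: ell2_inner_zero_right)

lemma ell2_inner_sum_left:
  assumes "f \<in> ell2" "\<And>n. n \<in> I \<Longrightarrow> g n \<in> ell2"
  shows "ell2_inner (\<lambda>k. \<Sum>n\<in>I. c n * g n k) f = (\<Sum>n\<in>I. cnj (c n) * ell2_inner (g n) f)"
proof -
  have "ell2_inner (\<lambda>k. \<Sum>n\<in>I. c n * g n k) f = cnj (ell2_inner f (\<lambda>k. \<Sum>n\<in>I. c n * g n k))"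
    by (simp add: ell2_inner_cnj)
  also have "\<dots> = (\<Sum>n\<in>I. cnj (c n) * ell2_inner (g n) f)"
    using assms by (simp add: ell2_inner_sum_right ell2_inner_cnj)
  finally show ?thesis .
qed

definition basis_vec :: "int \<Rightarrow> int \<Rightarrow> complex" where
  "basis_vec k = (\<lambda>j. if j = k then 1 else 0)"

lemma basis_vec_ell2: "basis_vec k \<in> ell2"
  unfolding ell2_def mem_Collect_eq
  by (subst summable_on_cong_neutral[where T = "{k}" and g = "\<lambda>_. 1"]) (auto simp: basis_vec_def)

lemma ell2_inner_basis_vec: "ell2_inner (basis_vec k) f = f k"
proof -
  have "ell2_inner (basis_vec k) f = infsum (\<lambda>j. f j) {k}"
    unfolding ell2_inner_def by (rule infsum_cong_neutral) (auto simp: basis_vec_def)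
  then show ?thesis by simp
qed

lemma ell2_sq_basis_vec: "ell2_sq (basis_vec k) = 1"
proof -
  have "ell2_sq (basis_vec k) = infsum (\<lambda>_. 1) {k}"
    unfolding ell2_sq_def by (rule infsum_cong_neutral) (auto simp: basis_vec_def)
  then show ?thesis by simp
qed

section \<open>Sums over the integers, block by block\<close>

lemma summable_on_shift_int:
  fixes c :: "int \<Rightarrow> 'a :: {comm_monoid_add, t2_space}"
  assumes "c summable_on UNIV"
  shows "(\<lambda>n. c (n + m)) summable_on UNIV"
proof -
  have "bij_betw (\<lambda>n. n + m) UNIV UNIV" by (rule bij_betwI[where g = "\<lambda>n. n - m"]) auto
  from summable_on_reindex_bij_betw[OF this, of c] assms show ?thesis by blast
qed

lemma infsum_pairs:
  fixes c :: "int \<Rightarrow> complex"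
  assumes P: "\<And>n. P (n + 1) \<longleftrightarrow> \<not> P n" and c: "c summable_on UNIV"
  shows "infsum c UNIV = (\<Sum>\<^sub>\<infinity>n\<in>{n. P n}. c n + c (n + 1))"
proof -
  have bij: "bij_betw (\<lambda>n. n + 1) {n. P n} {n. \<not> P n}"
  proof (intro bij_betwI[where g = "\<lambda>n. n - 1"] Pi_I)
    fix n assume "n \<in> {n. \<not> P n}"
    with P[of "n - 1"] show "n - 1 \<in> {n. P n}" by simp
  next
    fix n assume "n \<in> {n. P n}"
    with P[of n] show "n + 1 \<in> {n. \<not> P n}" by simp
  qed auto
  have sub: "c summable_on A" for A
    using c by (rule summable_on_subset_banach) simp
  have shift: "(\<lambda>n. c (n + 1)) summable_on {n. P n}"
    using sub summable_on_reindex_bij_betw[OF bij, of c] by blast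
  have "infsum c UNIV = infsum c ({n. P n} \<union> {n. \<not> P n})" by (rule arg_cong[where f = "infsum c"]) auto
  also have "\<dots> = infsum c {n. P n} + infsum c {n. \<not> P n}"
    by (rule infsum_Un_disjoint[OF sub sub]) blast
  also have "infsum c {n. \<not> P n} = (\<Sum>\<^sub>\<infinity>n\<in>{n. P n}. c (n + 1))"
    by (rule infsum_reindex_bij_betw[OF bij, symmetric])
  also have "infsum c {n. P n} + \<dots> = (\<Sum>\<^sub>\<infinity>n\<in>{n. P n}. c n + c (n + 1))"
    by (rule infsum_add[OF sub shift, symmetric])
  finally show ?thesis .
qed

section \<open>Band matrices as unitary operators\<close>

lemma block_op_pair:
  assumes "P n" "\<not> P (n + 1)"
  shows "block_op P (\<lambda>k. scatter r t (\<theta> k) (\<alpha> k) (\<gamma> k)) f n =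
      cis (-\<theta> n) * (of_real r * cis (-\<alpha> n) * f n + \<i> * of_real t * cis (\<gamma> n) * f (n + 1))"
    and "block_op P (\<lambda>k. scatter r t (\<theta> k) (\<alpha> k) (\<gamma> k)) f (n + 1) =
      cis (-\<theta> n) * (\<i> * of_real t * cis (-\<gamma> n) * f n + of_real r * cis (\<alpha> n) * f (n + 1))"
  using assms by (simp_all add: block_op_scatter)

text \<open>Unitarity of the block in polarised form, so that inner products and not just norms are
  preserved. Given that each phase factor is inverse to its conjugate and that
  \<open>R^2 + T^2 = 1\<close>, it is a polynomial identity.\<close>

lemma scatter_isometry:
  fixes a b c d :: complex and r t \<theta> \<alpha> \<gamma> :: real
  assumes rt: "r\<^sup>2 + t\<^sup>2 = 1"
  defines "x \<equiv> \<lambda>a b. cis (-\<theta>) * (of_real r * cis (-\<alpha>) * a + \<i> * of_real t * cis \<gamma> * b)"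
    and "y \<equiv> \<lambda>a b. cis (-\<theta>) * (\<i> * of_real t * cis (-\<gamma>) * a + of_real r * cis \<alpha> * b)"
  shows "cnj (x a b) * x c d + cnj (y a b) * y c d = cnj a * c + cnj b * d"
proof -
  define R T where "R = complex_of_real r" and "T = complex_of_real t"
  have RT: "R * R + T * T = 1"
    using rt by (simp add: R_def T_def power2_eq_square flip: of_real_mult of_real_add)
  have inv: "cis \<theta> * cis (-\<theta>) = 1" "cis \<alpha> * cis (-\<alpha>) = 1" "cis \<gamma> * cis (-\<gamma>) = 1"
    by (simp_all add: cis_mult)
  define p p' q q' s s' where "p = cis \<theta>" "p' = cis (-\<theta>)" "q = cis \<alpha>" "q' = cis (-\<alpha>)" "s = cis \<gamma>" "s' = cis (-\<gamma>)"
  note defs = p_p'_q_q'_s_s'_def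
  have c: "cnj p' = p" "cnj q' = q" "cnj q = q'" "cnj s = s'" "cnj s' = s" "cnj R = R" "cnj T = T"
    by (simp_all add: defs cis_cnj R_def T_def)
  have inv': "p * p' = 1" "q * q' = 1" "s * s' = 1" using inv by (simp_all add: defs)
  show ?thesis
    unfolding x_def y_def R_def[symmetric] T_def[symmetric] defs[symmetric]
    unfolding complex_cnj_mult complex_cnj_add complex_cnj_i c
    using inv' RT i_squared unfolding power2_eq_square by algebra
qed

lemma block_op_inner:
  fixes P :: "int \<Rightarrow> bool" and r t :: real and \<theta> \<alpha> \<gamma> :: "int \<Rightarrow> real"
  assumes P: "\<And>n. P (n + 1) \<longleftrightarrow> \<not> P n" and rt: "r\<^sup>2 + t\<^sup>2 = 1"
  defines "S \<equiv> \<lambda>k. scatter r t (\<theta> k) (\<alpha> k) (\<gamma> k)"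
  assumes f: "f \<in> ell2" and g: "g \<in> ell2"
  shows "block_op P S f \<in> ell2" "ell2_inner (block_op P S f) (block_op P S g) = ell2_inner f g"
proof -
  let ?B = "block_op P S"
  have pair: "cnj (?B f n) * ?B g n + cnj (?B f (n + 1)) * ?B g (n + 1) = cnj (f n) * g n + cnj (f (n + 1)) * g (n + 1)"
    if "P n" for f g n
  proof -
    have n: "\<not> P (n + 1)" using that P[of n] by simp
    show ?thesis unfolding S_def block_op_pair[OF that n] by (rule scatter_isometry[OF rt])
  qed
  have pair_le: "(cmod (?B f n))\<^sup>2 \<le> (cmod (f n))\<^sup>2 + (cmod (f (n + 1)))\<^sup>2"
     "(cmod (?B f (n + 1)))\<^sup>2 \<le> (cmod (f n))\<^sup>2 + (cmod (f (n + 1)))\<^sup>2" if "P n" for f n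
  proof -
    have "complex_of_real ((cmod (?B f n))\<^sup>2 + (cmod (?B f (n + 1)))\<^sup>2)
        = of_real ((cmod (f n))\<^sup>2 + (cmod (f (n + 1)))\<^sup>2)"
      using pair[OF that, of f f] by (simp add: mult.commute[of "cnj _"] flip: complex_norm_square)
    then have "(cmod (?B f n))\<^sup>2 + (cmod (?B f (n + 1)))\<^sup>2 = (cmod (f n))\<^sup>2 + (cmod (f (n + 1)))\<^sup>2"
      by (simp only: of_real_eq_iff)
    then show "(cmod (?B f n))\<^sup>2 \<le> (cmod (f n))\<^sup>2 + (cmod (f (n + 1)))\<^sup>2"
      "(cmod (?B f (n + 1)))\<^sup>2 \<le> (cmod (f n))\<^sup>2 + (cmod (f (n + 1)))\<^sup>2"
      using zero_le_power2[of "cmod (?B f n)"] zero_le_power2[of "cmod (?B f (n + 1))"] by linarith+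
  qed
  have mem: "?B f \<in> ell2" if "f \<in> ell2" for f
  proof (rule ell2_comparison)
    have s: "(\<lambda>n. (cmod (f n))\<^sup>2) summable_on UNIV" using that by (simp add: ell2_def)
    \<comment> \<open>The partner of \<open>n\<close> in its block is \<open>n + 1\<close> or
      \<open>n - 1\<close>; a majorant containing both neighbours serves either case.\<close>
    show "(\<lambda>n. (cmod (f n))\<^sup>2 + (cmod (f (n + 1)))\<^sup>2 + (cmod (f (n + (-1))))\<^sup>2) summable_on UNIV"
      by (intro summable_on_add s summable_on_shift_int[OF s])
    show "(cmod (?B f n))\<^sup>2 \<le> (cmod (f n))\<^sup>2 + (cmod (f (n + 1)))\<^sup>2 + (cmod (f (n + (-1))))\<^sup>2" for n
    proof (cases "P n")
      case True
      then show ?thesis using pair_le(1)[OF True, of f] by (simp add: add_increasing2)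
    next
      case False
      then have "P (n - 1)" using P[of "n - 1"] by simp
      then have "(cmod (?B f n))\<^sup>2 \<le> (cmod (f (n + (-1))))\<^sup>2 + (cmod (f n))\<^sup>2"
        using pair_le(2)[of "n - 1" f] by simp
      then show ?thesis using zero_le_power2[of "cmod (f (n + 1))"] by linarith
    qed
  qed
  then show "?B f \<in> ell2" using f .
  have "ell2_inner (?B f) (?B g) = (\<Sum>\<^sub>\<infinity>n\<in>{n. P n}. cnj (?B f n) * ?B g n + cnj (?B f (n + 1)) * ?B g (n + 1))"
    unfolding ell2_inner_def
    by (rule infsum_pairs[of P, OF P ell2_inner_summable[THEN abs_summable_summable]]) (intro mem f g)+
  also have "\<dots> = (\<Sum>\<^sub>\<infinity>n\<in>{n. P n}. cnj (f n) * g n + cnj (f (n + 1)) * g (n + 1))"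
    by (intro infsum_cong pair) simp
  also have "\<dots> = ell2_inner f g"
    unfolding ell2_inner_def
    by (rule infsum_pairs[of P, OF P ell2_inner_summable[THEN abs_summable_summable], symmetric]) (intro f g)+
  finally show "ell2_inner (?B f) (?B g) = ell2_inner f g" .
qed

text \<open>The adjoint of a scattering matrix is again one, with \<open>t\<close>, \<theta> and
  \<alpha> negated and \<gamma> kept. The inversion is blockwise and so holds for arbitrary
  sequences.\<close>

lemma block_op_inverse:
  assumes P: "\<And>n. P (n + 1) \<longleftrightarrow> \<not> P n" and rt: "r\<^sup>2 + t\<^sup>2 = 1"
  shows "block_op P (\<lambda>k. scatter r (-t) (- \<theta> k) (- \<alpha> k) (\<gamma> k))
           (block_op P (\<lambda>k. scatter r t (\<theta> k) (\<alpha> k) (\<gamma> k)) f) = f"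
    (is "?B' (?B f) = f")
proof -
  have pair: "?B' (?B f) n = f n" "?B' (?B f) (n + 1) = f (n + 1)" if "P n" for n
  proof -
    have n: "\<not> P (n + 1)" using P[of n] that by simp
    define R T where "R = complex_of_real r" and "T = complex_of_real t"
    have RT: "R * R + T * T = 1"
      using rt by (simp add: R_def T_def power2_eq_square flip: of_real_mult of_real_add)
    have inv: "cis (\<theta> n) * cis (-\<theta> n) = 1" "cis (\<alpha> n) * cis (-\<alpha> n) = 1" "cis (\<gamma> n) * cis (-\<gamma> n) = 1"
      by (simp_all add: cis_mult)
    show "?B' (?B f) n = f n" "?B' (?B f) (n + 1) = f (n + 1)"
      unfolding block_op_pair[OF that n] of_real_minus minus_minus R_def[symmetric] T_def[symmetric]
      using inv RT i_squared unfolding power2_eq_square by algebra+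
  qed
  show ?thesis
  proof
    fix n show "?B' (?B f) n = f n"
      using pair(1)[of n] pair(2)[of "n - 1"] P[of "n - 1"] by (cases "P n") auto
  qed
qed

lemma block_op_lincomb:
  "block_op P S (\<lambda>k. c * f k + d * g k) n = c * block_op P S f n + d * block_op P S g n"
  by (simp add: block_op_def matrix_vector_mult_def sum_2 algebra_simps)

lemma block_op_tendsto:
  assumes "\<And>k. (\<lambda>j. \<psi> j k) \<longlonglongrightarrow> \<phi> k"
  shows "(\<lambda>j. block_op P S (\<psi> j) n) \<longlonglongrightarrow> block_op P S \<phi> n"
  unfolding block_op_def matrix_vector_mult_def
  by (auto simp: sum_2 intro!: tendsto_intros assms)

text \<open>What the spectral argument uses of the operator; \<open>V\<close> is its inverse.
  Algebraic laws hold for all sequences, metric ones on \<open>ell2\<close>. Continuity under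
  coordinatewise limits reflects the band structure, each output coordinate depending on finitely
  many inputs, and makes sense of limits of approximate solutions that may leave
  \<open>ell2\<close>.\<close>

locale band_unitary =
  fixes U V :: "(int \<Rightarrow> complex) \<Rightarrow> (int \<Rightarrow> complex)"
  assumes U_lincomb: "U (\<lambda>k. c * f k + d * g k) = (\<lambda>k. c * U f k + d * U g k)"
    and V_lincomb: "V (\<lambda>k. c * f k + d * g k) = (\<lambda>k. c * V f k + d * V g k)"
    and U_V: "U (V f) = f" and V_U: "V (U f) = f"
    and U_ell2: "f \<in> ell2 \<Longrightarrow> U f \<in> ell2" and V_ell2: "f \<in> ell2 \<Longrightarrow> V f \<in> ell2"
    and U_inner: "f \<in> ell2 \<Longrightarrow> g \<in> ell2 \<Longrightarrow> ell2_inner (U f) (U g) = ell2_inner f g"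
    and U_tendsto: "(\<And>k. (\<lambda>j. \<psi> j k) \<longlonglongrightarrow> \<phi> k) \<Longrightarrow> (\<lambda>j. U (\<psi> j) n) \<longlonglongrightarrow> U \<phi> n"

lemma band_op_band_unitary:
  assumes rt: "r\<^sup>2 + t\<^sup>2 = 1"
  shows "band_unitary (band_op r t \<theta> \<alpha> \<gamma>)
    (block_op even (\<lambda>k. scatter r (-t) (- \<theta> k) (- \<alpha> k) (\<gamma> k)) \<circ>
     block_op odd (\<lambda>k. scatter r (-t) (- \<theta> k) (- \<alpha> k) (\<gamma> k)))"
proof -
  have rt': "r\<^sup>2 + (-t)\<^sup>2 = 1" using rt by simp
  have P: "even (n + 1) \<longleftrightarrow> \<not> even n" "odd (n + 1) \<longleftrightarrow> \<not> odd n" for n :: int by auto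
  have inv: "block_op P (\<lambda>k. scatter r t (\<theta> k) (\<alpha> k) (\<gamma> k))
           (block_op P (\<lambda>k. scatter r (-t) (- \<theta> k) (- \<alpha> k) (\<gamma> k)) f) = f"
    if "\<And>n. P (n + 1) \<longleftrightarrow> \<not> P n" for P f
    using block_op_inverse[of P, OF that rt', of "\<lambda>k. - \<theta> k" "\<lambda>k. - \<alpha> k"] by simp
  show ?thesis
    by unfold_locales
      (simp_all add: band_op_def Let_def fun_eq_iff block_op_lincomb[abs_def]
         inv[of even, OF P(1)] inv[of odd, OF P(2)] block_op_inverse[of even, OF P(1) rt] block_op_inverse[of odd, OF P(2) rt]
         block_op_inner[of even, OF P(1) rt] block_op_inner[of odd, OF P(2) rt]
         block_op_inner[of even, OF P(1) rt'] block_op_inner[of odd, OF P(2) rt'] block_op_tendsto)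
qed

section \<open>Fejer means\<close>

lemma ell2_sq_add_le:
  assumes "f \<in> ell2" "g \<in> ell2"
  shows "ell2_sq (\<lambda>k. f k + g k) \<le> 2 * (ell2_sq f + ell2_sq g)"
proof -
  have f: "(\<lambda>k. (cmod (f k))\<^sup>2) summable_on UNIV" and g: "(\<lambda>k. (cmod (g k))\<^sup>2) summable_on UNIV"
    and fg: "(\<lambda>k. (cmod (f k + g k))\<^sup>2) summable_on UNIV"
    using assms ell2_add[OF assms] by (auto simp: ell2_def)
  have "ell2_sq (\<lambda>k. f k + g k) \<le> (\<Sum>\<^sub>\<infinity>k. 2 * ((cmod (f k))\<^sup>2 + (cmod (g k))\<^sup>2))"
    unfolding ell2_sq_def
    by (rule infsum_mono[OF fg summable_on_cmult_right[OF summable_on_add[OF f g]] cmod_add_square_le])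
  also have "\<dots> = 2 * (ell2_sq f + ell2_sq g)"
    unfolding infsum_cmult_right' infsum_add[OF f g] ell2_sq_def ..
  finally show ?thesis .
qed

context band_unitary
begin

lemma U_scale: "U (\<lambda>k. c * f k) = (\<lambda>k. c * U f k)"
  using U_lincomb[of c f 0 "\<lambda>_. 0"] by simp

lemma V_scale: "V (\<lambda>k. c * f k) = (\<lambda>k. c * V f k)"
  using V_lincomb[of c f 0 "\<lambda>_. 0"] by simp

lemma U_zero: "U (\<lambda>_. 0) = (\<lambda>_. 0)"
  using U_scale[of 0 "\<lambda>_. 0"] by simp

lemma V_zero: "V (\<lambda>_. 0) = (\<lambda>_. 0)"
  using V_scale[of 0 "\<lambda>_. 0"] by simp

lemma U_sum: "U (\<lambda>k. \<Sum>n\<in>I. c n * f n k) = (\<lambda>k. \<Sum>n\<in>I. c n * U (f n) k)"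
proof (induction I rule: infinite_finite_induct)
  case (insert n I)
  then show ?case
    using U_lincomb[of "c n" "f n" 1 "\<lambda>k. \<Sum>n\<in>I. c n * f n k"] by simp
qed (simp_all add: U_zero)

lemma V_sum: "V (\<lambda>k. \<Sum>n\<in>I. c n * f n k) = (\<lambda>k. \<Sum>n\<in>I. c n * V (f n) k)"
proof (induction I rule: infinite_finite_induct)
  case (insert n I)
  then show ?case
    using V_lincomb[of "c n" "f n" 1 "\<lambda>k. \<Sum>n\<in>I. c n * f n k"] by simp
qed (simp_all add: V_zero)

lemma V_pow_sum: "(V ^^ m) (\<lambda>k. \<Sum>n\<in>I. c n * f n k) = (\<lambda>k. \<Sum>n\<in>I. c n * (V ^^ m) (f n) k)"
  by (induction m) (simp_all add: V_sum)

lemma U_pow_ell2: "f \<in> ell2 \<Longrightarrow> (U ^^ n) f \<in> ell2"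
  by (induction n) (auto intro: U_ell2)

lemma V_pow_ell2: "f \<in> ell2 \<Longrightarrow> (V ^^ n) f \<in> ell2"
  by (induction n) (auto intro: V_ell2)

lemma U_pow_inner: "f \<in> ell2 \<Longrightarrow> g \<in> ell2 \<Longrightarrow> ell2_inner ((U ^^ n) f) ((U ^^ n) g) = ell2_inner f g"
  by (induction n) (auto simp: U_inner U_pow_ell2)

lemma ell2_sq_U_pow: "f \<in> ell2 \<Longrightarrow> ell2_sq ((U ^^ n) f) = ell2_sq f"
  using U_pow_inner[of f f n] by (simp add: ell2_inner_self U_pow_ell2)

lemma V_pow_U_pow: "(V ^^ n) ((U ^^ n) f) = f"
proof (induction n arbitrary: f)
  case (Suc n)
  have "(V ^^ Suc n) ((U ^^ Suc n) f) = V ((V ^^ n) ((U ^^ n) (U f)))"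
    by (simp add: funpow_swap1)
  then show ?case by (simp add: Suc V_U)
qed simp

lemma U_pow_V_pow: "(U ^^ n) ((V ^^ n) f) = f"
proof (induction n arbitrary: f)
  case (Suc n)
  have "(U ^^ Suc n) ((V ^^ Suc n) f) = U ((U ^^ n) ((V ^^ n) (V f)))"
    by (simp add: funpow_swap1)
  then show ?case by (simp add: Suc U_V)
qed simp

lemma U_V_pow_commute: "U ((V ^^ n) f) = (V ^^ n) (U f)"
proof (induction n)
  case (Suc n)
  have "U ((V ^^ Suc n) f) = (V ^^ n) f" by (simp add: U_V)
  also have "\<dots> = V (U ((V ^^ n) f))" by (simp add: V_U)
  finally show ?case by (simp add: Suc)
qed simp

lemma V_pow_inner:
  assumes "f \<in> ell2" "g \<in> ell2"
  shows "ell2_inner f ((V ^^ n) g) = ell2_inner ((U ^^ n) f) g"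
  using U_pow_inner[OF assms(1) V_pow_ell2[OF assms(2)], of n n] by (simp add: U_pow_V_pow)

text \<open>The operator \<open>D\<close> of the overview at \<open>z = cis \<xi>\<close>. The next
  definition is its adjoint, since \<open>V\<close> is the inverse of a unitary operator.\<close>

definition wave :: "nat \<Rightarrow> real \<Rightarrow> (int \<Rightarrow> complex) \<Rightarrow> int \<Rightarrow> complex" where
  "wave N \<xi> f = (\<lambda>k. \<Sum>n<N. cis (- (real n * \<xi>)) * (U ^^ n) f k)"

definition wave_adj :: "nat \<Rightarrow> real \<Rightarrow> (int \<Rightarrow> complex) \<Rightarrow> int \<Rightarrow> complex" where
  "wave_adj N \<xi> f = (\<lambda>k. \<Sum>n<N. cis (real n * \<xi>) * (V ^^ n) f k)"

text \<open>Fejer mean of the Fourier series of the spectral density of \<open>f\<close>: at a point \<open>cis \<xi>\<close>, an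
  approximate generalized eigenfunction.\<close>

definition fejer :: "nat \<Rightarrow> (int \<Rightarrow> complex) \<Rightarrow> real \<Rightarrow> int \<Rightarrow> complex" where
  "fejer N f \<xi> = (\<lambda>k. inverse (of_nat N) * wave_adj N \<xi> (wave N \<xi> f) k)"

lemma wave_ell2: "f \<in> ell2 \<Longrightarrow> wave N \<xi> f \<in> ell2"
  unfolding wave_def by (intro ell2_sum ell2_scale U_pow_ell2)

lemma fejer_expand:
  "fejer N f \<xi> k =
    (\<Sum>m<N. \<Sum>n<N. cis ((real m - real n) * \<xi>) * (inverse (of_nat N) * (V ^^ m) ((U ^^ n) f) k))"
proof -
  have "fejer N f \<xi> k = inverse (of_nat N) *
     (\<Sum>m<N. cis (real m * \<xi>) * (\<Sum>n<N. cis (- (real n * \<xi>)) * (V ^^ m) ((U ^^ n) f) k))"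
    unfolding fejer_def wave_adj_def wave_def by (simp only: V_pow_sum)
  also have "\<dots> = (\<Sum>m<N. \<Sum>n<N. (cis (real m * \<xi>) * cis (- (real n * \<xi>))) *
      (inverse (of_nat N) * (V ^^ m) ((U ^^ n) f) k))"
    by (simp add: sum_distrib_left mult_ac)
  finally show ?thesis by (simp add: cis_mult left_diff_distrib)
qed

text \<open>Adjointness tested on a basis vector. A single coordinate is thereby controlled by the
  norm of \<open>wave\<close> at \<open>basis_vec k\<close>, a quantity of the same kind as the one
  for \<open>f\<close>.\<close>

lemma wave_adj_inner:
  assumes "g \<in> ell2"
  shows "wave_adj N \<xi> g k = ell2_inner (wave N \<xi> (basis_vec k)) g"
proof -
  have "ell2_inner (wave N \<xi> (basis_vec k)) g =
      (\<Sum>n<N. cnj (cis (- (real n * \<xi>))) * ell2_inner ((U ^^ n) (basis_vec k)) g)"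
    unfolding wave_def using assms by (intro ell2_inner_sum_left U_pow_ell2 basis_vec_ell2)
  also have "\<dots> = wave_adj N \<xi> g k"
    unfolding wave_adj_def
    using assms by (intro sum.cong) (auto simp: cis_cnj V_pow_inner[symmetric] basis_vec_ell2 ell2_inner_basis_vec)
  finally show ?thesis ..
qed

lemma ell2_sq_wave:
  assumes "f \<in> ell2"
  shows "of_real (ell2_sq (wave N \<xi> f)) =
    (\<Sum>m<N. \<Sum>n<N. cis ((real m - real n) * \<xi>) * ell2_inner ((U ^^ m) f) ((U ^^ n) f))"
proof -
  have left: "ell2_inner (wave N \<xi> f) h = (\<Sum>m<N. cnj (cis (- (real m * \<xi>))) * ell2_inner ((U ^^ m) f) h)"
    if "h \<in> ell2" for h
    unfolding wave_def using assms that by (intro ell2_inner_sum_left U_pow_ell2)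
  have "of_real (ell2_sq (wave N \<xi> f)) = ell2_inner (wave N \<xi> f) (wave N \<xi> f)"
    using assms by (simp add: ell2_inner_self wave_ell2)
  also have "\<dots> = (\<Sum>m<N. cnj (cis (- (real m * \<xi>))) * ell2_inner ((U ^^ m) f) (wave N \<xi> f))"
    by (rule left[OF wave_ell2[OF assms]])
  also have "\<dots> = (\<Sum>m<N. cis (real m * \<xi>) * (\<Sum>n<N. cis (- (real n * \<xi>)) * ell2_inner ((U ^^ m) f) ((U ^^ n) f)))"
  proof (intro sum.cong refl)
    fix m
    have "ell2_inner ((U ^^ m) f) (wave N \<xi> f) =
        (\<Sum>n<N. cis (- (real n * \<xi>)) * ell2_inner ((U ^^ m) f) ((U ^^ n) f))"
      unfolding wave_def using assms by (intro ell2_inner_sum_right U_pow_ell2)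
    then show "cnj (cis (- (real m * \<xi>))) * ell2_inner ((U ^^ m) f) (wave N \<xi> f) =
       cis (real m * \<xi>) * (\<Sum>n<N. cis (- (real n * \<xi>)) * ell2_inner ((U ^^ m) f) ((U ^^ n) f))"
      by (simp add: cis_cnj)
  qed
  also have "\<dots> = (\<Sum>m<N. \<Sum>n<N. (cis (real m * \<xi>) * cis (- (real n * \<xi>))) * ell2_inner ((U ^^ m) f) ((U ^^ n) f))"
    by (simp add: sum_distrib_left mult_ac)
  finally show ?thesis by (simp add: cis_mult left_diff_distrib)
qed

lemma cmod_wave_adj_le:
  assumes "g \<in> ell2" "0 < s"
  shows "cmod (wave_adj N \<xi> g k) \<le> s * ell2_sq (wave N \<xi> (basis_vec k)) + ell2_sq g / s"
  using assms by (simp add: wave_adj_inner cmod_ell2_inner_le wave_ell2 basis_vec_ell2)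

text \<open>The coordinate is the inner product of \<open>wave\<close> at \<open>basis_vec k\<close>
  and \<open>wave\<close> at \<open>f\<close>, divided by \<open>N\<close>. Both summands on the
  right have integrals over the angle that do not depend on \<open>N\<close>.\<close>

lemma cmod_fejer_le:
  assumes "f \<in> ell2" "0 < s"
  shows "cmod (fejer N f \<xi> k) \<le> s * (ell2_sq (wave N \<xi> (basis_vec k)) / N) + ell2_sq (wave N \<xi> f) / N / s"
proof -
  have "cmod (fejer N f \<xi> k) = cmod (wave_adj N \<xi> (wave N \<xi> f) k) / N"
    by (simp add: fejer_def norm_mult norm_inverse divide_inverse)
  also have "\<dots> \<le> (s * ell2_sq (wave N \<xi> (basis_vec k)) + ell2_sq (wave N \<xi> f) / s) / N"
    using assms by (intro divide_right_mono cmod_wave_adj_le wave_ell2) auto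
  finally show ?thesis by (simp add: add_divide_distrib mult.commute)
qed

text \<open>\<open>(U - z) D\<close> telescopes to the boundary terms
  \<open>z^(1 - N) U^N - z\<close>, whose size does not grow with \<open>N\<close>; the factor
  \<open>1 / N\<close> then makes the residual small.\<close>

lemma fejer_residual:
  "U (fejer N f \<xi>) k - cis \<xi> * fejer N f \<xi> k = inverse (of_nat N) *
     wave_adj N \<xi> (\<lambda>k. cis (\<xi> - real N * \<xi>) * (U ^^ N) f k + (- cis \<xi>) * f k) k"
proof -
  let ?a = "\<lambda>n k. cis (\<xi> - real n * \<xi>) * (U ^^ n) f k"
  have adj_lin: "wave_adj N \<xi> (\<lambda>k. c * g k + d * h k) k = c * wave_adj N \<xi> g k + d * wave_adj N \<xi> h k" for c d g h k
  proof -
    have "(V ^^ n) (\<lambda>k. c * g k + d * h k) = (\<lambda>k. c * (V ^^ n) g k + d * (V ^^ n) h k)" for n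
      by (induction n) (simp_all add: V_lincomb)
    then show ?thesis by (simp add: wave_adj_def sum_distrib_left sum.distrib algebra_simps)
  qed
  have "U (fejer N f \<xi>) k = inverse (of_nat N) * wave_adj N \<xi> (U (wave N \<xi> f)) k"
    unfolding fejer_def wave_adj_def U_scale U_sum U_V_pow_commute ..
  then have "U (fejer N f \<xi>) k - cis \<xi> * fejer N f \<xi> k = inverse (of_nat N) *
      wave_adj N \<xi> (\<lambda>k. 1 * U (wave N \<xi> f) k + (- cis \<xi>) * wave N \<xi> f k) k"
    unfolding adj_lin by (simp add: fejer_def algebra_simps)
  also have "(\<lambda>k. 1 * U (wave N \<xi> f) k + (- cis \<xi>) * wave N \<xi> f k) = (\<lambda>k. \<Sum>n<N. ?a (Suc n) k - ?a n k)"
  proof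
    fix k
    have "1 * (cis (- (real n * \<xi>)) * U ((U ^^ n) f) k) + (- cis \<xi>) * (cis (- (real n * \<xi>)) * (U ^^ n) f k)
        = ?a (Suc n) k - ?a n k" for n
    proof -
      have "cis (\<xi> - real (Suc n) * \<xi>) = cis (- (real n * \<xi>))"
        "cis (\<xi> - real n * \<xi>) = cis \<xi> * cis (- (real n * \<xi>))"
        by (simp_all add: cis_mult distrib_right)
      then show ?thesis by simp
    qed
    then show "1 * U (wave N \<xi> f) k + (- cis \<xi>) * wave N \<xi> f k = (\<Sum>n<N. ?a (Suc n) k - ?a n k)"
      unfolding wave_def U_sum sum_distrib_left sum.distrib[symmetric] by (intro sum.cong refl)
  qed
  also have "\<dots> = (\<lambda>k. ?a N k - ?a 0 k)"
    by (rule ext) (rule sum_lessThan_telescope)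
  finally show ?thesis by simp
qed

lemma cmod_fejer_residual_le:
  assumes f: "f \<in> ell2" and s: "0 < s"
  shows "cmod (U (fejer N f \<xi>) k - cis \<xi> * fejer N f \<xi> k) \<le>
    s * (ell2_sq (wave N \<xi> (basis_vec k)) / N) + 4 * ell2_sq f / N / s"
proof -
  define g where "g = (\<lambda>k. cis (\<xi> - real N * \<xi>) * (U ^^ N) f k + (- cis \<xi>) * f k)"
  have mem: "(\<lambda>k. cis (\<xi> - real N * \<xi>) * (U ^^ N) f k) \<in> ell2" "(\<lambda>k. - cis \<xi> * f k) \<in> ell2"
    by (rule ell2_scale[OF U_pow_ell2[OF f]], rule ell2_scale[OF f])
  have g: "g \<in> ell2" unfolding g_def by (rule ell2_add[OF mem])
  have "ell2_sq g \<le> 2 * (ell2_sq (\<lambda>k. cis (\<xi> - real N * \<xi>) * (U ^^ N) f k) + ell2_sq (\<lambda>k. - cis \<xi> * f k))"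
    unfolding g_def by (rule ell2_sq_add_le[OF mem])
  also have "\<dots> = 4 * ell2_sq f"
    using f by (subst (1 2) ell2_sq_scale) (auto simp: U_pow_ell2 ell2_sq_U_pow)
  finally have g4: "ell2_sq g \<le> 4 * ell2_sq f" .
  have "cmod (U (fejer N f \<xi>) k - cis \<xi> * fejer N f \<xi> k) = cmod (wave_adj N \<xi> g k) / N"
    unfolding fejer_residual g_def[symmetric] by (simp add: norm_mult norm_inverse divide_inverse)
  also have "\<dots> \<le> (s * ell2_sq (wave N \<xi> (basis_vec k)) + ell2_sq g / s) / N"
    using g s by (intro divide_right_mono cmod_wave_adj_le) auto
  also have "\<dots> \<le> (s * ell2_sq (wave N \<xi> (basis_vec k)) + 4 * ell2_sq f / s) / N"
    using g4 s by (intro divide_right_mono add_left_mono) auto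
  finally show ?thesis by (simp add: add_divide_distrib mult.commute)
qed

end

section \<open>Trigonometric polynomials and uniform integrability\<close>

definition angle_measure :: "real measure" where
  "angle_measure = restrict_space lborel {0..<2 * pi}"

lemma circle_lebesgue_alt: "circle_lebesgue = distr angle_measure borel cis"
  by (simp add: circle_lebesgue_def angle_measure_def)

lemma emeasure_angle_measure_space: "emeasure angle_measure (space angle_measure) = ennreal (2 * pi)"
  by (simp add: angle_measure_def space_restrict_space emeasure_restrict_space)

lemma finite_measure_angle_measure: "finite_measure angle_measure"
  by (rule finite_measureI) (simp add: emeasure_angle_measure_space)

lemma measurable_angle_measure: "f \<in> borel_measurable borel \<Longrightarrow> f \<in> borel_measurable angle_measure"
  unfolding angle_measure_def by (intro measurable_restrict_space1) simp

lemma cis_measurable: "(\<lambda>\<xi>. cis (c * \<xi> + d)) \<in> borel_measurable borel"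
  by (intro borel_measurable_continuous_onI continuous_intros)

lemma integrable_cis: "integrable angle_measure (\<lambda>\<xi>. cis (c * \<xi>))"
proof -
  interpret finite_measure angle_measure by (rule finite_measure_angle_measure)
  show ?thesis
    using cis_measurable[of c 0]
    by (intro integrable_const_bound[of _ 1] measurable_angle_measure) auto
qed

lemma integral_cis:
  fixes j :: int
  shows "(LINT \<xi>|angle_measure. cis (of_int j * \<xi>)) = (if j = 0 then of_real (2 * pi) else 0)"
proof (cases "j = 0")
  case True
  then show ?thesis
    using emeasure_angle_measure_space by (simp add: measure_def of_real_def)
next
  case False
  let ?F = "\<lambda>x. exp (\<i> * of_int j * of_real x) / (\<i> * of_int j)"
  have eq: "cis (of_int j * x) = exp (\<i> * of_int j * of_real x)" for x
    by (simp add: cis_conv_exp mult.assoc)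
  have "(LINT \<xi>|angle_measure. cis (of_int j * \<xi>)) =
      (LINT \<xi>|lborel. indicator {0..<2 * pi} \<xi> *\<^sub>R cis (of_int j * \<xi>))"
    unfolding angle_measure_def by (rule integral_restrict_space) simp
  \<comment> \<open>The right end point is a null set; the closed interval is the one for the
    fundamental theorem.\<close>
  also have "\<dots> = (LINT \<xi>|lborel. indicator {0..2 * pi} \<xi> *\<^sub>R cis (of_int j * \<xi>))"
  proof (rule integral_cong_AE)
    show "AE x in lborel. indicator {0..<2 * pi} x *\<^sub>R cis (of_int j * x) =
        indicator {0..2 * pi} x *\<^sub>R cis (of_int j * x)"
      using AE_lborel_singleton[of "2 * pi"] by eventually_elim (auto simp: indicator_def)
  qed (use cis_measurable[of "of_int j" 0] in auto)
  also have "\<dots> = ?F (2 * pi) - ?F 0"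
  proof (rule integral_FTC_atLeastAtMost)
    fix x
    have "((\<lambda>w. exp (\<i> * of_int j * w) / (\<i> * of_int j)) has_field_derivative exp (\<i> * of_int j * of_real x))
        (at (of_real x))"
      using False by (auto intro!: derivative_eq_intros)
    then show "(?F has_vector_derivative cis (of_int j * x)) (at x within {0..2 * pi})"
      unfolding eq by (rule has_vector_derivative_real_field[THEN has_vector_derivative_at_within])
  next
    show "continuous_on {0..2 * pi} (\<lambda>x. cis (of_int j * x))" by (intro continuous_intros)
  qed simp
  also have "\<dots> = 0"
  proof -
    have "exp (\<i> * of_int j * of_real (2 * pi)) = 1"
      using exp_integer_2pi[of "of_int j"] by (simp add: mult_ac)
    then show ?thesis by simp
  qed
  finally show ?thesis using False by simp
qed

text \<open>Orthogonality of characters leaves the diagonal. Coordinates of Fejer means, squared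
  norms of \<open>wave\<close> and the squared Dirichlet kernel are all double sums of this
  shape.\<close>

lemma trig_polynomial_integral:
  fixes c :: "nat \<Rightarrow> nat \<Rightarrow> complex"
  shows "integrable angle_measure (\<lambda>\<xi>. \<Sum>m<N. \<Sum>n<N. cis ((real m - real n) * \<xi>) * c m n)"
    and "(LINT \<xi>|angle_measure. (\<Sum>m<N. \<Sum>n<N. cis ((real m - real n) * \<xi>) * c m n)) =
      of_real (2 * pi) * (\<Sum>m<N. c m m)"
proof -
  have int: "integrable angle_measure (\<lambda>\<xi>. cis ((real m - real n) * \<xi>) * c m n)" for m n
    by (intro integrable_mult_left integrable_cis)
  then show "integrable angle_measure (\<lambda>\<xi>. \<Sum>m<N. \<Sum>n<N. cis ((real m - real n) * \<xi>) * c m n)"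
    by (intro Bochner_Integration.integrable_sum)
  have val: "(LINT \<xi>|angle_measure. cis ((real m - real n) * \<xi>)) = (if n = m then of_real (2 * pi) else 0)" for m n
    using integral_cis[of "int m - int n"] by (simp del: of_real_mult)
  have "(LINT \<xi>|angle_measure. (\<Sum>m<N. \<Sum>n<N. cis ((real m - real n) * \<xi>) * c m n))
     = (\<Sum>m<N. \<Sum>n<N. (LINT \<xi>|angle_measure. cis ((real m - real n) * \<xi>)) * c m n)"
    by (simp add: Bochner_Integration.integral_sum Bochner_Integration.integrable_sum int integrable_cis)
  also have "\<dots> = (\<Sum>m<N. of_real (2 * pi) * c m m)"
    unfolding val by (intro sum.cong refl) (simp add: if_distrib[of "\<lambda>a. a * _"] sum.delta' cong: if_cong)
  finally show "(LINT \<xi>|angle_measure. (\<Sum>m<N. \<Sum>n<N. cis ((real m - real n) * \<xi>) * c m n)) =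
      of_real (2 * pi) * (\<Sum>m<N. c m m)"
    by (simp add: sum_distrib_left)
qed

lemma trig_polynomial_nn_integral:
  fixes F :: "real \<Rightarrow> real"
  assumes F: "\<And>\<xi>. of_real (F \<xi>) = (\<Sum>m<N. \<Sum>n<N. cis ((real m - real n) * \<xi>) * c m n)"
    and nonneg: "\<And>\<xi>. 0 \<le> F \<xi>"
  shows "F \<in> borel_measurable borel"
    and "(\<integral>\<^sup>+\<xi>. ennreal (F \<xi>) \<partial>angle_measure) = ennreal (2 * pi * Re (\<Sum>m<N. c m m))"
proof -
  have Re: "F = (\<lambda>\<xi>. Re (\<Sum>m<N. \<Sum>n<N. cis ((real m - real n) * \<xi>) * c m n))"
    unfolding F[symmetric] by simp
  show "F \<in> borel_measurable borel"
    unfolding Re by (intro borel_measurable_continuous_onI continuous_intros)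
  have "integrable angle_measure F"
    unfolding Re by (intro integrable_Re trig_polynomial_integral)
  moreover have "(LINT \<xi>|angle_measure. F \<xi>) = 2 * pi * Re (\<Sum>m<N. c m m)"
    unfolding Re by (subst integral_Re[OF trig_polynomial_integral(1)]) (simp add: trig_polynomial_integral(2))
  ultimately show "(\<integral>\<^sup>+\<xi>. ennreal (F \<xi>) \<partial>angle_measure) = ennreal (2 * pi * Re (\<Sum>m<N. c m m))"
    using nonneg by (subst nn_integral_eq_integral) auto
qed

text \<open>The density is cut at height \<open>H\<close>: below it, the integral against \<nu>
  takes over; above it lies a set of \<mu>-measure less than \<epsilon>, on which the bound
  \<open>K\<close> is used. The point is that \<open>H\<close> is chosen before \<open>G\<close> and
  \<open>K\<close>.\<close>

lemma absolutely_continuous_nn_integral_le: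
  fixes \<epsilon> :: real
  assumes \<mu>: "finite_measure \<mu>" and \<nu>: "sigma_finite_measure \<nu>" and sets: "sets \<mu> = sets \<nu>"
    and ac: "absolutely_continuous \<nu> \<mu>" and \<epsilon>: "0 < \<epsilon>"
  shows "\<exists>H::nat. \<forall>G\<in>borel_measurable \<nu>. \<forall>K. (AE x in \<mu>. G x \<le> K) \<longrightarrow>
    (\<integral>\<^sup>+x. G x \<partial>\<mu>) \<le> of_nat H * (\<integral>\<^sup>+x. G x \<partial>\<nu>) + K * ennreal \<epsilon>"
proof -
  interpret \<mu>: finite_measure \<mu> by fact
  interpret \<nu>: sigma_finite_measure \<nu> by fact
  define h where "h = RN_deriv \<nu> \<mu>"
  have h[measurable]: "h \<in> borel_measurable \<nu>" by (simp add: h_def)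
  have dens: "density \<nu> h = \<mu>" unfolding h_def by (rule \<nu>.density_RN_deriv[OF ac sets])
  \<comment> \<open>These sets decrease to the set of infinite density, which is null; finiteness of
    \<mu> gives continuity from above.\<close>
  define A where "A n = {x \<in> space \<nu>. of_nat n < h x}" for n :: nat
  have A[measurable]: "A n \<in> sets \<nu>" for n unfolding A_def by measurable
  have "(\<lambda>n. emeasure \<mu> (A n)) \<longlonglongrightarrow> emeasure \<mu> (\<Inter>n. A n)"
  proof (rule Lim_emeasure_decseq)
    show "decseq A"
      unfolding decseq_def A_def by (blast intro: order_le_less_trans[OF of_nat_mono])
  qed (auto simp: sets)
  moreover have "emeasure \<mu> (\<Inter>n. A n) = 0"
  proof -
    have h_fin: "AE x in \<nu>. h x \<noteq> \<infinity>"
      unfolding h_def by (rule \<nu>.RN_deriv_finite[OF \<mu>.sigma_finite_measure_axioms ac sets])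
    have h_inf: "h x = \<infinity>" if "x \<in> (\<Inter>n. A n)" for x
    proof (rule ccontr)
      assume "h x \<noteq> \<infinity>"
      then obtain n where "h x < of_nat n"
        using ennreal_Ex_less_of_nat[of "h x"] by (auto simp: less_top)
      moreover have "of_nat n < h x" using that by (simp add: A_def)
      ultimately show False by simp
    qed
    from h_fin have "AE x in \<nu>. x \<notin> (\<Inter>n. A n)"
      by eventually_elim (use h_inf in blast)
    then have "(\<Inter>n. A n) \<in> null_sets \<nu>"
      by (subst AE_iff_null_sets) auto
    then show ?thesis using ac by (auto simp: absolutely_continuous_def)
  qed
  ultimately have "\<forall>\<^sub>F n in sequentially. emeasure \<mu> (A n) < ennreal \<epsilon>"
    using \<epsilon> by (intro order_tendstoD(2)) auto
  then obtain H where H: "emeasure \<mu> (A H) < ennreal \<epsilon>"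
    using eventually_happens by fastforce
  have "(\<integral>\<^sup>+x. G x \<partial>\<mu>) \<le> of_nat H * (\<integral>\<^sup>+x. G x \<partial>\<nu>) + K * ennreal \<epsilon>"
    if G[measurable]: "G \<in> borel_measurable \<nu>" and K: "AE x in \<mu>. G x \<le> K" for G K
  proof -
    have G'[measurable]: "G \<in> borel_measurable \<mu>" using G sets by (simp cong: measurable_cong_sets)
    have A'[measurable]: "A H \<in> sets \<mu>" using A sets by simp
    have "(\<integral>\<^sup>+x. G x \<partial>\<mu>) = (\<integral>\<^sup>+x. G x * indicator (- A H) x + G x * indicator (A H) x \<partial>\<mu>)"
      by (intro nn_integral_cong) (auto split: split_indicator)
    also have "\<dots> = (\<integral>\<^sup>+x. G x * indicator (- A H) x \<partial>\<mu>) + (\<integral>\<^sup>+x. G x * indicator (A H) x \<partial>\<mu>)"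
      by (rule nn_integral_add) measurable
    also have "\<dots> \<le> of_nat H * (\<integral>\<^sup>+x. G x \<partial>\<nu>) + K * ennreal \<epsilon>"
    proof (rule add_mono)
      have "(\<integral>\<^sup>+x. G x * indicator (- A H) x \<partial>\<mu>) = (\<integral>\<^sup>+x. h x * (G x * indicator (- A H) x) \<partial>\<nu>)"
        unfolding dens[symmetric] by (rule nn_integral_density) measurable
      also have "\<dots> \<le> (\<integral>\<^sup>+x. of_nat H * G x \<partial>\<nu>)"
        by (intro nn_integral_mono) (auto simp: A_def not_less split: split_indicator intro!: mult_right_mono)
      also have "\<dots> = of_nat H * (\<integral>\<^sup>+x. G x \<partial>\<nu>)" by (rule nn_integral_cmult) measurable
      finally show "(\<integral>\<^sup>+x. G x * indicator (- A H) x \<partial>\<mu>) \<le> of_nat H * (\<integral>\<^sup>+x. G x \<partial>\<nu>)" .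
      have "(\<integral>\<^sup>+x. G x * indicator (A H) x \<partial>\<mu>) \<le> (\<integral>\<^sup>+x. K * indicator (A H) x \<partial>\<mu>)"
        using K by (intro nn_integral_mono_AE) (auto intro!: mult_right_mono)
      also have "\<dots> = K * emeasure \<mu> (A H)" by (rule nn_integral_cmult_indicator) measurable
      also have "\<dots> \<le> K * ennreal \<epsilon>" using H by (intro mult_left_mono) auto
      finally show "(\<integral>\<^sup>+x. G x * indicator (A H) x \<partial>\<mu>) \<le> K * ennreal \<epsilon>" .
    qed
    finally show ?thesis .
  qed
  then show ?thesis by blast
qed

text \<open>In the spectral representation, \<open>wave N \<xi>\<close> is multiplication by this
  function of \<zeta>. On the circle its squared modulus divided by \<open>N\<close> is the Fejer
  kernel centred at \<open>cis \<xi>\<close>.\<close>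

definition dirichlet_kernel :: "nat \<Rightarrow> real \<Rightarrow> complex \<Rightarrow> complex" where
  "dirichlet_kernel N \<xi> \<zeta> = (\<Sum>n<N. cis (- (real n * \<xi>)) * \<zeta> ^ n)"

lemma dirichlet_kernel_square:
  "of_real ((cmod (dirichlet_kernel N \<xi> \<zeta>))\<^sup>2) =
    (\<Sum>m<N. \<Sum>n<N. cis ((real m - real n) * \<xi>) * (cnj \<zeta> ^ m * \<zeta> ^ n))"
proof -
  have "of_real ((cmod (dirichlet_kernel N \<xi> \<zeta>))\<^sup>2) = cnj (dirichlet_kernel N \<xi> \<zeta>) * dirichlet_kernel N \<xi> \<zeta>"
    by (simp only: complex_norm_square mult.commute)
  also have "\<dots> = (\<Sum>m<N. \<Sum>n<N. (cis (real m * \<xi>) * cnj \<zeta> ^ m) * (cis (- (real n * \<xi>)) * \<zeta> ^ n))"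
    unfolding dirichlet_kernel_def cnj_sum sum_product by (simp add: cis_cnj)
  also have "\<dots> = (\<Sum>m<N. \<Sum>n<N. (cis (real m * \<xi>) * cis (- (real n * \<xi>))) * (cnj \<zeta> ^ m * \<zeta> ^ n))"
    by (simp only: mult_ac)
  finally show ?thesis by (simp add: cis_mult left_diff_distrib)
qed

lemma dirichlet_kernel_nn_integral:
  assumes "cmod \<zeta> = 1"
  shows "(\<integral>\<^sup>+\<xi>. ennreal ((cmod (dirichlet_kernel N \<xi> \<zeta>))\<^sup>2) \<partial>angle_measure) = ennreal (2 * pi * N)"
proof -
  have "cnj \<zeta> ^ m * \<zeta> ^ m = 1" for m
    using assms by (simp add: mult.commute[of "cnj _"] flip: power_mult_distrib complex_norm_square)
  then show ?thesis
    using trig_polynomial_nn_integral(2)[OF dirichlet_kernel_square[of N _ \<zeta>]] by simp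
qed

text \<open>The modulus depends on the two angles symmetrically, so integration over either of them
  gives the same value.\<close>

lemma dirichlet_kernel_cis_swap:
  "cmod (dirichlet_kernel N \<xi> (cis \<eta>)) = cmod (dirichlet_kernel N \<eta> (cis \<xi>))"
proof -
  have "dirichlet_kernel N \<xi> (cis \<eta>) = cnj (dirichlet_kernel N \<eta> (cis \<xi>))"
    unfolding dirichlet_kernel_def cnj_sum
    by (intro sum.cong refl) (simp add: Complex.DeMoivre cis_cnj mult.commute)
  then show ?thesis by simp
qed

lemma dirichlet_kernel_measurable:
  "(\<lambda>p. (cmod (dirichlet_kernel N (fst p) (snd p)))\<^sup>2) \<in> borel_measurable (borel \<Otimes>\<^sub>M borel)"
proof -
  have "continuous_on UNIV (\<lambda>p. (cmod (dirichlet_kernel N (fst p) (snd p)))\<^sup>2)"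
    unfolding dirichlet_kernel_def by (intro continuous_intros)
  then show ?thesis unfolding borel_prod by (rule borel_measurable_continuous_onI)
qed

context band_unitary
begin

text \<open>The definition supplies only the moments of nonnegative powers. Almost everywhere on the
  circle, conjugates cancel against powers, and unitarity shifts the inner product accordingly; the
  case \<open>m > n\<close> follows by conjugation.\<close>

lemma spectral_measure_moment:
  assumes f: "f \<in> ell2" and \<mu>: "is_spectral_measure U f \<mu>"
  shows "integrable \<mu> (\<lambda>\<zeta>. cnj \<zeta> ^ m * \<zeta> ^ n)"
    and "(LINT \<zeta>|\<mu>. cnj \<zeta> ^ m * \<zeta> ^ n) = ell2_inner ((U ^^ m) f) ((U ^^ n) f)"
proof -
  interpret finite_measure \<mu> using \<mu> by (simp add: is_spectral_measure_def)
  have sets: "sets \<mu> = sets borel" and null: "emeasure \<mu> (- sphere 0 1) = 0"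
    and mom: "(LINT z|\<mu>. z ^ n) = ell2_inner f ((U ^^ n) f)" for n
    using \<mu> by (auto simp: is_spectral_measure_def)
  have circ: "AE \<zeta> in \<mu>. cmod \<zeta> = 1"
  proof (rule AE_I')
    show "- sphere 0 1 \<in> null_sets \<mu>" using null by (auto simp: null_sets_def sets)
  qed auto
  have meas: "(\<lambda>\<zeta>. cnj \<zeta> ^ m * \<zeta> ^ n) \<in> borel_measurable \<mu>" for m n
    unfolding measurable_cong_sets[OF sets refl]
    by (intro borel_measurable_continuous_onI continuous_intros)
  have int: "integrable \<mu> (\<lambda>\<zeta>. cnj \<zeta> ^ m * \<zeta> ^ n)" for m n
    using circ by (intro integrable_const_bound[of _ 1] meas) (auto simp: norm_mult norm_power elim!: eventually_mono)
  then show "integrable \<mu> (\<lambda>\<zeta>. cnj \<zeta> ^ m * \<zeta> ^ n)" .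
  have le: "(LINT \<zeta>|\<mu>. cnj \<zeta> ^ m * \<zeta> ^ n) = ell2_inner ((U ^^ m) f) ((U ^^ n) f)" if "m \<le> n" for m n
  proof -
    have n: "n = m + (n - m)" using that by simp
    have "(LINT \<zeta>|\<mu>. cnj \<zeta> ^ m * \<zeta> ^ n) = (LINT \<zeta>|\<mu>. \<zeta> ^ (n - m))"
    proof (rule integral_cong_AE)
      show "AE \<zeta> in \<mu>. cnj \<zeta> ^ m * \<zeta> ^ n = \<zeta> ^ (n - m)"
        using circ
      proof eventually_elim
        case (elim \<zeta>)
        have "cnj \<zeta> ^ m * \<zeta> ^ n = (\<zeta> * cnj \<zeta>) ^ m * \<zeta> ^ (n - m)"
          by (subst n) (simp add: power_add power_mult_distrib mult_ac)
        also have "\<zeta> * cnj \<zeta> = 1" using elim by (simp flip: complex_norm_square)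
        finally show ?case by simp
      qed
      show "(\<lambda>\<zeta>. \<zeta> ^ (n - m)) \<in> borel_measurable \<mu>" using meas[of 0 "n - m"] by simp
    qed (rule meas)
    also have "\<dots> = ell2_inner f ((U ^^ (n - m)) f)" by (rule mom)
    also have "\<dots> = ell2_inner ((U ^^ m) f) ((U ^^ m) ((U ^^ (n - m)) f))"
      using f by (simp add: U_pow_inner U_pow_ell2)
    also have "(U ^^ m) ((U ^^ (n - m)) f) = (U ^^ n) f"
      using funpow_add[of m "n - m" U] that by simp
    finally show ?thesis .
  qed
  show "(LINT \<zeta>|\<mu>. cnj \<zeta> ^ m * \<zeta> ^ n) = ell2_inner ((U ^^ m) f) ((U ^^ n) f)"
  proof (cases "m \<le> n")
    case True
    then show ?thesis by (rule le)
  next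
    case False
    have "(LINT \<zeta>|\<mu>. cnj \<zeta> ^ m * \<zeta> ^ n) = (LINT \<zeta>|\<mu>. cnj (cnj \<zeta> ^ n * \<zeta> ^ m))"
      by (simp add: mult.commute)
    also have "\<dots> = cnj (LINT \<zeta>|\<mu>. cnj \<zeta> ^ n * \<zeta> ^ m)"
      by (rule Bochner_Integration.integral_cnj)
    also have "\<dots> = cnj (ell2_inner ((U ^^ n) f) ((U ^^ m) f))"
      using le[of n m] False by simp
    finally show ?thesis by (simp add: ell2_inner_cnj)
  qed
qed

text \<open>Both sides expand into the same double sum of mixed moments. Thus the squared norm is,
  up to \<open>N\<close>, the Fejer mean of the spectral measure.\<close>

lemma ell2_sq_wave_spectral:
  assumes f: "f \<in> ell2" and \<mu>: "is_spectral_measure U f \<mu>"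
  shows "ennreal (ell2_sq (wave N \<xi> f)) = (\<integral>\<^sup>+\<zeta>. ennreal ((cmod (dirichlet_kernel N \<xi> \<zeta>))\<^sup>2) \<partial>\<mu>)"
proof -
  let ?S = "\<lambda>\<zeta>. \<Sum>m<N. \<Sum>n<N. cis ((real m - real n) * \<xi>) * (cnj \<zeta> ^ m * \<zeta> ^ n)"
  have int: "integrable \<mu> ?S"
    using spectral_measure_moment(1)[OF f \<mu>]
    by (intro Bochner_Integration.integrable_sum integrable_mult_right)
  have Re: "(\<lambda>\<zeta>. (cmod (dirichlet_kernel N \<xi> \<zeta>))\<^sup>2) = (\<lambda>\<zeta>. Re (?S \<zeta>))"
    unfolding dirichlet_kernel_square[symmetric] by simp
  have "of_real (ell2_sq (wave N \<xi> f)) = (LINT \<zeta>|\<mu>. ?S \<zeta>)"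
    unfolding ell2_sq_wave[OF f] spectral_measure_moment(2)[OF f \<mu>, symmetric]
    using spectral_measure_moment(1)[OF f \<mu>]
    by (simp add: Bochner_Integration.integral_sum Bochner_Integration.integrable_sum)
  then have "ell2_sq (wave N \<xi> f) = (LINT \<zeta>|\<mu>. (cmod (dirichlet_kernel N \<xi> \<zeta>))\<^sup>2)"
    unfolding Re integral_Re[OF int] by (metis Re_complex_of_real)
  moreover have "integrable \<mu> (\<lambda>\<zeta>. (cmod (dirichlet_kernel N \<xi> \<zeta>))\<^sup>2)"
    unfolding Re using int by (rule integrable_Re)
  ultimately show ?thesis by (simp add: nn_integral_eq_integral)
qed

lemma ell2_sq_wave_measurable:
  assumes "f \<in> ell2"
  shows "(\<lambda>\<xi>. ell2_sq (wave N \<xi> f)) \<in> borel_measurable borel"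
  by (rule trig_polynomial_nn_integral(1)[OF ell2_sq_wave[OF assms] ell2_sq_nonneg])

lemma ell2_sq_wave_nn_integral:
  assumes "f \<in> ell2"
  shows "(\<integral>\<^sup>+\<xi>. ennreal (ell2_sq (wave N \<xi> f)) \<partial>angle_measure) = ennreal (2 * pi * N * ell2_sq f)"
  using trig_polynomial_nn_integral(2)[OF ell2_sq_wave[OF assms] ell2_sq_nonneg]
  by (simp add: U_pow_inner assms ell2_inner_self mult.assoc)

text \<open>The only place where absolute continuity of the spectral measure enters.\<close>

lemma wave_uniformly_integrable:
  fixes \<epsilon> :: real
  assumes f: "f \<in> ell2" and \<mu>: "is_spectral_measure U f \<mu>"
    and ac: "absolutely_continuous circle_lebesgue \<mu>" and \<epsilon>: "0 < \<epsilon>"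
  shows "\<exists>H::nat. \<forall>N>0. \<forall>A\<in>sets angle_measure.
    (\<integral>\<^sup>+\<xi>\<in>A. ennreal (ell2_sq (wave N \<xi> f) / N) \<partial>angle_measure)
      \<le> ennreal (2 * pi) * (of_nat H * emeasure angle_measure A + ennreal \<epsilon>)"
proof -
  interpret L: finite_measure angle_measure by (rule finite_measure_angle_measure)
  interpret \<mu>: finite_measure \<mu> using \<mu> by (simp add: is_spectral_measure_def)
  have cis[measurable]: "cis \<in> angle_measure \<rightarrow>\<^sub>M borel"
    using cis_measurable[of 1 0] by (intro measurable_angle_measure) simp
  interpret C: finite_measure circle_lebesgue
    unfolding circle_lebesgue_alt by (rule L.finite_measure_distr) simp
  have sets: "sets \<mu> = sets borel" and null: "emeasure \<mu> (- sphere 0 1) = 0"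
    using \<mu> by (auto simp: is_spectral_measure_def)
  have circ: "AE \<zeta> in \<mu>. cmod \<zeta> = 1"
  proof (rule AE_I')
    show "- sphere 0 1 \<in> null_sets \<mu>" using null by (auto simp: null_sets_def sets)
  qed auto
  have sets_C: "sets \<mu> = sets circle_lebesgue" by (simp add: sets circle_lebesgue_alt)
  obtain H :: nat where H: "\<And>G K. G \<in> borel_measurable circle_lebesgue \<Longrightarrow> (AE x in \<mu>. G x \<le> K) \<Longrightarrow>
      (\<integral>\<^sup>+x. G x \<partial>\<mu>) \<le> of_nat H * (\<integral>\<^sup>+x. G x \<partial>circle_lebesgue) + K * ennreal \<epsilon>"
    using absolutely_continuous_nn_integral_le[OF \<mu>.finite_measure_axioms C.sigma_finite_measure_axioms sets_C ac \<epsilon>]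
    by blast
  have "(\<integral>\<^sup>+\<xi>\<in>A. ennreal (ell2_sq (wave N \<xi> f) / N) \<partial>angle_measure)
      \<le> ennreal (2 * pi) * (of_nat H * emeasure angle_measure A + ennreal \<epsilon>)"
    if N: "0 < N" and A[measurable]: "A \<in> sets angle_measure" for N A
  proof -
    define F where "F \<xi> \<zeta> = ennreal ((cmod (dirichlet_kernel N \<xi> \<zeta>))\<^sup>2 / N)" for \<xi> \<zeta>
    have id[measurable]: "(\<lambda>x. x) \<in> angle_measure \<rightarrow>\<^sub>M borel" by (rule measurable_angle_measure) simp
    have id\<mu>[measurable]: "(\<lambda>x. x) \<in> \<mu> \<rightarrow>\<^sub>M borel" by (rule measurable_ident_sets[OF sets])
    have F_meas: "(\<lambda>x. F (u x) (v x)) \<in> borel_measurable Q"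
      if [measurable]: "u \<in> borel_measurable Q" "v \<in> borel_measurable Q" for u v and Q :: "'q measure"
    proof -
      have "(\<lambda>x. (u x, v x)) \<in> Q \<rightarrow>\<^sub>M borel \<Otimes>\<^sub>M borel" by measurable
      from measurable_compose[OF this dirichlet_kernel_measurable[of N]]
      have [measurable]: "(\<lambda>x. (cmod (dirichlet_kernel N (u x) (v x)))\<^sup>2) \<in> borel_measurable Q" by simp
      show ?thesis unfolding F_def by measurable
    qed
    have F_int: "(\<integral>\<^sup>+\<xi>. F \<xi> \<zeta> \<partial>angle_measure) = ennreal (2 * pi)" if "cmod \<zeta> = 1" for \<zeta>
    proof -
      have [measurable]: "(\<lambda>\<xi>. (cmod (dirichlet_kernel N \<xi> \<zeta>))\<^sup>2) \<in> borel_measurable angle_measure"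
        using trig_polynomial_nn_integral(1)[OF dirichlet_kernel_square[of N _ \<zeta>]]
        by (intro measurable_angle_measure) simp
      have "(\<integral>\<^sup>+\<xi>. F \<xi> \<zeta> \<partial>angle_measure) =
          (\<integral>\<^sup>+\<xi>. ennreal (1 / N) * ennreal ((cmod (dirichlet_kernel N \<xi> \<zeta>))\<^sup>2) \<partial>angle_measure)"
        by (simp add: F_def ennreal_mult'[symmetric])
      also have "\<dots> = ennreal (1 / N) * ennreal (2 * pi * N)"
        by (subst nn_integral_cmult) (simp_all add: dirichlet_kernel_nn_integral[OF that])
      also have "\<dots> = ennreal (2 * pi)" using N by (simp add: ennreal_mult'[symmetric])
      finally show ?thesis .
    qed
    \<comment> \<open>After exchanging the integrals, the set \<open>A\<close> of angles becomes a
      test function on the circle: bounded by \<open>2 * pi\<close>, and with Lebesgue integral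
      \<open>2 * pi\<close> times the measure of \<open>A\<close>.\<close>
    define G where "G \<zeta> = (\<integral>\<^sup>+\<xi>. F \<xi> \<zeta> * indicator A \<xi> \<partial>angle_measure)" for \<zeta>
    interpret P: pair_sigma_finite angle_measure \<mu> ..
    interpret PL: pair_sigma_finite angle_measure angle_measure ..
    have "(\<integral>\<^sup>+\<xi>\<in>A. ennreal (ell2_sq (wave N \<xi> f) / N) \<partial>angle_measure) =
        (\<integral>\<^sup>+\<xi>. (\<integral>\<^sup>+\<zeta>. F \<xi> \<zeta> * indicator A \<xi> \<partial>\<mu>) \<partial>angle_measure)"
    proof (intro nn_integral_cong)
      fix \<xi>
      have [measurable]: "(\<lambda>\<zeta>. (cmod (dirichlet_kernel N \<xi> \<zeta>))\<^sup>2) \<in> borel_measurable \<mu>"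
        unfolding measurable_cong_sets[OF sets refl] dirichlet_kernel_def
        by (intro borel_measurable_continuous_onI continuous_intros)
      have "ennreal (ell2_sq (wave N \<xi> f) / N) = ennreal (1 / N) * ennreal (ell2_sq (wave N \<xi> f))"
        by (simp add: ennreal_mult'[symmetric])
      also have "\<dots> = (\<integral>\<^sup>+\<zeta>. ennreal (1 / N) * ennreal ((cmod (dirichlet_kernel N \<xi> \<zeta>))\<^sup>2) \<partial>\<mu>)"
        unfolding ell2_sq_wave_spectral[OF f \<mu>] by (subst nn_integral_cmult) simp_all
      also have "\<dots> = (\<integral>\<^sup>+\<zeta>. F \<xi> \<zeta> \<partial>\<mu>)"
        by (simp add: F_def ennreal_mult'[symmetric])
      finally show "ennreal (ell2_sq (wave N \<xi> f) / N) * indicator A \<xi> = (\<integral>\<^sup>+\<zeta>. F \<xi> \<zeta> * indicator A \<xi> \<partial>\<mu>)"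
        by (simp split: split_indicator)
    qed
    also have "\<dots> = (\<integral>\<^sup>+\<zeta>. G \<zeta> \<partial>\<mu>)"
      unfolding G_def
      by (intro P.Fubini'[symmetric])
        (auto simp: split_beta' intro!: borel_measurable_times_ennreal F_meas
          measurable_compose[OF measurable_fst id] measurable_compose[OF measurable_snd id\<mu>]
          borel_measurable_indicator' measurable_fst)
    also have "\<dots> \<le> of_nat H * (\<integral>\<^sup>+\<zeta>. G \<zeta> \<partial>circle_lebesgue) + ennreal (2 * pi) * ennreal \<epsilon>"
    proof (rule H)
      show G[measurable]: "G \<in> borel_measurable circle_lebesgue"
        unfolding G_def circle_lebesgue_alt measurable_distr_eq1
        by (intro L.borel_measurable_nn_integral)
          (auto simp: split_beta' intro!: borel_measurable_times_ennreal F_meas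
            measurable_compose[OF measurable_snd id] measurable_fst
            borel_measurable_indicator' measurable_snd)
      show "AE \<zeta> in \<mu>. G \<zeta> \<le> ennreal (2 * pi)"
        using circ
      proof eventually_elim
        case (elim \<zeta>)
        have "G \<zeta> \<le> (\<integral>\<^sup>+\<xi>. F \<xi> \<zeta> \<partial>angle_measure)"
          unfolding G_def by (intro nn_integral_mono) (auto split: split_indicator)
        then show ?case by (simp add: F_int[OF elim])
      qed
    qed
    also have "(\<integral>\<^sup>+\<zeta>. G \<zeta> \<partial>circle_lebesgue) = ennreal (2 * pi) * emeasure angle_measure A"
    proof -
      have G: "G \<in> borel_measurable borel"
        unfolding G_def
        by (intro L.borel_measurable_nn_integral)
          (auto simp: split_beta' intro!: borel_measurable_times_ennreal F_meas
            measurable_compose[OF measurable_snd id] measurable_fst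
            borel_measurable_indicator' measurable_snd)
      have "(\<integral>\<^sup>+\<zeta>. G \<zeta> \<partial>circle_lebesgue) = (\<integral>\<^sup>+\<eta>. G (cis \<eta>) \<partial>angle_measure)"
        unfolding circle_lebesgue_alt using cis G by (subst nn_integral_distr) simp_all
      also have "\<dots> = (\<integral>\<^sup>+\<xi>. (\<integral>\<^sup>+\<eta>. F \<xi> (cis \<eta>) * indicator A \<xi> \<partial>angle_measure) \<partial>angle_measure)"
        unfolding G_def
        by (intro PL.Fubini')
          (auto simp: split_beta' intro!: borel_measurable_times_ennreal F_meas
            measurable_compose[OF measurable_fst id] measurable_compose[OF measurable_snd cis]
            borel_measurable_indicator' measurable_fst)
      also have "\<dots> = (\<integral>\<^sup>+\<xi>. ennreal (2 * pi) * indicator A \<xi> \<partial>angle_measure)"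
      proof (intro nn_integral_cong)
        fix \<xi>
        have "F \<xi> (cis \<eta>) = F \<eta> (cis \<xi>)" for \<eta>
          by (simp add: F_def dirichlet_kernel_cis_swap[of N \<xi>])
        then show "(\<integral>\<^sup>+\<eta>. F \<xi> (cis \<eta>) * indicator A \<xi> \<partial>angle_measure) = ennreal (2 * pi) * indicator A \<xi>"
          using F_int[of "cis \<xi>"] by (simp split: split_indicator)
      qed
      also have "\<dots> = ennreal (2 * pi) * emeasure angle_measure A"
        by (rule nn_integral_cmult_indicator) measurable
      finally show ?thesis .
    qed
    finally show ?thesis by (simp add: distrib_left mult.left_commute)
  qed
  then show ?thesis by blast
qed

end

section \<open>Absence of absolutely continuous spectrum\<close>

lemma summable_inverse_Suc_square: "summable (\<lambda>n. 1 / (real n + 1)\<^sup>2)"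
proof -
  have "summable (\<lambda>n. inverse (real (Suc n) ^ 2))"
    using inverse_power_summable[of 2, where ?'a = real] summable_Suc_iff[of "\<lambda>n. inverse (real n ^ 2)"] by simp
  then show ?thesis by (simp add: inverse_eq_divide add.commute)
qed

context band_unitary
begin

text \<open>Compactness by contradiction. The bound is available only for those \<open>j\<close>
  that satisfy \<open>E\<close>; along an infinite set of these on which the coordinate stays above
  \<open>e\<close>, a subsequence would converge to a bounded solution that is nonzero at
  \<open>k\<close>. Setting the other terms to 0 prepares for dominated convergence.\<close>

lemma U_limit_point_vanishes:
  assumes bound: "\<And>j k. E j \<Longrightarrow> cmod (S j k) \<le> C * (1 + (real_of_int k)\<^sup>2)"
    and res: "\<And>k. (\<lambda>j. U (S j) k - z * S j k) \<longlonglongrightarrow> 0"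
    and none: "\<And>\<psi>. (\<And>k. U \<psi> k = z * \<psi> k) \<Longrightarrow>
       (\<And>k. cmod (\<psi> k) \<le> C * (1 + (real_of_int k)\<^sup>2)) \<Longrightarrow> (\<And>k. \<psi> k = 0)"
  shows "(\<lambda>j. if E j then cmod (S j k) else 0) \<longlonglongrightarrow> 0"
proof (rule ccontr)
  assume "\<not> ?thesis"
  then obtain e where e: "0 < e" and "\<forall>m. \<exists>j\<ge>m. e \<le> \<bar>if E j then cmod (S j k) else 0\<bar>"
    unfolding LIMSEQ_iff by (auto simp: not_less)
  then have "\<exists>j\<ge>m. E j \<and> e \<le> cmod (S j k)" for m
    by (metis abs_norm_cancel abs_zero not_le)
  then have inf: "infinite {j. E j \<and> e \<le> cmod (S j k)}"
    unfolding infinite_nat_iff_unbounded_le by blast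
  obtain \<sigma> :: "nat \<Rightarrow> nat" where \<sigma>: "strict_mono \<sigma>" "\<And>l. E (\<sigma> l) \<and> e \<le> cmod (S (\<sigma> l) k)"
    using infinite_enumerate[OF inf] by auto
  \<comment> \<open>Division by the weight turns the polynomial bound into a uniform one, so that a
    subsequence converging at every integer exists.\<close>
  define w where "w i = 1 + (real_of_int i)\<^sup>2" for i
  have w: "w i > 0" for i unfolding w_def by (simp add: add_pos_nonneg)
  have bd: "norm (S (\<sigma> l) i / of_real (w i)) \<le> C" for l i
    using bound[of "\<sigma> l" i] \<sigma>(2) w[of i] by (simp add: norm_divide pos_divide_le_eq flip: w_def)
  obtain \<tau> where \<tau>: "strict_mono (\<tau> :: nat \<Rightarrow> nat)"
    and lim: "\<And>i. \<exists>L. (\<lambda>l. S (\<sigma> (\<tau> l)) i / of_real (w i)) \<longlonglongrightarrow> L"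
    by (rule function_convergent_subsequence[of "UNIV :: int set" "\<lambda>l i. S (\<sigma> l) i / of_real (w i)" C])
      (use bd in auto)
  from lim obtain L where L: "\<And>i. (\<lambda>l. S (\<sigma> (\<tau> l)) i / of_real (w i)) \<longlonglongrightarrow> L i" by metis
  define \<psi> where "\<psi> i = L i * of_real (w i)" for i
  have \<psi>: "(\<lambda>l. S (\<sigma> (\<tau> l)) i) \<longlonglongrightarrow> \<psi> i" for i
    using tendsto_mult_right[OF L[of i], of "of_real (w i)"] w[of i] by (simp add: \<psi>_def)
  have sub: "strict_mono (\<lambda>l. \<sigma> (\<tau> l))" using \<sigma>(1) \<tau> by (simp add: strict_mono_def)
  have "U \<psi> i = z * \<psi> i" for i
  proof -
    have "(\<lambda>l. U (S (\<sigma> (\<tau> l))) i - z * S (\<sigma> (\<tau> l)) i) \<longlonglongrightarrow> U \<psi> i - z * \<psi> i"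
      by (intro tendsto_diff tendsto_mult_left U_tendsto \<psi>)
    moreover have "(\<lambda>l. U (S (\<sigma> (\<tau> l))) i - z * S (\<sigma> (\<tau> l)) i) \<longlonglongrightarrow> 0"
      using LIMSEQ_subseq_LIMSEQ[OF res[of i] sub] by (simp add: o_def)
    ultimately have "U \<psi> i - z * \<psi> i = 0" by (rule LIMSEQ_unique)
    then show ?thesis by simp
  qed
  moreover have "cmod (\<psi> i) \<le> C * (1 + (real_of_int i)\<^sup>2)" for i
    by (rule LIMSEQ_le_const2[OF tendsto_norm[OF \<psi>]]) (use bound \<sigma>(2) in blast)
  ultimately have "\<psi> k = 0" by (rule none)
  moreover have "e \<le> cmod (\<psi> k)"
    by (rule LIMSEQ_le_const[OF tendsto_norm[OF \<psi>]]) (use \<sigma>(2) in blast)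
  ultimately show False using e by simp
qed

lemma fejer_measurable: "(\<lambda>\<xi>. fejer N f \<xi> k) \<in> borel_measurable borel"
  unfolding fejer_expand by (intro borel_measurable_continuous_onI continuous_intros)

text \<open>On the diagonal the powers of \<open>V\<close> and \<open>U\<close> cancel, leaving
  \<open>N\<close> copies of \<open>f k / N\<close>. This lets \<open>f\<close> be recovered from
  its approximate solutions.\<close>

lemma fejer_integral:
  assumes "0 < N"
  shows "integrable angle_measure (\<lambda>\<xi>. fejer N f \<xi> k)"
    and "(LINT \<xi>|angle_measure. fejer N f \<xi> k) = of_real (2 * pi) * f k"
proof -
  show "integrable angle_measure (\<lambda>\<xi>. fejer N f \<xi> k)"
    unfolding fejer_expand by (rule trig_polynomial_integral(1))
  have "(LINT \<xi>|angle_measure. fejer N f \<xi> k) =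
      of_real (2 * pi) * (\<Sum>m<N. inverse (of_nat N) * (V ^^ m) ((U ^^ m) f) k)"
    unfolding fejer_expand by (rule trig_polynomial_integral(2))
  also have "(\<Sum>m<N. inverse (of_nat N) * (V ^^ m) ((U ^^ m) f) k) = f k"
    using assms by (simp add: V_pow_U_pow)
  finally show "(LINT \<xi>|angle_measure. fejer N f \<xi> k) = of_real (2 * pi) * f k" .
qed

lemma ac_vector_vanishes:
  assumes f: "f \<in> ell2" and \<mu>: "is_spectral_measure U f \<mu>"
    and ac: "absolutely_continuous circle_lebesgue \<mu>"
    and none: "AE \<xi> in angle_measure. \<forall>\<psi> C. (\<forall>k. U \<psi> k = cis \<xi> * \<psi> k) \<longrightarrow>
      (\<forall>k. cmod (\<psi> k) \<le> C * (1 + (real_of_int k)\<^sup>2)) \<longrightarrow> (\<forall>k. \<psi> k = 0)"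
  shows "f k = 0"
proof -
  interpret L: finite_measure angle_measure by (rule finite_measure_angle_measure)
  \<comment> \<open>A fourth power, to be used with weight \<open>s = 1 / (j + 1)^2\<close>: the
    residual bound becomes a summable weight times \<open>a\<close>, plus
    \<open>4 |f|^2 (j + 1)^2 / N\<close>, and both tend to 0.\<close>
  define N where "N j = (j + 1) ^ 4" for j :: nat
  have N: "0 < N j" for j by (simp add: N_def)
  define S where "S j \<xi> = fejer (N j) f \<xi>" for j \<xi>
  define a where "a j k \<xi> = ell2_sq (wave (N j) \<xi> (basis_vec k)) / N j" for j k \<xi>
  define b where "b j \<xi> = ell2_sq (wave (N j) \<xi> f) / N j" for j \<xi>
  have nonneg: "0 \<le> a j k \<xi>" "0 \<le> b j \<xi>" for j k \<xi>
    by (simp_all add: a_def b_def ell2_sq_nonneg)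
  have S_le: "cmod (S j \<xi> k) \<le> s * a j k \<xi> + b j \<xi> / s" if "0 < s" for s j \<xi> k
    unfolding S_def a_def b_def by (rule cmod_fejer_le[OF f that])
  have [measurable]: "(\<lambda>\<xi>. S j \<xi> k) \<in> borel_measurable angle_measure" for j k
    unfolding S_def by (intro measurable_angle_measure fejer_measurable)
  have [measurable]: "(\<lambda>\<xi>. ell2_sq (wave n \<xi> g)) \<in> borel_measurable angle_measure" if "g \<in> ell2" for g n
    using that by (intro measurable_angle_measure ell2_sq_wave_measurable)
  have a_meas[measurable]: "a j k \<in> borel_measurable angle_measure" for j k
    unfolding a_def[abs_def] using basis_vec_ell2 by measurable
  have b_meas[measurable]: "b j \<in> borel_measurable angle_measure" for j
    unfolding b_def[abs_def] using f by measurable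
  have wave_int: "(\<integral>\<^sup>+\<xi>. ennreal (ell2_sq (wave (N j) \<xi> g) / N j) \<partial>angle_measure) = ennreal (2 * pi * ell2_sq g)"
    if g: "g \<in> ell2" for g j
  proof -
    have "(\<integral>\<^sup>+\<xi>. ennreal (ell2_sq (wave (N j) \<xi> g) / N j) \<partial>angle_measure) =
      (\<integral>\<^sup>+\<xi>. ennreal (1 / N j) * ennreal (ell2_sq (wave (N j) \<xi> g)) \<partial>angle_measure)"
      by (simp add: ennreal_mult'[symmetric])
    also have "\<dots> = ennreal (1 / N j) * ennreal (2 * pi * N j * ell2_sq g)"
      using g by (subst nn_integral_cmult) (simp_all add: ell2_sq_wave_nn_integral)
    finally show ?thesis using N[of j] by (simp add: ennreal_mult'[symmetric] mult.assoc)
  qed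
  have a_int: "(\<integral>\<^sup>+\<xi>. ennreal (a j k \<xi>) \<partial>angle_measure) = ennreal (2 * pi)" for j k
    unfolding a_def using wave_int[OF basis_vec_ell2[of k], of j] by (simp add: ell2_sq_basis_vec)
  have b_int: "(\<integral>\<^sup>+\<xi>. ennreal (b j \<xi>) \<partial>angle_measure) = ennreal (2 * pi * ell2_sq f)" for j
    unfolding b_def by (rule wave_int[OF f])

  have "AE \<xi> in angle_measure. (\<lambda>j. a j k \<xi> / (real j + 1)\<^sup>2) \<longlonglongrightarrow> 0" for k
  proof -
    \<comment> \<open>The integrals of \<open>a j k\<close> are all \<open>2 * pi\<close>, so the
      summable weight gives convergence for almost every angle along the whole sequence.\<close>
    have sum_fin: "(\<integral>\<^sup>+\<xi>. (\<Sum>j. ennreal (a j k \<xi> / (real j + 1)\<^sup>2)) \<partial>angle_measure) \<noteq> \<infinity>"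
    proof -
      have "(\<integral>\<^sup>+\<xi>. (\<Sum>j. ennreal (a j k \<xi> / (real j + 1)\<^sup>2)) \<partial>angle_measure)
        = (\<Sum>j. \<integral>\<^sup>+\<xi>. ennreal (1 / (real j + 1)\<^sup>2) * ennreal (a j k \<xi>) \<partial>angle_measure)"
        by (subst nn_integral_suminf) (simp_all add: ennreal_mult'[symmetric])
      also have "\<dots> = (\<Sum>j. ennreal (1 / (real j + 1)\<^sup>2 * (2 * pi)))"
        by (subst nn_integral_cmult) (simp_all add: a_int ennreal_mult'[symmetric])
      also have "\<dots> = ennreal (\<Sum>j. 1 / (real j + 1)\<^sup>2 * (2 * pi))"
        by (intro suminf_ennreal2 summable_mult2 summable_inverse_Suc_square) simp
      finally show ?thesis by simp
    qed
    have "AE \<xi> in angle_measure. (\<Sum>j. ennreal (a j k \<xi> / (real j + 1)\<^sup>2)) \<noteq> \<infinity>"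
      by (rule nn_integral_PInf_AE[OF _ sum_fin]) measurable
    then show ?thesis
    proof eventually_elim
      case (elim \<xi>)
      have "summable (\<lambda>j. a j k \<xi> / (real j + 1)\<^sup>2)"
        using elim by (intro summable_suminf_not_top) (auto simp: nonneg)
      then show ?case by (rule summable_LIMSEQ_zero)
    qed
  qed
  then have AE_a: "AE \<xi> in angle_measure. \<forall>k. (\<lambda>j. a j k \<xi> / (real j + 1)\<^sup>2) \<longlonglongrightarrow> 0"
    by (simp add: AE_all_countable)
  have res: "(\<lambda>j. U (S j \<xi>) k - cis \<xi> * S j \<xi> k) \<longlonglongrightarrow> 0"
    if "(\<lambda>j. a j k \<xi> / (real j + 1)\<^sup>2) \<longlonglongrightarrow> 0" for \<xi> k
  proof (rule Lim_null_comparison)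
    show "\<forall>\<^sub>F j in sequentially. norm (U (S j \<xi>) k - cis \<xi> * S j \<xi> k) \<le>
        a j k \<xi> / (real j + 1)\<^sup>2 + 4 * ell2_sq f / (real j + 1)\<^sup>2"
    proof (rule always_eventually, rule allI)
      fix j
      have "norm (U (S j \<xi>) k - cis \<xi> * S j \<xi> k) \<le>
          1 / (real j + 1)\<^sup>2 * a j k \<xi> + 4 * ell2_sq f / N j / (1 / (real j + 1)\<^sup>2)"
        unfolding S_def a_def by (rule cmod_fejer_residual_le[OF f]) simp
      also have "4 * ell2_sq f / N j / (1 / (real j + 1)\<^sup>2) = 4 * ell2_sq f / (real j + 1)\<^sup>2"
      proof -
        define w where "w = (real j + 1)\<^sup>2"
        have "w \<noteq> 0" "real (N j) = w * w"
          by (simp_all add: w_def N_def add.commute flip: power_add)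
        then show ?thesis unfolding w_def[symmetric] by simp
      qed
      finally show "norm (U (S j \<xi>) k - cis \<xi> * S j \<xi> k) \<le>
        a j k \<xi> / (real j + 1)\<^sup>2 + 4 * ell2_sq f / (real j + 1)\<^sup>2" by simp
    qed
    have "(\<lambda>j. 4 * ell2_sq f / (real j + 1)\<^sup>2) \<longlonglongrightarrow> 0"
      using tendsto_mult_right_zero[OF summable_LIMSEQ_zero[OF summable_inverse_Suc_square], of "4 * ell2_sq f"] by simp
    from tendsto_add[OF that this]
    show "(\<lambda>j. a j k \<xi> / (real j + 1)\<^sup>2 + 4 * ell2_sq f / (real j + 1)\<^sup>2) \<longlonglongrightarrow> 0" by simp
  qed

  \<comment> \<open>A weighted sum of all coordinates, with coordinate 0 counted twice. One bound on
    \<open>B\<close> controls every coordinate at that angle.\<close>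
  define B where "B j \<xi> = (\<Sum>i. ennreal ((cmod (S j \<xi> (int i)) + cmod (S j \<xi> (- int i))) / (real i + 1)\<^sup>2))" for j \<xi>
  have [measurable]: "B j \<in> borel_measurable angle_measure" for j
    unfolding B_def[abs_def] by measurable
  \<comment> \<open>Each index contributes two coordinates, of integral at most
    \<open>2 * pi * (1 + ell2_sq f)\<close> each.\<close>
  define K where "K = (\<Sum>i. 1 / (real i + 1)\<^sup>2 * (4 * pi * (1 + ell2_sq f)))"
  have K: "0 \<le> K" unfolding K_def using ell2_sq_nonneg[of f]
    by (intro suminf_nonneg summable_mult2 summable_inverse_Suc_square) simp
  have B_int: "(\<integral>\<^sup>+\<xi>. B j \<xi> \<partial>angle_measure) \<le> ennreal K" for j
  proof -
    have S_int: "(\<integral>\<^sup>+\<xi>. ennreal (cmod (S j \<xi> k)) \<partial>angle_measure) \<le> ennreal (2 * pi * (1 + ell2_sq f))" for k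
    proof -
      have "(\<integral>\<^sup>+\<xi>. ennreal (cmod (S j \<xi> k)) \<partial>angle_measure) \<le>
          (\<integral>\<^sup>+\<xi>. ennreal (a j k \<xi>) + ennreal (b j \<xi>) \<partial>angle_measure)"
        using S_le[of 1] nonneg by (intro nn_integral_mono) (simp add: ennreal_plus[symmetric] del: ennreal_plus)
      also have "\<dots> = ennreal (2 * pi) + ennreal (2 * pi * ell2_sq f)"
        by (subst nn_integral_add) (simp_all add: a_int b_int)
      also have "\<dots> = ennreal (2 * pi * (1 + ell2_sq f))"
        using ell2_sq_nonneg[of f] by (simp add: ennreal_plus[symmetric] distrib_left del: ennreal_plus)
      finally show ?thesis .
    qed
    have "(\<integral>\<^sup>+\<xi>. B j \<xi> \<partial>angle_measure) = (\<Sum>i. \<integral>\<^sup>+\<xi>. ennreal (1 / (real i + 1)\<^sup>2) *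
        (ennreal (cmod (S j \<xi> (int i))) + ennreal (cmod (S j \<xi> (- int i)))) \<partial>angle_measure)"
      unfolding B_def
      by (subst nn_integral_suminf)
         (simp_all add: ennreal_mult'[symmetric] ennreal_plus[symmetric] del: ennreal_plus)
    also have "\<dots> = (\<Sum>i. ennreal (1 / (real i + 1)\<^sup>2) * ((\<integral>\<^sup>+\<xi>. ennreal (cmod (S j \<xi> (int i))) \<partial>angle_measure)
        + (\<integral>\<^sup>+\<xi>. ennreal (cmod (S j \<xi> (- int i))) \<partial>angle_measure)))"
      by (simp add: nn_integral_cmult nn_integral_add)
    also have "\<dots> \<le> (\<Sum>i. ennreal (1 / (real i + 1)\<^sup>2) *
        (ennreal (2 * pi * (1 + ell2_sq f)) + ennreal (2 * pi * (1 + ell2_sq f))))"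
      by (intro suminf_le mult_left_mono add_mono S_int) auto
    also have "\<dots> = (\<Sum>i. ennreal (1 / (real i + 1)\<^sup>2 * (4 * pi * (1 + ell2_sq f))))"
      using ell2_sq_nonneg[of f]
      by (simp add: ennreal_mult'[symmetric] ennreal_plus[symmetric] mult.assoc del: ennreal_plus)
    also have "\<dots> = ennreal K"
      unfolding K_def using ell2_sq_nonneg[of f]
      by (intro suminf_ennreal2 summable_mult2 summable_inverse_Suc_square) simp
    finally show ?thesis .
  qed
  have B_bound: "cmod (S j \<xi> k) \<le> 2 * R * (1 + (real_of_int k)\<^sup>2)" if R: "0 \<le> R" "B j \<xi> \<le> ennreal R" for j \<xi> k R
  proof -
    define i where "i = nat \<bar>k\<bar>"
    have i: "(real i)\<^sup>2 = (real_of_int k)\<^sup>2" by (simp add: i_def)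
    have "ennreal ((cmod (S j \<xi> (int i)) + cmod (S j \<xi> (- int i))) / (real i + 1)\<^sup>2) \<le> B j \<xi>"
    proof -
      have "g i \<le> (\<Sum>i. g i)" for g :: "nat \<Rightarrow> ennreal"
        using sum_le_suminf[of g "{i}"] by (simp add: summableI)
      from this[of "\<lambda>i. ennreal ((cmod (S j \<xi> (int i)) + cmod (S j \<xi> (- int i))) / (real i + 1)\<^sup>2)"]
      show ?thesis unfolding B_def .
    qed
    also have "\<dots> \<le> ennreal R" by (rule R(2))
    finally have "(cmod (S j \<xi> (int i)) + cmod (S j \<xi> (- int i))) / (real i + 1)\<^sup>2 \<le> R"
      using R(1) by simp
    then have "cmod (S j \<xi> (int i)) + cmod (S j \<xi> (- int i)) \<le> R * (real i + 1)\<^sup>2"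
      by (simp add: pos_divide_le_eq)
    moreover have "cmod (S j \<xi> k) \<le> cmod (S j \<xi> (int i)) + cmod (S j \<xi> (- int i))"
    proof (cases "0 \<le> k")
      case True
      then have "S j \<xi> (int i) = S j \<xi> k" by (simp add: i_def)
      then show ?thesis by simp
    next
      case False
      then have "S j \<xi> (- int i) = S j \<xi> k" by (simp add: i_def)
      then show ?thesis by simp
    qed
    ultimately have "cmod (S j \<xi> k) \<le> R * (real i + 1)\<^sup>2" by linarith
    \<comment> \<open>The difference of the two sides is \<open>(i - 1)^2\<close>; this is the
      source of the factor 2 in the bound.\<close>
    also have "(real i + 1)\<^sup>2 \<le> 2 * (1 + (real_of_int k)\<^sup>2)"
      using zero_le_power2[of "real i - 1"] unfolding i[symmetric] by (simp add: power2_eq_square algebra_simps)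
    then have "R * (real i + 1)\<^sup>2 \<le> R * (2 * (1 + (real_of_int k)\<^sup>2))" using R(1) by (rule mult_left_mono)
    finally show ?thesis by (simp add: mult_ac)
  qed

  \<comment> \<open>One \<open>s\<close> pays for the basis vector and two for the bad angles.
    Uniform integrability is invoked with \<open>s^2\<close> because that contribution is divided by
    \<open>s\<close>.\<close>
  have "cmod (f k) \<le> 3 * s" if s: "0 < s" for s
  proof -
    obtain H :: nat where H: "\<And>n A. 0 < n \<Longrightarrow> A \<in> sets angle_measure \<Longrightarrow>
      (\<integral>\<^sup>+\<xi>\<in>A. ennreal (ell2_sq (wave n \<xi> f) / n) \<partial>angle_measure)
      \<le> ennreal (2 * pi) * (of_nat H * emeasure angle_measure A + ennreal (s\<^sup>2))"
      using wave_uniformly_integrable[OF f \<mu> ac, of "s\<^sup>2"] s by auto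
    \<comment> \<open>Large enough that \<open>H\<close> times the Markov bound \<open>K / R\<close>
      is at most \<open>s^2\<close>; the summand 1 keeps \<open>R\<close> positive.\<close>
    define R where "R = (real H * K + 1) / s\<^sup>2"
    have R: "0 < R" using K s by (auto simp: R_def intro!: divide_pos_pos add_nonneg_pos)
    have HK: "real H * (K / R) \<le> s\<^sup>2"
    proof -
      have "real H * K \<le> s\<^sup>2 * R" using s by (simp add: R_def)
      then show ?thesis using R by (simp add: pos_divide_le_eq)
    qed
    define u where "u j \<xi> = (if B j \<xi> \<le> ennreal R then cmod (S j \<xi> k) else 0)" for j \<xi>
    define A where "A j = {\<xi> \<in> space angle_measure. \<not> B j \<xi> \<le> ennreal R}" for j
    have [measurable]: "u j \<in> borel_measurable angle_measure" for j
      unfolding u_def[abs_def] by measurable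
    have A[measurable]: "A j \<in> sets angle_measure" for j unfolding A_def by measurable
    \<comment> \<open>On good angles the coordinate is bounded by a constant, and the limit-point
      argument gives pointwise convergence to 0.\<close>
    have lim: "(\<lambda>j. \<integral>\<^sup>+\<xi>. ennreal (u j \<xi>) \<partial>angle_measure) \<longlonglongrightarrow> (\<integral>\<^sup>+\<xi>. 0 \<partial>angle_measure)"
    proof (rule nn_integral_dominated_convergence)
      show "AE \<xi> in angle_measure. ennreal (u j \<xi>) \<le> ennreal (2 * R * (1 + (real_of_int k)\<^sup>2))" for j
        using B_bound[of R j _ k] R by (auto simp: u_def intro!: ennreal_leI)
      show "(\<integral>\<^sup>+\<xi>. ennreal (2 * R * (1 + (real_of_int k)\<^sup>2)) \<partial>angle_measure) < \<infinity>"
        by (simp add: L.emeasure_eq_measure ennreal_mult_less_top)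
      show "AE \<xi> in angle_measure. (\<lambda>j. ennreal (u j \<xi>)) \<longlonglongrightarrow> 0"
        using AE_a none
      proof eventually_elim
        case (elim \<xi>)
        have "(\<lambda>j. u j \<xi>) \<longlonglongrightarrow> 0"
          unfolding u_def
        proof (rule U_limit_point_vanishes[where z = "cis \<xi>" and C = "2 * R"])
          show "cmod (S j \<xi> k) \<le> 2 * R * (1 + (real_of_int k)\<^sup>2)" if "B j \<xi> \<le> ennreal R" for j k
            using B_bound[OF _ that] R by simp
          show "(\<lambda>j. U (S j \<xi>) k - cis \<xi> * S j \<xi> k) \<longlonglongrightarrow> 0" for k
            using elim(1) by (intro res) blast
          show "\<psi> k = 0" if "\<And>k. U \<psi> k = cis \<xi> * \<psi> k" "\<And>k. cmod (\<psi> k) \<le> 2 * R * (1 + (real_of_int k)\<^sup>2)" for \<psi> k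
            using elim(2) that by blast
        qed
        then show ?case using tendsto_ennrealI by fastforce
      qed
    qed measurable
    have "ennreal (2 * pi * cmod (f k)) \<le> (\<integral>\<^sup>+\<xi>. ennreal (u j \<xi>) \<partial>angle_measure) + ennreal (6 * pi * s)" for j
    proof -
      have "ennreal (2 * pi * cmod (f k)) = ennreal (norm (LINT \<xi>|angle_measure. S j \<xi> k))"
        unfolding S_def fejer_integral(2)[OF N] by (simp add: norm_mult)
      also have "\<dots> \<le> (\<integral>\<^sup>+\<xi>. ennreal (cmod (S j \<xi> k)) \<partial>angle_measure)"
        unfolding S_def by (rule integral_norm_bound_ennreal[OF fejer_integral(1)[OF N]])
      \<comment> \<open>On bad angles the two parts are treated differently: the basis vector is not
        assumed to have an absolutely continuous spectral measure, so \<open>a\<close> is merely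
        damped by \<open>s\<close>, while \<open>b\<close> may carry \<open>1 / s\<close> because it
        is uniformly integrable.\<close>
      also have "\<dots> \<le> (\<integral>\<^sup>+\<xi>. ennreal (u j \<xi>) + (ennreal s * ennreal (a j k \<xi>)
          + ennreal (1 / s) * (ennreal (b j \<xi>) * indicator (A j) \<xi>)) \<partial>angle_measure)"
      proof (rule nn_integral_mono)
        fix \<xi> assume \<xi>: "\<xi> \<in> space angle_measure"
        show "ennreal (cmod (S j \<xi> k)) \<le> ennreal (u j \<xi>) + (ennreal s * ennreal (a j k \<xi>)
          + ennreal (1 / s) * (ennreal (b j \<xi>) * indicator (A j) \<xi>))"
        proof (cases "B j \<xi> \<le> ennreal R")
          case True
          then show ?thesis by (simp add: u_def)
        next
          case False
          then have "\<xi> \<in> A j" using \<xi> by (simp add: A_def)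
          moreover have "ennreal (cmod (S j \<xi> k)) \<le> ennreal (s * a j k \<xi> + 1 / s * b j \<xi>)"
            using S_le[OF s, of j \<xi> k] by (intro ennreal_leI) simp
          moreover have "ennreal (s * a j k \<xi> + 1 / s * b j \<xi>) =
              ennreal s * ennreal (a j k \<xi>) + ennreal (1 / s) * ennreal (b j \<xi>)"
            using s nonneg(1)[of j k \<xi>] nonneg(2)[of j \<xi>]
            by (subst ennreal_plus) (simp_all add: ennreal_mult'[symmetric])
          ultimately show ?thesis using False by (simp add: u_def)
        qed
      qed
      also have "\<dots> = (\<integral>\<^sup>+\<xi>. ennreal (u j \<xi>) \<partial>angle_measure) + (ennreal s * ennreal (2 * pi)
          + ennreal (1 / s) * (\<integral>\<^sup>+\<xi>\<in>A j. ennreal (b j \<xi>) \<partial>angle_measure))"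
        by (simp add: nn_integral_add nn_integral_cmult a_int)
      also have "\<dots> \<le> (\<integral>\<^sup>+\<xi>. ennreal (u j \<xi>) \<partial>angle_measure) + (ennreal s * ennreal (2 * pi)
          + ennreal (1 / s) * (ennreal (2 * pi) * (ennreal (s\<^sup>2) + ennreal (s\<^sup>2))))"
      proof (intro add_left_mono mult_left_mono)
        \<comment> \<open>Markov's inequality for \<open>B\<close> bounds the measure of the bad
          angles by \<open>K / R\<close>, uniformly in \<open>j\<close>.\<close>
        have "emeasure angle_measure (A j) \<le>
            emeasure angle_measure {\<xi> \<in> space angle_measure. 1 \<le> ennreal (1 / R) * B j \<xi>}"
        proof (rule emeasure_mono)
          show "A j \<subseteq> {\<xi> \<in> space angle_measure. 1 \<le> ennreal (1 / R) * B j \<xi>}"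
          proof
            fix \<xi> assume "\<xi> \<in> A j"
            then have "\<xi> \<in> space angle_measure" "ennreal R \<le> B j \<xi>" by (auto simp: A_def)
            then have "ennreal (1 / R) * ennreal R \<le> ennreal (1 / R) * B j \<xi>" by (intro mult_left_mono) auto
            then show "\<xi> \<in> {\<xi> \<in> space angle_measure. 1 \<le> ennreal (1 / R) * B j \<xi>}"
              using R \<open>\<xi> \<in> space angle_measure\<close> by (simp add: ennreal_mult'[symmetric])
          qed
        qed measurable
        also have "\<dots> \<le> ennreal (1 / R) * (\<integral>\<^sup>+\<xi>. B j \<xi> * indicator (space angle_measure) \<xi> \<partial>angle_measure)"
          by (rule nn_integral_Markov_inequality) measurable
        also have "(\<integral>\<^sup>+\<xi>. B j \<xi> * indicator (space angle_measure) \<xi> \<partial>angle_measure) = (\<integral>\<^sup>+\<xi>. B j \<xi> \<partial>angle_measure)"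
          by (intro nn_integral_cong) simp
        also have "ennreal (1 / R) * \<dots> \<le> ennreal (1 / R) * ennreal K"
          by (intro mult_left_mono B_int) simp
        also have "\<dots> = ennreal (K / R)" using R by (simp add: ennreal_mult'[symmetric])
        finally have "of_nat H * emeasure angle_measure (A j) \<le> of_nat H * ennreal (K / R)"
          by (intro mult_left_mono) auto
        also have "\<dots> = ennreal (real H * (K / R))"
          by (simp add: ennreal_of_nat_eq_real_of_nat ennreal_mult'[symmetric])
        also have "\<dots> \<le> ennreal (s\<^sup>2)" using HK by (rule ennreal_leI)
        finally have "of_nat H * emeasure angle_measure (A j) \<le> ennreal (s\<^sup>2)" .
        then have "ennreal (2 * pi) * (of_nat H * emeasure angle_measure (A j) + ennreal (s\<^sup>2))
            \<le> ennreal (2 * pi) * (ennreal (s\<^sup>2) + ennreal (s\<^sup>2))"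
          by (intro mult_left_mono add_right_mono) auto
        with H[OF N A] show "(\<integral>\<^sup>+\<xi>\<in>A j. ennreal (b j \<xi>) \<partial>angle_measure)
            \<le> ennreal (2 * pi) * (ennreal (s\<^sup>2) + ennreal (s\<^sup>2))"
          unfolding b_def by (rule order_trans)
      qed auto
      also have "ennreal s * ennreal (2 * pi) + ennreal (1 / s) * (ennreal (2 * pi) * (ennreal (s\<^sup>2) + ennreal (s\<^sup>2)))
          = ennreal (s * (2 * pi) + 1 / s * (2 * pi * (s\<^sup>2 + s\<^sup>2)))"
        using s by (simp add: ennreal_mult'[symmetric] ennreal_plus[symmetric] del: ennreal_plus)
      also have "s * (2 * pi) + 1 / s * (2 * pi * (s\<^sup>2 + s\<^sup>2)) = 6 * pi * s"
        using s by (simp add: power2_eq_square)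
      finally show ?thesis .
    qed
    moreover have "(\<lambda>j. (\<integral>\<^sup>+\<xi>. ennreal (u j \<xi>) \<partial>angle_measure) + ennreal (6 * pi * s)) \<longlonglongrightarrow> 0 + ennreal (6 * pi * s)"
      using lim by (intro tendsto_add tendsto_const) simp
    ultimately have "ennreal (2 * pi * cmod (f k)) \<le> 0 + ennreal (6 * pi * s)"
      by (intro LIMSEQ_le_const) auto
    then have "2 * pi * cmod (f k) \<le> 2 * pi * (3 * s)" using s by simp
    then show ?thesis by simp
  qed
  then have "cmod (f k) \<le> e" if "0 < e" for e
    using that by (metis mult.commute nonzero_mult_div_cancel_left times_divide_eq_right zero_less_divide_iff zero_less_numeral zero_neq_numeral)
  then have "cmod (f k) \<le> 0" by (rule field_le_epsilon[of _ 0, simplified])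
  then show ?thesis by simp
qed

end

text \<open>On such a set \<open>T - z\<close> is the identity for every \<open>z\<close>, so no
  \<open>z\<close> belongs to the spectrum. Assuming an inclusion covers the empty set as
  well.\<close>

lemma spectrum_on_subset_zero:
  assumes "H \<subseteq> {\<lambda>_. 0}" "T (\<lambda>_. 0) = (\<lambda>_. 0)"
  shows "spectrum_on H T = {}"
proof -
  have zero: "g = (\<lambda>_. 0)" if "g \<in> H" for g using that assms(1) by auto
  have image: "(\<lambda>k. T g k - z * g k) = g" if "g \<in> H" for g z
    unfolding zero[OF that] assms(2) by simp
  have "bij_betw (\<lambda>g k. T g k - z * g k) H H" for z
    by (rule bij_betw_byWitness[where f' = id]) (auto simp: image)
  moreover have "ell2_norm g \<le> 1 * ell2_norm (\<lambda>k. T g k - z * g k)" if "g \<in> H" for g z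
    using image[OF that] by simp
  ultimately show ?thesis unfolding spectrum_on_def by (intro Collect_empty_eq[THEN iffD2] allI) blast
qed

theorem theorem4p1:
  fixes M :: "'a measure" and \<theta> \<alpha> :: "int \<Rightarrow> 'a \<Rightarrow> real" and r t :: real
  assumes "prob_space M"
    and "0 < t" and "t < 1" and "r = sqrt (1 - t\<^sup>2)"
    and "prob_space.indep_vars M (\<lambda>_. borel) (case_sum \<theta> \<alpha>) (UNIV :: (int + int) set)"
    and "\<And>k. distr M borel (\<theta> k) = uniform_measure lborel {0..<2 * pi}"
    and "\<And>k. distr M borel (\<alpha> k) = uniform_measure lborel {0..<2 * pi}"
  shows "AE \<omega> in M. ac_spectrum (band_op r t (\<lambda>k. \<theta> k \<omega>) (\<lambda>k. \<alpha> k \<omega>) (\<lambda>_. 0)) = {}"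
proof -
  interpret prob_space M by fact
  have "t\<^sup>2 < 1" using assms(2,3) by (simp add: power_less_one_iff)
  then have rt: "r\<^sup>2 + t\<^sup>2 = 1" using assms(4) by simp
  from AE_no_polynomially_bounded_eigenfunction[OF assms(2,3,4,5,6)]
  show ?thesis
  proof eventually_elim
    case (elim \<omega>)
    define U where "U = band_op r t (\<lambda>k. \<theta> k \<omega>) (\<lambda>k. \<alpha> k \<omega>) (\<lambda>_. 0)"
    obtain V where "band_unitary U V"
      unfolding U_def using band_op_band_unitary[OF rt] by blast
    then interpret band_unitary U V .
    have "ac_subspace U \<subseteq> {\<lambda>_. 0}"
    proof
      fix f assume "f \<in> ac_subspace U"
      then obtain \<mu> where "f \<in> ell2" "is_spectral_measure U f \<mu>" "absolutely_continuous circle_lebesgue \<mu>"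
        by (auto simp: ac_subspace_def)
      from ac_vector_vanishes[OF this elim[folded U_def angle_measure_def]]
      show "f \<in> {\<lambda>_. 0}" by auto
    qed
    then show ?case
      unfolding ac_spectrum_def U_def[symmetric] using U_zero by (rule spectrum_on_subset_zero)
  qed
qed

end
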